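(* Let $k$ be a field and let $R$ be a $k$-algebra which is oriented by three idempotents $e, e'_1, e'_2$. Put $e_i=e'_i+e$ and $A_i=e_iRe_i$ for $i=1,2$, and $C=eRe$. There exists a commutative diagram $$\begin{array}{ccccccccccc} &&\vdots&&\vdots&&\vdots&&\vdots&&\\ &&\downarrow&&\downarrow&&\downarrow&&\downarrow&&\\ \cdots&\to&{\rm H}^n(R,D(R))&\to&{\rm HC}^{n-1}(R)&\to&{\rm HC}^{n+1}(R)&\to&{\rm H}^{n+1}(R,D(R))&\to&\cdots\\ &&\downarrow&&\downarrow&&\downarrow&&\downarrow&&\\ \cdots&\to&\bigoplus_{i=1}^2{\rm H}^{n}(A_i,D(A_i))&\to&\bigoplus_{i=1}^2{\rm HC}^{n-1}(A_i)&\to&\bigoplus_{i=1}^2{\rm HC}^{n+1}(A_i)&\to&\bigoplus_{i=1}^2{\rm H}^{n+1}(A_i,D(A_i))&\to&\cdots\\ &&\downarrow&&\downarrow&&\downarrow&&\downarrow&&\\ \cdots&\to&{\rm H}^{n}(C,D(C))&\to&{\rm HC}^{n-1}(C)&\to&{\rm HC}^{n+1}(C)&\to&{\rm H}^{n+1}(C,D(C))&\to&\cdots\\ &&\downarrow&&\downarrow&&\downarrow&&\downarrow&&\\ \cdots&\to&{\rm H}^{n+1}(R,D(R))&\to&{\rm HC}^{n}(R)&\to&{\rm HC}^{n+2}(R)&\to&{\rm H}^{n+2}(R,D(R))&\to&\cdots\\ &&\downarrow&&\downarrow&&\downarrow&&\downarrow&&\\ &&\vdots&&\vdots&&\vdots&&\vdots&&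 \end{array}$$ in which the rows and columns are exact; the rows are the cohomological Connes exact sequences (of $R$, the direct sum of those of $A_1$ and $A_2$, and of $C$) and the columns are long exact Mayer--Vietoris sequences $\cdots\to X^n(R)\to X^n(A_1)\oplus X^n(A_2)\to X^n(C)\to X^{n+1}(R)\to\cdots$ for $X^n(\Lambda)={\rm H}^n(\Lambda,D(\Lambda))$ and $X^n(\Lambda)={\rm HC}^n(\Lambda)$.
   Context: Algebras are associative unital algebras over a field $k$; $\otimes=\otimes_k$; $D={\rm Hom}_k(-,k)$. An algebra $R$ is \emph{oriented} by $e,e'_1,e'_2$ if $e,e'_1,e'_2$ are orthogonal idempotents of $R$ with $1_R=e'_1+e+e'_2$, such that $e'_1Re'_2=e'_2Re'_1=0$ and at least one of the following holds: (1) $eRe'_1=eRe'_2=0$; (2) $e'_1Re=e'_2Re=0$; (3) $e'_1Re=eRe'_2=0$. The algebras $C$, $A_1$, $A_2$ have units $e$, $e_1$, $e_2$. ${\rm H}^n(\Lambda,N)={\rm Ext}^n_{\Lambda^e}(\Lambda,N)$ with $\Lambda^e=\Lambda\otimes\Lambda^{op}$. Cyclic cohomology: on $\Lambda^{\otimes n+1}$ let $b'(r_0\otimes\cdots\otimes r_n)=\sum_{i=0}^{n-1}(-1)^ir_0\otimes\cdots\otimes r_ir_{i+1}\otimes\cdots\otimes r_n$, $b(r_0\otimes\cdots\otimes r_n)=b'(r_0\otimes\cdots\otimes r_n)+(-1)^nr_nr_0\otimes r_1\otimes\cdots\otimes r_{n-1}$, $t(r_0\otimes\cdots\otimes r_n)=(-1)^nr_n\otimes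 r_0\otimes\cdots\otimes r_{n-1}$, $N=1+t+\cdots+t^n$. The cyclic bicomplex $CC(\Lambda)$ is the first quadrant bicomplex with $CC(\Lambda)_{p,q}=\Lambda^{\otimes q+1}$, vertical differential $b$ in even columns and $-b'$ in odd columns, horizontal differential $1-t$ from odd to even columns and $N$ from even to odd columns. Then ${\rm HC}^n(\Lambda)={\rm H}^n({\rm Tot}\,D(CC(\Lambda)))$. The cohomological Connes sequence $\cdots\to{\rm H}^n(\Lambda,D(\Lambda))\to{\rm HC}^{n-1}(\Lambda)\to{\rm HC}^{n+1}(\Lambda)\to{\rm H}^{n+1}(\Lambda,D(\Lambda))\to\cdots$ is the long exact sequence of the total complexes of $0\to D(CC(\Lambda))[2,0]\to D(CC(\Lambda))\to D(CC(\Lambda))^{\{2\}}\to0$, where $D(CC(\Lambda))^{\{2\}}$ consists of the first two columns (its total cohomology is ${\rm H}^*(\Lambda,D(\Lambda))$) and $[2,0]$ shifts by two columns. *)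

theory Defs
  imports Complex_Main "HOL-Algebra.Module" "HOL-Library.Function_Algebras"
begin

section \<open>Algebras and orientations\<close>

text \<open>
  A \<open>k\<close>-algebra is a type of class \<^class>\<open>ring\<close> with a \<open>k\<close>-bilinear multiplication and an explicit unit.
  (The class \<^class>\<open>ring_1\<close> would exclude the zero algebra.)  The subalgebras \<open>u R u\<close> with \<open>u\<close>
  idempotent have their own unit \<open>u\<close>; they are given by their carrier sets, and all constructions
  below take the carrier \<open>A\<close> of an algebra as a parameter.  For \<open>R\<close> itself, \<open>A = UNIV\<close>.
\<close>

locale k_algebra = vector_space scale
  for scale :: "'k::field \<Rightarrow> 'r::ring \<Rightarrow> 'r" +
  fixes unit :: 'r
  assumes scale_mult_left: "scale c x * y = scale c (x * y)"
    and scale_mult_right: "x * scale c y = scale c (x * y)"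
    and unit_left: "unit * x = x"
    and unit_right: "x * unit = x"

definition corner :: "'r::ring \<Rightarrow> 'r set" where
  "corner u = range (\<lambda>x. u * x * u)"

definition oriented :: "'r::ring \<Rightarrow> 'r \<Rightarrow> 'r \<Rightarrow> 'r \<Rightarrow> bool" where
  "oriented unit e e1' e2' \<longleftrightarrow>
     e * e = e \<and> e1' * e1' = e1' \<and> e2' * e2' = e2' \<and>
     e * e1' = 0 \<and> e1' * e = 0 \<and> e * e2' = 0 \<and> e2' * e = 0 \<and> e1' * e2' = 0 \<and> e2' * e1' = 0 \<and>
     unit = e1' + e + e2' \<and>
     (\<forall>x. e1' * x * e2' = 0) \<and> (\<forall>x. e2' * x * e1' = 0) \<and>
     ((\<forall>x. e * x * e1' = 0) \<and> (\<forall>x. e * x * e2' = 0) \<or>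
      (\<forall>x. e1' * x * e = 0) \<and> (\<forall>x. e2' * x * e = 0) \<or>
      (\<forall>x. e1' * x * e = 0) \<and> (\<forall>x. e * x * e2' = 0))"

section \<open>Vector spaces with carriers, cohomology, exactness\<close>

text \<open>
  Cohomology spaces are records of type \<open>('k, 'v) module\<close>; of these only the fields \<^const>\<open>carrier\<close>,
  \<^const>\<open>zero\<close>, \<^const>\<open>add\<close> and \<^const>\<open>smult\<close> matter.
\<close>

definition linear_map :: "('k, 'v) module \<Rightarrow> ('k, 'w) module \<Rightarrow> ('v \<Rightarrow> 'w) \<Rightarrow> bool" where
  "linear_map V W f \<longleftrightarrow>
     f \<in> carrier V \<rightarrow> carrier W \<and>
     (\<forall>x\<in>carrier V. \<forall>y\<in>carrier V. f (x \<oplus>\<^bsub>V\<^esub> y) = f x \<oplus>\<^bsub>W\<^esub> f y) \<and>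
     (\<forall>c. \<forall>x\<in>carrier V. f (c \<odot>\<^bsub>V\<^esub> x) = c \<odot>\<^bsub>W\<^esub> f x)"

definition exact_pair ::
  "('k, 'u) module \<Rightarrow> ('u \<Rightarrow> 'v) \<Rightarrow> ('k, 'v) module \<Rightarrow> ('v \<Rightarrow> 'w) \<Rightarrow> ('k, 'w) module \<Rightarrow> bool" where
  "exact_pair U f V g W \<longleftrightarrow>
     linear_map U V f \<and> linear_map V W g \<and> f ` carrier U = {v \<in> carrier V. g v = \<zero>\<^bsub>W\<^esub>}"

text \<open>Exactness of
  \<open>\<cdots> \<rightarrow> X n \<rightarrow> Y n \<rightarrow> Z n \<rightarrow> X (n + 1) \<rightarrow> \<cdots>\<close> with maps \<open>f n\<close>, \<open>g n\<close>, \<open>h n\<close>, for all integers \<open>n\<close>.\<close>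

definition long_exact ::
  "(int \<Rightarrow> ('k, 'x) module) \<Rightarrow> (int \<Rightarrow> ('k, 'y) module) \<Rightarrow> (int \<Rightarrow> ('k, 'z) module) \<Rightarrow>
   (int \<Rightarrow> 'x \<Rightarrow> 'y) \<Rightarrow> (int \<Rightarrow> 'y \<Rightarrow> 'z) \<Rightarrow> (int \<Rightarrow> 'z \<Rightarrow> 'x) \<Rightarrow> bool" where
  "long_exact X Y Z f g h \<longleftrightarrow>
     (\<forall>n. exact_pair (X n) (f n) (Y n) (g n) (Z n) \<and>
          exact_pair (Y n) (g n) (Z n) (h n) (X (n + 1)) \<and>
          exact_pair (Z n) (h n) (X (n + 1)) (f (n + 1)) (Y (n + 1)))"

text \<open>Commutativity of all squares between the sequence \<open>f, g, h\<close> on \<open>X, Y, Z\<close> and a second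
  sequence of the same shape with maps \<open>f', g', h'\<close>, where \<open>a, b, c\<close> are the connecting verticals.\<close>

definition commuting_ladder ::
  "(int \<Rightarrow> ('k, 'x) module) \<Rightarrow> (int \<Rightarrow> ('k, 'y) module) \<Rightarrow> (int \<Rightarrow> ('k, 'z) module) \<Rightarrow>
   (int \<Rightarrow> 'x \<Rightarrow> 'y) \<Rightarrow> (int \<Rightarrow> 'y \<Rightarrow> 'z) \<Rightarrow> (int \<Rightarrow> 'z \<Rightarrow> 'x) \<Rightarrow>
   (int \<Rightarrow> 'x2 \<Rightarrow> 'y2) \<Rightarrow> (int \<Rightarrow> 'y2 \<Rightarrow> 'z2) \<Rightarrow> (int \<Rightarrow> 'z2 \<Rightarrow> 'x2) \<Rightarrow>
   (int \<Rightarrow> 'x \<Rightarrow> 'x2) \<Rightarrow> (int \<Rightarrow> 'y \<Rightarrow> 'y2) \<Rightarrow> (int \<Rightarrow> 'z \<Rightarrow> 'z2) \<Rightarrow> bool" where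
  "commuting_ladder X Y Z f g h f' g' h' a b c \<longleftrightarrow>
     (\<forall>n. (\<forall>x\<in>carrier (X n). b n (f n x) = f' n (a n x)) \<and>
          (\<forall>y\<in>carrier (Y n). c n (g n y) = g' n (b n y)) \<and>
          (\<forall>z\<in>carrier (Z n). a (n + 1) (h n z) = h' n (c n z)))"

definition dsum :: "('k, 'v) module \<Rightarrow> ('k, 'w) module \<Rightarrow> ('k, 'v \<times> 'w) module" (infixr "\<boxplus>" 65) where
  "V \<boxplus> W =
     \<lparr>carrier = carrier V \<times> carrier W, mult = undefined, one = undefined,
      zero = (\<zero>\<^bsub>V\<^esub>, \<zero>\<^bsub>W\<^esub>),
      add = (\<lambda>(v, w) (v', w'). (v \<oplus>\<^bsub>V\<^esub> v', w \<oplus>\<^bsub>W\<^esub> w')),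
      smult = (\<lambda>c (v, w). (c \<odot>\<^bsub>V\<^esub> v, c \<odot>\<^bsub>W\<^esub> w))\<rparr>"

text \<open>\<open>H\<^sup>n\<close> of a cochain complex with terms \<open>X n\<close>, as the space of cosets of the coboundaries.\<close>

definition cohomology ::
  "('k \<Rightarrow> 'c \<Rightarrow> 'c) \<Rightarrow> (int \<Rightarrow> 'c::ab_group_add set) \<Rightarrow> ('c \<Rightarrow> 'c) \<Rightarrow> int \<Rightarrow> ('k, 'c set) module" where
  "cohomology sc X d n =
     \<lparr>carrier = (\<lambda>z. (\<lambda>b. z + b) ` d ` X (n - 1)) ` {z \<in> X n. d z = 0},
      mult = undefined, one = undefined,
      zero = d ` X (n - 1),
      add = (\<lambda>U V. {u + v | u v. u \<in> U \<and> v \<in> V}),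
      smult = (\<lambda>c U. {sc c u + b | u b. u \<in> U \<and> b \<in> d ` X (n - 1)})\<rparr>"

text \<open>The map into the cohomology space \<open>W\<close> sending the class of \<open>z\<close> to the class of \<open>\<phi> z\<close>
  (recall that \<open>\<zero>\<^bsub>W\<^esub>\<close> is the set of coboundaries).\<close>

definition induced :: "('k, 'd::ab_group_add set) module \<Rightarrow> ('c \<Rightarrow> 'd) \<Rightarrow> 'c set \<Rightarrow> 'd set" where
  "induced W \<phi> U = (\<Union>u\<in>U. (\<lambda>b. \<phi> u + b) ` \<zero>\<^bsub>W\<^esub>)"

section \<open>Tensor powers\<close>

text \<open>
  By the universal property of \<open>\<otimes>\<close>, a linear map \<open>A\<^sup>\<otimes>\<^sup>m \<rightarrow> N\<close> is an \<open>m\<close>-linear map on \<open>A\<close>.  It is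
  represented by a function on lists over \<open>A\<close>, extended by \<open>0\<close> outside its domain, the list
  \<open>[r\<^sub>0, \<dots>, r\<^sub>n]\<close> standing for \<open>r\<^sub>0 \<otimes> \<cdots> \<otimes> r\<^sub>n\<close>.
\<close>

definition multilinear_on ::
  "('k \<Rightarrow> 'r::ring \<Rightarrow> 'r) \<Rightarrow> 'r set \<Rightarrow> ('k \<Rightarrow> 'n \<Rightarrow> 'n) \<Rightarrow> ('r list \<Rightarrow> 'n::ab_group_add) \<Rightarrow> bool" where
  "multilinear_on scale A scaleN f \<longleftrightarrow>
     (\<forall>xs ys. set xs \<subseteq> A \<longrightarrow> set ys \<subseteq> A \<longrightarrow>
        (\<forall>x\<in>A. \<forall>y\<in>A. f (xs @ (x + y) # ys) = f (xs @ x # ys) + f (xs @ y # ys)) \<and>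
        (\<forall>c. \<forall>x\<in>A. f (xs @ scale c x # ys) = scaleN c (f (xs @ x # ys))))"

text \<open>\<open>r\<^sub>0 \<otimes> \<cdots> \<otimes> r\<^sub>i r\<^sub>i\<^sub>+\<^sub>1 \<otimes> \<cdots> \<otimes> r\<^sub>n\<close>, then \<open>r\<^sub>n r\<^sub>0 \<otimes> r\<^sub>1 \<otimes> \<cdots> \<otimes> r\<^sub>n\<^sub>-\<^sub>1\<close>, then \<open>r\<^sub>n \<otimes> r\<^sub>0 \<otimes> \<cdots> \<otimes> r\<^sub>n\<^sub>-\<^sub>1\<close>.\<close>

definition face :: "nat \<Rightarrow> 'r::ring list \<Rightarrow> 'r list" where
  "face i xs = take i xs @ (xs ! i * xs ! Suc i) # drop (i + 2) xs"

definition cyclic_face :: "'r::ring list \<Rightarrow> 'r list" where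
  "cyclic_face xs = (last xs * hd xs) # butlast (tl xs)"

definition rotate_right :: "'r list \<Rightarrow> 'r list" where
  "rotate_right xs = last xs # butlast xs"

section \<open>Hochschild cohomology\<close>

record ('k, 'r, 'n) bimodule =
  bcarrier :: "'n set"
  bscale :: "'k \<Rightarrow> 'n \<Rightarrow> 'n"
  lact :: "'r \<Rightarrow> 'n \<Rightarrow> 'n"
  ract :: "'n \<Rightarrow> 'r \<Rightarrow> 'n"

text \<open>
  \<open>Ext\<close> over \<open>A\<^sup>e\<close> is computed with the bar resolution of \<open>A\<close> by the free (\<open>k\<close> being a field)
  \<open>A\<^sup>e\<close>-modules \<open>A \<otimes> A\<^sup>\<otimes>\<^sup>n \<otimes> A\<close>, with differential \<open>b'\<close>.  So \<open>bar_cochains\<close> in degree \<open>n\<close> is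
  \<open>Hom(A \<otimes> A\<^sup>\<otimes>\<^sup>n \<otimes> A, N)\<close> over \<open>A\<^sup>e\<close>, in the form of \<open>(n + 2)\<close>-linear maps commuting with the outer
  actions of \<open>A\<close>; it is zero for \<open>n < 0\<close>.
\<close>

definition bar_cochains ::
  "('k \<Rightarrow> 'r::ring \<Rightarrow> 'r) \<Rightarrow> 'r set \<Rightarrow> ('k, 'r, 'n::ab_group_add) bimodule \<Rightarrow> int \<Rightarrow> ('r list \<Rightarrow> 'n) set"
  where
  "bar_cochains scale A N n =
     {F. (\<forall>xs. F xs \<in> bcarrier N) \<and>
         (\<forall>xs. F xs \<noteq> 0 \<longrightarrow> 2 \<le> length xs \<and> int (length xs) = n + 2 \<and> set xs \<subseteq> A) \<and>
         multilinear_on scale A (bscale N) F \<and>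
         (\<forall>a\<in>A. \<forall>x\<in>A. \<forall>y\<in>A. \<forall>xs. set xs \<subseteq> A \<longrightarrow>
            F ((a * x) # xs @ [y]) = lact N a (F (x # xs @ [y])) \<and>
            F (x # xs @ [y * a]) = ract N (F (x # xs @ [y])) a)}"

definition bar_diff ::
  "'r set \<Rightarrow> ('k::field, 'r::ring, 'n::ab_group_add) bimodule \<Rightarrow> ('r list \<Rightarrow> 'n) \<Rightarrow> 'r list \<Rightarrow> 'n" where
  "bar_diff A N F xs =
     (if 2 \<le> length xs \<and> set xs \<subseteq> A
      then \<Sum>i<length xs - 1. bscale N ((- 1) ^ i) (F (face i xs)) else 0)"

definition hochschild ::
  "('k::field \<Rightarrow> 'r::ring \<Rightarrow> 'r) \<Rightarrow> 'r set \<Rightarrow> ('k, 'r, 'n::ab_group_add) bimodule \<Rightarrow> int \<Rightarrow>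
   ('k, ('r list \<Rightarrow> 'n) set) module" where
  "hochschild scale A N =
     cohomology (\<lambda>c F xs. bscale N c (F xs)) (bar_cochains scale A N) (bar_diff A N)"

text \<open>\<open>D(A) = Hom\<^sub>k(A, k)\<close> with \<open>(a \<phi> b)(x) = \<phi>(b x a)\<close>.\<close>

definition dual_bimodule ::
  "('k::field \<Rightarrow> 'r::ring \<Rightarrow> 'r) \<Rightarrow> 'r set \<Rightarrow> ('k, 'r, 'r \<Rightarrow> 'k) bimodule" where
  "dual_bimodule scale A =
     \<lparr>bcarrier = {\<phi>. (\<forall>x\<in>A. \<forall>y\<in>A. \<phi> (x + y) = \<phi> x + \<phi> y) \<and>
                     (\<forall>c. \<forall>x\<in>A. \<phi> (scale c x) = c * \<phi> x) \<and> (\<forall>x. x \<notin> A \<longrightarrow> \<phi> x = 0)},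
      bscale = (\<lambda>c \<phi> x. c * \<phi> x),
      lact = (\<lambda>a \<phi> x. if x \<in> A then \<phi> (x * a) else 0),
      ract = (\<lambda>\<phi> b x. if x \<in> A then \<phi> (b * x) else 0)\<rparr>"

definition HH ::
  "('k::field \<Rightarrow> 'r::ring \<Rightarrow> 'r) \<Rightarrow> 'r set \<Rightarrow> int \<Rightarrow> ('k, ('r list \<Rightarrow> 'r \<Rightarrow> 'k) set) module" where
  "HH scale A = hochschild scale A (dual_bimodule scale A)"

section \<open>Cyclic cohomology\<close>

text \<open>Precomposition of a form with \<open>b'\<close>, \<open>b\<close>, \<open>t\<close> and \<open>N\<close>; a list of length \<open>n + 1\<close> is an element of
  \<open>A\<^sup>\<otimes>\<^sup>n\<^sup>+\<^sup>1\<close>.  The map \<open>b\<close> vanishes on \<open>A\<close>, whence the case distinction.\<close>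

definition dual_b' :: "('r::ring list \<Rightarrow> 'k::field) \<Rightarrow> 'r list \<Rightarrow> 'k" where
  "dual_b' f xs = (\<Sum>i<length xs - 1. (- 1) ^ i * f (face i xs))"

definition dual_b :: "('r::ring list \<Rightarrow> 'k::field) \<Rightarrow> 'r list \<Rightarrow> 'k" where
  "dual_b f xs =
     dual_b' f xs + (if 2 \<le> length xs then (- 1) ^ (length xs - 1) * f (cyclic_face xs) else 0)"

definition dual_t :: "('r::ring list \<Rightarrow> 'k::field) \<Rightarrow> 'r list \<Rightarrow> 'k" where
  "dual_t f xs = (- 1) ^ (length xs - 1) * f (rotate_right xs)"

definition dual_N :: "('r::ring list \<Rightarrow> 'k::field) \<Rightarrow> 'r list \<Rightarrow> 'k" where
  "dual_N f xs = (\<Sum>j<length xs. (dual_t ^^ j) f xs)"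

text \<open>
  The total complex of the columns \<open>p \<in> P\<close> of \<open>D(CC(A))\<close>.  In a cochain \<open>f\<close> of degree \<open>n\<close>, the form
  \<open>f p\<close> is the component in \<open>D(CC(A)\<^bsub>p,n-p\<^esub>) = D(A\<^bsup>\<otimes>n-p+1\<^esup>)\<close>.
\<close>

definition tot_cochains ::
  "('k::field \<Rightarrow> 'r::ring \<Rightarrow> 'r) \<Rightarrow> 'r set \<Rightarrow> nat set \<Rightarrow> int \<Rightarrow> (nat \<Rightarrow> 'r list \<Rightarrow> 'k) set" where
  "tot_cochains scale A P n =
     {f. (\<forall>p. multilinear_on scale A (*) (f p)) \<and>
         (\<forall>p xs. f p xs \<noteq> 0 \<longrightarrow>
            p \<in> P \<and> xs \<noteq> [] \<and> set xs \<subseteq> A \<and> int p + (int (length xs) - 1) = n)}"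

definition tot_diff ::
  "'r::ring set \<Rightarrow> nat set \<Rightarrow> (nat \<Rightarrow> 'r list \<Rightarrow> 'k::field) \<Rightarrow> nat \<Rightarrow> 'r list \<Rightarrow> 'k" where
  "tot_diff A P f p xs =
     (if p \<in> P \<and> xs \<noteq> [] \<and> set xs \<subseteq> A then
        (if even p then dual_b (f p) xs else - dual_b' (f p) xs) +
        (if p = 0 then 0
         else if odd p then f (p - 1) xs - dual_t (f (p - 1)) xs
         else dual_N (f (p - 1)) xs)
      else 0)"

definition tot_cohomology ::
  "('k::field \<Rightarrow> 'r::ring \<Rightarrow> 'r) \<Rightarrow> 'r set \<Rightarrow> nat set \<Rightarrow> int \<Rightarrow>
   ('k, (nat \<Rightarrow> 'r list \<Rightarrow> 'k) set) module" where
  "tot_cohomology scale A P =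
     cohomology (\<lambda>c f p xs. c * f p xs) (tot_cochains scale A P) (tot_diff A P)"

definition HC ::
  "('k::field \<Rightarrow> 'r::ring \<Rightarrow> 'r) \<Rightarrow> 'r set \<Rightarrow> int \<Rightarrow> ('k, (nat \<Rightarrow> 'r list \<Rightarrow> 'k) set) module" where
  "HC scale A = tot_cohomology scale A UNIV"

section \<open>The Connes sequence\<close>

abbreviation HC2 ::
  "('k::field \<Rightarrow> 'r::ring \<Rightarrow> 'r) \<Rightarrow> 'r set \<Rightarrow> int \<Rightarrow> ('k, (nat \<Rightarrow> 'r list \<Rightarrow> 'k) set) module" where
  "HC2 scale A \<equiv> tot_cohomology scale A {0, 1}"

text \<open>
  The isomorphism between the cohomology of the two-column complex and \<open>H\<^sup>*(A, D(A))\<close>: project to the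
  column \<open>p = 0\<close> (the column \<open>p = 1\<close> is acyclic) and let the form \<open>g\<close> on \<open>A\<^sup>\<otimes>\<^sup>n\<^sup>+\<^sup>1\<close> correspond to
  \<open>F(x \<otimes> r\<^sub>1 \<otimes> \<cdots> \<otimes> r\<^sub>n \<otimes> y)(r) = g(y r x \<otimes> r\<^sub>1 \<otimes> \<cdots> \<otimes> r\<^sub>n)\<close>.
\<close>

definition to_bar :: "'r::ring set \<Rightarrow> (nat \<Rightarrow> 'r list \<Rightarrow> 'k::field) \<Rightarrow> 'r list \<Rightarrow> 'r \<Rightarrow> 'k" where
  "to_bar A g xs r =
     (if 2 \<le> length xs \<and> set xs \<subseteq> A \<and> r \<in> A
      then g 0 ((last xs * r * hd xs) # butlast (tl xs)) else 0)"

definition HC2_to_HH ::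
  "('k::field \<Rightarrow> 'r::ring \<Rightarrow> 'r) \<Rightarrow> 'r set \<Rightarrow> int \<Rightarrow>
   (nat \<Rightarrow> 'r list \<Rightarrow> 'k) set \<Rightarrow> ('r list \<Rightarrow> 'r \<Rightarrow> 'k) set" where
  "HC2_to_HH scale A n = induced (HH scale A n) (to_bar A)"

text \<open>
  The maps of the long exact sequence of \<open>0 \<rightarrow> D(CC(A))[2,0] \<rightarrow> D(CC(A)) \<rightarrow> D(CC(A))\<^sup>{\<^sup>2\<^sup>} \<rightarrow> 0\<close>:
  \<open>B: H\<^sup>n(A, D(A)) \<rightarrow> HC\<^sup>n\<^sup>-\<^sup>1(A)\<close>, \<open>S: HC\<^sup>n\<^sup>-\<^sup>1(A) \<rightarrow> HC\<^sup>n\<^sup>+\<^sup>1(A)\<close> and \<open>I: HC\<^sup>n\<^sup>+\<^sup>1(A) \<rightarrow> H\<^sup>n\<^sup>+\<^sup>1(A, D(A))\<close>,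
  all at index \<open>n\<close>.  The connecting map \<open>B\<close> lifts a two-column cocycle (by zero), applies the
  differential of \<open>D(CC(A))\<close>, and reads the result in \<open>D(CC(A))[2,0]\<close>.
\<close>

definition connes_B ::
  "('k::field \<Rightarrow> 'r::ring \<Rightarrow> 'r) \<Rightarrow> 'r set \<Rightarrow> int \<Rightarrow>
   ('r list \<Rightarrow> 'r \<Rightarrow> 'k) set \<Rightarrow> (nat \<Rightarrow> 'r list \<Rightarrow> 'k) set" where
  "connes_B scale A n =
     induced (HC scale A (n - 1)) (\<lambda>g p. tot_diff A UNIV g (p + 2)) \<circ>
     inv_into (carrier (HC2 scale A n)) (HC2_to_HH scale A n)"

definition connes_S ::
  "('k::field \<Rightarrow> 'r::ring \<Rightarrow> 'r) \<Rightarrow> 'r set \<Rightarrow> int \<Rightarrow>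
   (nat \<Rightarrow> 'r list \<Rightarrow> 'k) set \<Rightarrow> (nat \<Rightarrow> 'r list \<Rightarrow> 'k) set" where
  "connes_S scale A n =
     induced (HC scale A (n + 1)) (\<lambda>f p. if 2 \<le> p then f (p - 2) else 0)"

definition connes_I ::
  "('k::field \<Rightarrow> 'r::ring \<Rightarrow> 'r) \<Rightarrow> 'r set \<Rightarrow> int \<Rightarrow>
   (nat \<Rightarrow> 'r list \<Rightarrow> 'k) set \<Rightarrow> ('r list \<Rightarrow> 'r \<Rightarrow> 'k) set" where
  "connes_I scale A n =
     HC2_to_HH scale A (n + 1) \<circ>
     induced (HC2 scale A (n + 1)) (\<lambda>f p. if p < 2 then f p else 0)"

section \<open>Mayer--Vietoris maps\<close>

text \<open>Restriction of cochains to the carrier \<open>A\<close> of a subalgebra (possibly with a different unit).\<close>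

definition res_HH ::
  "('k::field \<Rightarrow> 'r::ring \<Rightarrow> 'r) \<Rightarrow> 'r set \<Rightarrow> int \<Rightarrow>
   ('r list \<Rightarrow> 'r \<Rightarrow> 'k) set \<Rightarrow> ('r list \<Rightarrow> 'r \<Rightarrow> 'k) set" where
  "res_HH scale A n =
     induced (HH scale A n) (\<lambda>F xs r. if set xs \<subseteq> A \<and> r \<in> A then F xs r else 0)"

definition res_HC ::
  "('k::field \<Rightarrow> 'r::ring \<Rightarrow> 'r) \<Rightarrow> 'r set \<Rightarrow> int \<Rightarrow>
   (nat \<Rightarrow> 'r list \<Rightarrow> 'k) set \<Rightarrow> (nat \<Rightarrow> 'r list \<Rightarrow> 'k) set" where
  "res_HC scale A n = induced (HC scale A n) (\<lambda>f p xs. if set xs \<subseteq> A then f p xs else 0)"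

definition mv_pair :: "(int \<Rightarrow> 'x \<Rightarrow> 'y) \<Rightarrow> (int \<Rightarrow> 'x \<Rightarrow> 'z) \<Rightarrow> int \<Rightarrow> 'x \<Rightarrow> 'y \<times> 'z" where
  "mv_pair \<rho>1 \<rho>2 n x = (\<rho>1 n x, \<rho>2 n x)"

definition mv_diff ::
  "(int \<Rightarrow> ('k, 'z) module) \<Rightarrow> (int \<Rightarrow> 'y \<Rightarrow> 'z) \<Rightarrow> int \<Rightarrow> 'y \<times> 'y \<Rightarrow> 'z" where
  "mv_diff V \<rho> n = (\<lambda>(y1, y2). \<rho> n y1 \<ominus>\<^bsub>V n\<^esub> \<rho> n y2)"

end

(* A cochain with values in the dual is a multilinear form, so all complexes involved are total
   complexes of columns of the dual cyclic bicomplex: all columns for HC, the first two for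
   H(-, D(-)).  Forms on R restrict to pairs of forms on A1 and A2 that agree on C, and the forms
   vanishing on A1 and on A2 are an acyclic kernel.  Indeed, inserting the idempotents e1', e, e2'
   contracts each column of the kernel up to a sum over closed walks in the Peirce decomposition,
   and the orientation forces a closed walk of nonzero elements to stay at one vertex, hence in A1
   or in A2, where the forms vanish.  The Mayer--Vietoris sequences are the long exact sequences of
   these restrictions. *)

theory Submission
  imports Defs "HOL-Library.Product_Plus"
begin

text \<open>In general the restriction to \<open>A1\<close> and \<open>A2\<close> is not injective
  on forms, so there is no short exact sequence to start from. The snake lemma is therefore proved
  for a sequence that is exact in the middle and on the right and whose left map has an acyclic
  kernel; cocycles are lifted with a correction from this kernel.

  Inserting the unit of \<open>R\<close> would not contract the kernel: the unit need not lie in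
  \<open>A1\<close> or \<open>A2\<close>, so vanishing on them would be lost. An idempotent
  \<open>v i\<close>, in contrast, either lies in such a corner or annihilates it from the right.
  The three kinds of orientation are treated at once by a rank on the vertices that every nonzero
  step between different vertices raises.

  Hochschild cohomology is defined by bar cochains, but it is presented by the cocycles of the first
  two columns, the second column being contracted by inserting the unit. All maps of the diagram are
  thereby computed on families of forms.\<close>

section \<open>Identities in the cyclic bicomplex\<close>

lemma face_0: "face 0 (x # y # xs) = x * y # xs"
  by (simp add: face_def)

lemma face_Suc: "face (Suc i) (x # xs) = x # face i xs"
  by (simp add: face_def)

lemma length_face: "Suc i < length xs \<Longrightarrow> length (face i xs) = length xs - 1"
  by (simp add: face_def)

lemma set_face:
  assumes "Suc i < length xs" "set xs \<subseteq> A" "\<And>x y. x \<in> A \<Longrightarrow> y \<in> A \<Longrightarrow> x * y \<in> A"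
  shows "set (face i xs) \<subseteq> A"
proof -
  have "xs ! i \<in> A" "xs ! Suc i \<in> A"
    using assms(1,2) by (auto intro: subsetD[OF _ nth_mem])
  then show ?thesis
    using assms(2,3) by (auto simp: face_def dest: in_set_takeD in_set_dropD)
qed

lemma dual_b'_short [simp]: "dual_b' f [] = 0" "dual_b' f [x] = 0"
  by (simp_all add: dual_b'_def)

text \<open>The faces other than the first keep the first entry, so it can be moved into the form,
  and each of them loses one sign. This recursion replaces index arithmetic in the inductions on
  \<open>b'\<close>.\<close>

lemma dual_b'_Cons2:
  "dual_b' f (x # y # ys) = f (x * y # ys) - dual_b' (\<lambda>zs. f (x # zs)) (y # ys)"
  unfolding dual_b'_def
  by (simp add: sum.lessThan_Suc_shift face_0 face_Suc sum_negf flip: lessThan_Suc_atMost del: sum.lessThan_Suc)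

lemma dual_b'_cong:
  assumes "\<And>zs. zs \<noteq> [] \<Longrightarrow> Suc (length zs) = length xs \<Longrightarrow> set zs \<subseteq> A \<Longrightarrow> f zs = g zs"
    and "set xs \<subseteq> A" "\<And>x y. x \<in> A \<Longrightarrow> y \<in> A \<Longrightarrow> x * y \<in> A"
  shows "dual_b' f xs = dual_b' g xs"
proof -
  have "f (face i xs) = g (face i xs)" if "i < length xs - 1" for i
  proof (rule assms(1))
    show "Suc (length (face i xs)) = length xs" "face i xs \<noteq> []" "set (face i xs) \<subseteq> A"
      using that length_face[of i xs] set_face[of i xs A] assms(2,3)
      by (auto simp: face_def)
  qed
  then show ?thesis by (simp add: dual_b'_def)
qed

lemma dual_b'_minus: "dual_b' (\<lambda>zs. f zs - g zs) xs = dual_b' f xs - dual_b' g xs"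
  by (simp add: dual_b'_def sum_subtractf right_diff_distrib)

lemma dual_b'_cmult: "dual_b' (\<lambda>zs. c * f zs) xs = c * dual_b' f xs"
  by (simp add: dual_b'_def sum_distrib_left mult.left_commute)

lemma dual_b'_sum: "dual_b' (\<lambda>zs. \<Sum>i\<in>I. f i zs) xs = (\<Sum>i\<in>I. dual_b' (f i) xs)"
  unfolding dual_b'_def sum_distrib_left by (rule sum.swap)

lemma dual_b'_cong_UNIV:
  assumes "\<And>zs. zs \<noteq> [] \<Longrightarrow> Suc (length zs) = length xs \<Longrightarrow> f zs = g zs"
  shows "dual_b' f xs = dual_b' g xs"
  by (rule dual_b'_cong[of xs UNIV]) (use assms in auto)

text \<open>Left multiplication of the first entry commutes with every face: by associativity with
  the first one, trivially with the others.\<close>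

lemma dual_b'_hd:
  "dual_b' (\<lambda>zs. f (a * hd zs # tl zs)) (y # ys) = dual_b' f (a * y # ys)"
  by (cases ys) (simp_all add: dual_b'_Cons2 mult.assoc)

lemma dual_b'_dual_b': "dual_b' (dual_b' f) xs = 0"
proof (induction xs arbitrary: f)
  case (Cons x xs)
  show ?case
  proof (cases xs)
    case (Cons y ys)
    \<comment> \<open>The inner \<open>b'\<close> splits into a form with \<open>x\<close>
      multiplied into its first entry, which reproduces the first face of the whole, and a form with
      \<open>x\<close> frozen, which dies by induction.\<close>
    have "dual_b' (\<lambda>zs. dual_b' f (x # zs)) (y # ys)
      = dual_b' (\<lambda>zs. f (x * hd zs # tl zs) - dual_b' (\<lambda>ws. f (x # ws)) zs) (y # ys)"
      by (rule dual_b'_cong_UNIV) (auto simp: neq_Nil_conv dual_b'_Cons2)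
    also have "\<dots> = dual_b' f (x * y # ys)"
      using Cons.IH[of "\<lambda>ws. f (x # ws)"] Cons by (simp add: dual_b'_minus dual_b'_hd)
    finally show ?thesis using Cons by (simp add: dual_b'_Cons2)
  qed simp
qed simp

text \<open>The wrap-around face of \<open>b\<close>, kept apart from \<open>b'\<close>: inserting
  idempotents contracts \<open>b'\<close> outright, and only this summand leaves a
  remainder.\<close>

definition dual_c :: "('r::ring list \<Rightarrow> 'k::field) \<Rightarrow> 'r list \<Rightarrow> 'k" where
  "dual_c f xs = (if 2 \<le> length xs then (- 1) ^ (length xs - 1) * f (cyclic_face xs) else 0)"

lemma dual_b_eq: "dual_b f xs = dual_b' f xs + dual_c f xs"
  by (simp add: dual_b_def dual_c_def)

lemma dual_c_snoc:
  "zs \<noteq> [] \<Longrightarrow> dual_c f (zs @ [r]) = (- 1) ^ length zs * f (r * hd zs # tl zs)"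
  by (cases zs) (auto simp: dual_c_def cyclic_face_def)

lemma dual_c_short [simp]: "dual_c f [] = 0" "dual_c f [x] = 0"
  by (simp_all add: dual_c_def)

text \<open>Mirror image of the recursion at the head. The last face is the one that interacts with
  the wrap-around face.\<close>

lemma dual_b'_snoc:
  "dual_b' g (ws @ [y, r]) = dual_b' (\<lambda>zs. g (zs @ [r])) (ws @ [y]) + (- 1) ^ length ws * g (ws @ [y * r])"
proof (induction ws arbitrary: g)
  case (Cons w ws)
  show ?case
  proof (cases ws)
    case Nil
    then show ?thesis by (simp add: dual_b'_Cons2)
  next
    case (Cons v vs)
    then show ?thesis
      using Cons.IH[of "\<lambda>zs. g (w # zs)"] by (simp add: dual_b'_Cons2 algebra_simps)
  qed
qed (simp add: dual_b'_Cons2)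

text \<open>With \<open>b = b' + c\<close> the mixed terms and \<open>cc\<close> have to cancel.
  Faces that avoid the last entry cancel between the two mixed terms; the remaining face multiplies
  the last two entries before wrapping around and cancels \<open>cc\<close> by
  associativity.\<close>

lemma dual_b_dual_b: "dual_b (dual_b f) xs = 0"
proof -
  consider "length xs < 2" | ws y r where "xs = ws @ [y, r]"
  proof (cases xs rule: rev_cases)
    case (snoc ys r)
    then show ?thesis using that by (cases ys rule: rev_cases) auto
  qed (use that in auto)
  then show ?thesis
  proof cases
    case 1
    then show ?thesis by (simp add: dual_b_def dual_b'_def)
  next
    case xs: 2
    let ?m = "length ws"
    have b: "dual_b f = (\<lambda>zs. dual_b' f zs + dual_c f zs)"
      by (auto simp: dual_b_eq)
    have "dual_b' (dual_c f) xs
      = dual_b' (\<lambda>zs. dual_c f (zs @ [r])) (ws @ [y]) + (- 1) ^ ?m * dual_c f (ws @ [y * r])"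
      unfolding xs by (rule dual_b'_snoc)
    also have "dual_b' (\<lambda>zs. dual_c f (zs @ [r])) (ws @ [y])
      = dual_b' (\<lambda>zs. (- 1) ^ ?m * f (r * hd zs # tl zs)) (ws @ [y])"
      by (rule dual_b'_cong_UNIV) (auto simp: dual_c_snoc)
    also have "\<dots> = (- 1) ^ ?m * dual_b' f (r * hd (ws @ [y]) # tl (ws @ [y]))"
      by (cases "ws @ [y]") (simp_all add: dual_b'_cmult dual_b'_hd[of f r])
    finally have 1: "dual_b' (dual_c f) xs = (- 1) ^ ?m * dual_b' f (r * hd (ws @ [y]) # tl (ws @ [y]))
       + (- 1) ^ ?m * dual_c f (ws @ [y * r])" .
    have xs': "xs = (ws @ [y]) @ [r]" using xs by simp
    have 2: "dual_c (dual_b' f) xs = - ((- 1) ^ ?m * dual_b' f (r * hd (ws @ [y]) # tl (ws @ [y])))"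
      unfolding xs' by (subst dual_c_snoc) auto
    have "dual_c (dual_c f) xs = - ((- 1) ^ ?m * dual_c f (r * hd (ws @ [y]) # tl (ws @ [y])))"
      unfolding xs' by (subst dual_c_snoc) auto
    also have "dual_c f (r * hd (ws @ [y]) # tl (ws @ [y])) = dual_c f (ws @ [y * r])"
    proof (cases ws)
      case (Cons w vs)
      then show ?thesis
        using dual_c_snoc[of "r * w # vs" f y] dual_c_snoc[of "w # vs" f "y * r"]
        by (simp add: mult.assoc)
    qed simp
    finally have 3: "dual_c (dual_c f) xs = - ((- 1) ^ ?m * dual_c f (ws @ [y * r]))" .
    have "dual_b (dual_b f) xs
      = dual_b' (dual_b' f) xs + dual_b' (dual_c f) xs + dual_c (dual_b' f) xs + dual_c (dual_c f) xs"
      unfolding dual_b_eq[of "dual_b f"] unfolding b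
      by (simp add: dual_b'_def dual_c_def sum.distrib algebra_simps)
    then show ?thesis using 1 2 3 by (simp add: dual_b'_dual_b')
  qed
qed

section \<open>Rotations, the signed operator \<open>t\<close> and the norm\<close>

lemma length_rotate_right [simp]: "xs \<noteq> [] \<Longrightarrow> length (rotate_right xs) = length xs"
  by (simp add: rotate_right_def)

lemma rotate_right_eq_Nil [simp]: "rotate_right xs \<noteq> []"
  by (simp add: rotate_right_def)

lemma set_rotate_right [simp]: "xs \<noteq> [] \<Longrightarrow> set (rotate_right xs) = set xs"
  by (cases xs rule: rev_cases) (auto simp: rotate_right_def)

lemma rotate_right_snoc [simp]:
  "rotate_right (xs @ [x]) = x # xs"
  "rotate_right (xs @ ys @ [x]) = x # xs @ ys"
  "rotate_right (xs @ [y, x]) = x # xs @ [y]"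
  "rotate_right (y # xs @ [x]) = x # y # xs"
  by (simp_all add: rotate_right_def butlast_append)

lemma funpow_rotate_right_append: "(rotate_right ^^ length ys) (xs @ ys) = ys @ xs"
proof (induction ys arbitrary: xs rule: rev_induct)
  case (snoc y ys)
  have "(rotate_right ^^ length (ys @ [y])) (xs @ ys @ [y]) = (rotate_right ^^ length ys) (rotate_right ((xs @ ys) @ [y]))"
    by (simp only: length_append_singleton funpow_Suc_right o_apply append_assoc)
  then show ?case using snoc[of "y # xs"] by simp
qed simp

lemma funpow_rotate_right_length: "(rotate_right ^^ length xs) xs = xs"
  using funpow_rotate_right_append[of xs "[]"] by simp

lemma
  assumes "xs \<noteq> []"
  shows length_funpow_rotate_right [simp]: "length ((rotate_right ^^ j) xs) = length xs"
    and funpow_rotate_right_Nil [simp]: "(rotate_right ^^ j) xs \<noteq> []"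
    and set_funpow_rotate_right [simp]: "set ((rotate_right ^^ j) xs) = set xs"
proof -
  have "length ((rotate_right ^^ j) xs) = length xs \<and> (rotate_right ^^ j) xs \<noteq> [] \<and> set ((rotate_right ^^ j) xs) = set xs"
    by (induction j) (use assms in auto)
  then show "length ((rotate_right ^^ j) xs) = length xs" "(rotate_right ^^ j) xs \<noteq> []"
    "set ((rotate_right ^^ j) xs) = set xs" by auto
qed

lemma funpow_dual_t:
  "xs \<noteq> [] \<Longrightarrow> (dual_t ^^ j) f xs = (- 1) ^ (j * (length xs - 1)) * f ((rotate_right ^^ j) xs)"
proof (induction j arbitrary: xs)
  case (Suc j)
  have "(dual_t ^^ Suc j) f xs = dual_t ((dual_t ^^ j) f) xs" by simp
  also have "\<dots> = (- 1) ^ (Suc j * (length xs - 1)) * f ((rotate_right ^^ j) (rotate_right xs))"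
    using Suc.IH[of "rotate_right xs"] Suc.prems
    by (simp add: dual_t_def[of "(dual_t ^^ j) f"] power_add)
  finally show ?case by (simp only: funpow_Suc_right o_apply)
qed simp

text \<open>The rotation has come full circle, and the accumulated exponent
  \<open>m * (m - 1)\<close> of the sign, with \<open>m = length xs\<close>, is even.\<close>

lemma funpow_dual_t_length: "xs \<noteq> [] \<Longrightarrow> (dual_t ^^ length xs) f xs = f xs"
  by (simp add: funpow_dual_t funpow_rotate_right_length)

lemma dual_t_cong:
  assumes "xs \<noteq> []" "set xs \<subseteq> A"
    "\<And>zs. zs \<noteq> [] \<Longrightarrow> length zs = length xs \<Longrightarrow> set zs \<subseteq> A \<Longrightarrow> f zs = g zs"
  shows "dual_t f xs = dual_t g xs"
  using assms(1,2) by (simp add: dual_t_def assms(3))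

lemma funpow_dual_t_cong:
  assumes "xs \<noteq> []" "set xs \<subseteq> A"
    "\<And>zs. zs \<noteq> [] \<Longrightarrow> length zs = length xs \<Longrightarrow> set zs \<subseteq> A \<Longrightarrow> f zs = g zs"
  shows "(dual_t ^^ j) f xs = (dual_t ^^ j) g xs"
  using assms(1,2) by (simp add: funpow_dual_t assms(3))

lemma dual_N_cong:
  assumes "xs \<noteq> []" "set xs \<subseteq> A"
    "\<And>zs. zs \<noteq> [] \<Longrightarrow> length zs = length xs \<Longrightarrow> set zs \<subseteq> A \<Longrightarrow> f zs = g zs"
  shows "dual_N f xs = dual_N g xs"
  unfolding dual_N_def using funpow_dual_t_cong[OF assms] by simp

text \<open>Composing with \<open>t\<close> shifts the summation range by one; the two end terms
  agree because \<open>t\<close> has order dividing \<open>length xs\<close>.\<close>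

lemma dual_N_dual_t:
  assumes "xs \<noteq> []"
  shows "dual_N (dual_t f) xs = dual_N f xs"
proof -
  have "dual_N (dual_t f) xs + (dual_t ^^ 0) f xs = (\<Sum>j<Suc (length xs). (dual_t ^^ j) f xs)"
    unfolding dual_N_def sum.lessThan_Suc_shift by (simp add: funpow_swap1)
  also have "\<dots> = dual_N f xs + f xs"
    using assms by (simp add: dual_N_def funpow_dual_t_length)
  finally show ?thesis by simp
qed

lemma dual_N_funpow_dual_t:
  "xs \<noteq> [] \<Longrightarrow> dual_N ((dual_t ^^ i) f) xs = dual_N f xs"
  by (induction i) (simp_all add: dual_N_dual_t)

lemma dual_t_dual_N:
  assumes "xs \<noteq> []"
  shows "dual_t (dual_N f) xs = dual_N f xs"
proof -
  have "dual_t (dual_N f) xs = (\<Sum>j<length xs. (dual_t ^^ Suc j) f xs)"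
    using assms by (simp add: dual_t_def dual_N_def sum_distrib_left)
  also have "\<dots> = dual_N (dual_t f) xs"
    by (simp add: dual_N_def funpow_swap1)
  finally show ?thesis by (simp add: dual_N_dual_t assms)
qed

lemma funpow_dual_t_dual_N: "xs \<noteq> [] \<Longrightarrow> (dual_t ^^ i) (dual_N f) xs = dual_N f xs"
proof (induction i arbitrary: xs)
  case (Suc i)
  have "(dual_t ^^ Suc i) (dual_N f) xs = dual_t ((dual_t ^^ i) (dual_N f)) xs" by simp
  also have "\<dots> = dual_t (dual_N f) xs"
    by (rule dual_t_cong[of xs UNIV]) (use Suc in auto)
  finally show ?case using Suc.prems by (simp add: dual_t_dual_N)
qed simp

lemma dual_N_minus: "xs \<noteq> [] \<Longrightarrow> dual_N (\<lambda>zs. f zs - g zs) xs = dual_N f xs - dual_N g xs"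
  by (simp add: dual_N_def funpow_dual_t algebra_simps sum_subtractf)

lemma dual_N_sum: "xs \<noteq> [] \<Longrightarrow> dual_N (\<lambda>zs. \<Sum>i\<in>I. f i zs) xs = (\<Sum>i\<in>I. dual_N (f i) xs)"
  unfolding dual_N_def
  by (subst sum.swap) (simp add: funpow_dual_t sum_distrib_left)

section \<open>Cyclic relations between faces and rotations\<close>

definition cface :: "nat \<Rightarrow> 'r::ring list \<Rightarrow> 'r list" where
  "cface i xs = (if Suc i < length xs then face i xs else cyclic_face xs)"

lemma length_cface: "2 \<le> length xs \<Longrightarrow> length (cface i xs) = length xs - 1"
  by (auto simp: cface_def length_face cyclic_face_def)

lemma dual_b_cface:
  assumes "2 \<le> length xs"
  shows "dual_b f xs = (\<Sum>i<length xs. (- 1) ^ i * f (cface i xs))"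
proof -
  obtain m where m: "length xs = Suc m" using assms by (cases "length xs") auto
  show ?thesis using assms by (simp add: dual_b_def dual_b'_def m cface_def)
qed

lemma dual_b'_cface: "dual_b' f xs = (\<Sum>i<length xs - 1. (- 1) ^ i * f (cface i xs))"
  unfolding dual_b'_def by (rule sum.cong) (auto simp: cface_def)

lemma face_append:
  "face i (xs @ x # y # ys) = (if i = length xs then xs @ x * y # ys else face i (xs @ x # y # ys))"
  by (simp add: face_def nth_append)

lemma face_snoc: "Suc i < length xs \<Longrightarrow> face i (xs @ [r]) = face i xs @ [r]"
  by (simp add: face_def nth_append)

text \<open>The relation \<open>d_{i+1} t = t d_i\<close> of a cyclic module, without signs.
  Together with \<open>d_0 t = d_n\<close>, which is \<open>cface_0_rotate\<close>, it governs how
  \<open>b\<close> and \<open>b'\<close> interact with \<open>t\<close> and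
  \<open>N\<close>.\<close>

lemma cface_Suc_rotate:
  assumes "Suc i < length xs"
  shows "cface (Suc i) (rotate_right xs) = rotate_right (cface i xs)"
proof -
  obtain ys r where xs: "xs = ys @ [r]" using assms by (cases xs rule: rev_cases) auto
  show ?thesis
  proof (cases "Suc i = length ys")
    \<comment> \<open>The last inner face becomes the wrap-around face after rotation.\<close>
    case True
    then obtain zs s where ys: "ys = zs @ [s]" by (cases ys rule: rev_cases) auto
    have "face i xs = zs @ [s * r]"
      using True face_append[of "length zs" zs s r "[]"] by (simp add: xs ys)
    then show ?thesis using True by (simp add: cface_def xs ys cyclic_face_def)
  next
    case False
    then show ?thesis using assms by (simp add: cface_def xs face_Suc face_snoc)
  qed
qed

lemma cface_funpow_rotate:
  "i < length xs \<Longrightarrow> 2 \<le> length xs \<Longrightarrow> cface i ((rotate_right ^^ i) xs) = (rotate_right ^^ i) (cface 0 xs)"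
proof (induction i)
  case (Suc i)
  have "xs \<noteq> []" using Suc.prems by auto
  then have "cface (Suc i) ((rotate_right ^^ Suc i) xs) = rotate_right (cface i ((rotate_right ^^ i) xs))"
    using Suc.prems by (simp add: cface_Suc_rotate)
  then show ?case using Suc by simp
qed simp

lemma cface_0_rotate: "2 \<le> length xs \<Longrightarrow> cface 0 (rotate_right xs) = cyclic_face xs"
  by (cases xs rule: rev_cases; cases "butlast xs") (auto simp: cface_def face_0 cyclic_face_def)

text \<open>This is \<open>b (1 - t) = (1 - t) b'\<close> read on forms, precomposition reversing
  the factors. Face 0 of the rotated list is the wrap-around face, which \<open>b'\<close> omits;
  the other faces match after a shift of index and sign.\<close>

lemma dual_t_dual_b:
  assumes "xs \<noteq> []"
  shows "dual_b' (\<lambda>zs. f zs - dual_t f zs) xs = dual_b f xs - dual_t (dual_b f) xs"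
proof (cases "2 \<le> length xs")
  case True
  then obtain n where n: "length xs = Suc n" "n \<ge> 1" by (cases "length xs") auto
  have "dual_t (dual_b f) xs = (- 1) ^ n * (\<Sum>i<Suc n. (- 1) ^ i * f (cface i (rotate_right xs)))"
    using n True assms by (simp add: dual_t_def dual_b_cface)
  also have "(\<Sum>i<Suc n. (- 1) ^ i * f (cface i (rotate_right xs)))
    = f (cyclic_face xs) + (\<Sum>i<n. (- 1) ^ Suc i * f (rotate_right (cface i xs)))"
    unfolding sum.lessThan_Suc_shift using n by (simp add: cface_0_rotate True cface_Suc_rotate)
  finally have 1: "dual_t (dual_b f) xs
    = (- 1) ^ n * f (cyclic_face xs) - (- 1) ^ n * (\<Sum>i<n. (- 1) ^ i * f (rotate_right (cface i xs)))"
    by (simp add: algebra_simps sum_negf)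
  \<comment> \<open>A face shortens the list by one entry, which changes the sign in
    \<open>t\<close>.\<close>
  have p: "(- 1) ^ (n - Suc 0) = - ((- 1) ^ n :: 'b)" using n by (cases n) auto
  have "dual_b' (dual_t f) xs = - ((- 1) ^ n * (\<Sum>i<n. (- 1) ^ i * f (rotate_right (cface i xs))))"
    using n True by (simp add: dual_b'_cface dual_t_def length_cface sum_distrib_left p algebra_simps sum_negf)
  then show ?thesis using 1 n by (simp add: dual_b'_minus dual_b_def)
next
  case False
  then have "length xs = 1" using assms by (cases "length xs") auto
  then show ?thesis using assms by (simp add: dual_b_def dual_b'_def dual_t_def)
qed

text \<open>Rotating \<open>i\<close> times turns face \<open>i\<close> into face 0. As the face
  removes one entry, the signs of the two powers of \<open>t\<close> differ by
  \<open>(- 1) ^ i\<close>, which is the sign of this face in \<open>b\<close>.\<close>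

lemma funpow_dual_t_cface:
  fixes f :: "'r::ring list \<Rightarrow> 'k::field"
  assumes "2 \<le> length xs" "i < length xs"
  shows "(dual_t ^^ i) (\<lambda>zs. (- 1) ^ i * f (cface i zs)) xs = (dual_t ^^ i) f (cface 0 xs)"
proof -
  have xs: "xs \<noteq> []" "cface 0 xs \<noteq> []" using assms length_cface[of xs 0] by auto
  obtain m where m: "length xs = Suc (Suc m)" using assms(1) by (cases "length xs"; cases "length xs - 1") auto
  have "(- 1) ^ (i * Suc m) * (- 1) ^ i = ((- 1) ^ (i * m) :: 'k)"
    by (simp add: power_add algebra_simps power_mult_distrib[symmetric] flip: power_mult)
  then show ?thesis
    using xs assms m by (simp add: funpow_dual_t cface_funpow_rotate length_cface)
qed

text \<open>This is \<open>N b = b' N\<close> read on forms. All faces are conjugates of face 0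
  under rotation, so both sides reduce to the norm of the single form \<open>G\<close>.\<close>

lemma dual_b_dual_N:
  assumes "xs \<noteq> []"
  shows "dual_b (dual_N f) xs = dual_N (dual_b' f) xs"
proof (cases "2 \<le> length xs")
  case True
  let ?m = "length xs"
  define D where "D i g = (\<lambda>zs. (- 1) ^ i * g (cface i zs))" for i and g :: "'a list \<Rightarrow> 'b"
  define G where "G = (\<lambda>zs. dual_N f (cface 0 zs))"
  have "dual_N (dual_b' f) xs = dual_N (\<lambda>zs. \<Sum>i<?m - 1. D i f zs) xs"
    by (rule dual_N_cong[OF assms, of UNIV]) (auto simp: dual_b'_cface D_def)
  also have "\<dots> = (\<Sum>i<?m - 1. dual_N (D i f) xs)"
    by (rule dual_N_sum[OF assms])
  also have "\<dots> = (\<Sum>i<?m - 1. dual_N (\<lambda>zs. (dual_t ^^ i) f (cface 0 zs)) xs)"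
  proof (rule sum.cong[OF refl])
    fix i assume i: "i \<in> {..<?m - 1}"
    have "dual_N (D i f) xs = dual_N ((dual_t ^^ i) (D i f)) xs"
      by (simp add: dual_N_funpow_dual_t assms)
    also have "\<dots> = dual_N (\<lambda>zs. (dual_t ^^ i) f (cface 0 zs)) xs"
      by (rule dual_N_cong[OF assms, of UNIV])
        (use i True funpow_dual_t_cface[of _ i f] in \<open>auto simp: D_def\<close>)
    finally show "dual_N (D i f) xs = dual_N (\<lambda>zs. (dual_t ^^ i) f (cface 0 zs)) xs" .
  qed
  also have "\<dots> = dual_N (\<lambda>zs. \<Sum>i<?m - 1. (dual_t ^^ i) f (cface 0 zs)) xs"
    by (rule dual_N_sum[OF assms, symmetric])
  \<comment> \<open>Behind the face the list has length \<open>?m - 1\<close>, so the summands are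
    exactly those of the norm there.\<close>
  also have "\<dots> = dual_N G xs"
    by (rule dual_N_cong[OF assms, of UNIV]) (use True in \<open>auto simp: G_def dual_N_def length_cface\<close>)
  finally have 1: "dual_N (dual_b' f) xs = dual_N G xs" .
  have "D i (dual_N f) xs = (dual_t ^^ (?m - i)) G xs" if "i < ?m" for i
  proof -
    \<comment> \<open>A full turn costs nothing; \<open>i\<close> of its rotations are spent on
      turning face \<open>i\<close> into face 0, and \<open>?m - i\<close> remain.\<close>
    have "D i (dual_N f) xs = (dual_t ^^ ?m) (D i (dual_N f)) xs"
      using assms by (simp add: funpow_dual_t_length)
    also have "dual_t ^^ ?m = dual_t ^^ (?m - i) \<circ> dual_t ^^ i"
      using that by (simp flip: funpow_add)
    also have "(\<dots>) (D i (dual_N f)) xs = (dual_t ^^ (?m - i)) ((dual_t ^^ i) (D i (dual_N f))) xs"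
      by simp
    also have "\<dots> = (dual_t ^^ (?m - i)) G xs"
    proof (rule funpow_dual_t_cong[OF assms, of UNIV])
      fix zs :: "'a list" assume zs: "zs \<noteq> []" "length zs = ?m"
      then have "(dual_t ^^ i) (D i (dual_N f)) zs = (dual_t ^^ i) (dual_N f) (cface 0 zs)"
        unfolding D_def using True that by (intro funpow_dual_t_cface) auto
      also have "\<dots> = G zs"
        unfolding G_def using zs True length_cface[of zs 0] by (intro funpow_dual_t_dual_N) auto
      finally show "(dual_t ^^ i) (D i (dual_N f)) zs = G zs" .
    qed simp
    finally show ?thesis .
  qed
  then have "dual_b (dual_N f) xs = (\<Sum>i<?m. (dual_t ^^ (?m - i)) G xs)"
    using True by (simp add: dual_b_cface D_def)
  also have "\<dots> = (\<Sum>i<?m. (dual_t ^^ Suc i) G xs)"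
    by (subst sum.nat_diff_reindex[symmetric]) (auto intro!: sum.cong simp: Suc_diff_Suc)
  also have "\<dots> = dual_N (dual_t G) xs"
    by (simp add: dual_N_def funpow_swap1)
  finally show ?thesis using 1 assms by (simp add: dual_N_dual_t)
next
  case False
  then have "length xs = 1" using assms by (cases "length xs") auto
  then show ?thesis by (simp add: dual_b_def dual_b'_def dual_N_def)
qed

section \<open>Presented cohomology and long exact sequences\<close>

locale cochain_complex =
  fixes sc :: "'k \<Rightarrow> 'c::ab_group_add \<Rightarrow> 'c" and X :: "int \<Rightarrow> 'c set" and d :: "'c \<Rightarrow> 'c"
  assumes sc_add: "sc c (x + y) = sc c x + sc c y"
    and zero_mem: "0 \<in> X n"
    and add_mem: "x \<in> X n \<Longrightarrow> y \<in> X n \<Longrightarrow> x + y \<in> X n"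
    and minus_mem: "x \<in> X n \<Longrightarrow> - x \<in> X n"
    and sc_mem: "x \<in> X n \<Longrightarrow> sc c x \<in> X n"
    and d_add: "d (x + y) = d x + d y"
    and d_sc: "d (sc c x) = sc c (d x)"
    and d_mem: "x \<in> X n \<Longrightarrow> d x \<in> X (n + 1)"
    and d_d: "x \<in> X n \<Longrightarrow> d (d x) = 0"
begin

lemma d_zero: "d 0 = 0" using d_add[of 0 0] by simp
lemma d_minus: "d (- x) = - d x" using d_add[of x "- x"] by (simp add: d_zero minus_unique)
lemma d_diff: "d (x - y) = d x - d y" using d_add[of x "- y"] by (simp add: d_minus)
lemma sc_zero: "sc c 0 = 0" using sc_add[of c 0 0] by simp
lemma sc_minus: "sc c (- x) = - sc c x" using sc_add[of c x "- x"] by (simp add: sc_zero minus_unique)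
lemma sc_diff: "sc c (x - y) = sc c x - sc c y" using sc_add[of c x "- y"] by (simp add: sc_minus)
lemma diff_mem: "x \<in> X n \<Longrightarrow> y \<in> X n \<Longrightarrow> x - y \<in> X n"
  using add_mem[of x n "- y"] minus_mem[of y n] by simp

definition cocycles :: "int \<Rightarrow> 'c set" where
  "cocycles n = {z \<in> X n. d z = 0}"

lemma cocycles_0: "0 \<in> cocycles n"
  and cocycles_add: "x \<in> cocycles n \<Longrightarrow> y \<in> cocycles n \<Longrightarrow> x + y \<in> cocycles n"
  and cocycles_minus: "x \<in> cocycles n \<Longrightarrow> - x \<in> cocycles n"
  and cocycles_sc: "x \<in> cocycles n \<Longrightarrow> sc c x \<in> cocycles n"
  by (auto simp: cocycles_def zero_mem add_mem minus_mem sc_mem d_zero d_add d_minus d_sc sc_zero)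

lemma d_cocycles: "x \<in> X n \<Longrightarrow> d x \<in> cocycles (n + 1)"
  by (simp add: cocycles_def d_mem d_d)

lemma shift: "cochain_complex sc (\<lambda>n. X (n - m)) d"
proof -
  have "d x \<in> X (n + 1 - m)" if "x \<in> X (n - m)" for x n
    using d_mem[OF that] by (simp add: algebra_simps)
  then show ?thesis
    by unfold_locales (auto simp: sc_add zero_mem add_mem minus_mem sc_mem d_add d_sc intro: d_d)
qed

end

definition coset_class :: "(int \<Rightarrow> 'c::ab_group_add set) \<Rightarrow> ('c \<Rightarrow> 'c) \<Rightarrow> int \<Rightarrow> 'c \<Rightarrow> 'c set" where
  "coset_class X d n z = (\<lambda>b. z + b) ` d ` X (n - 1)"

lemma mem_coset_class: "w \<in> coset_class X d n z \<longleftrightarrow> w - z \<in> d ` X (n - 1)"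
proof
  assume "w - z \<in> d ` X (n - 1)"
  then have "z + (w - z) \<in> coset_class X d n z" unfolding coset_class_def by (rule imageI)
  then show "w \<in> coset_class X d n z" by simp
qed (auto simp: coset_class_def)

text \<open>\<open>V\<close> is the quotient of \<open>Z\<close> by \<open>B\<close> with projection
  \<open>q\<close>. Since \<open>Z\<close> and \<open>B\<close> are independent of how
  \<open>V\<close> is built, bar cohomology can be presented by cocycles of another complex.\<close>

definition presents ::
  "('k, 'v) module \<Rightarrow> ('k \<Rightarrow> 'c \<Rightarrow> 'c) \<Rightarrow> 'c::ab_group_add set \<Rightarrow> 'c set \<Rightarrow> ('c \<Rightarrow> 'v) \<Rightarrow> bool" where
  "presents V sc Z B q \<longleftrightarrow>
     carrier V = q ` Z \<and> \<zero>\<^bsub>V\<^esub> = q 0 \<and> (\<forall>x\<in>Z. \<forall>y\<in>Z. q x = q y \<longleftrightarrow> x - y \<in> B) \<and>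
     (\<forall>x\<in>Z. \<forall>y\<in>Z. q (x + y) = q x \<oplus>\<^bsub>V\<^esub> q y) \<and> (\<forall>c. \<forall>x\<in>Z. q (sc c x) = c \<odot>\<^bsub>V\<^esub> q x)"

lemma presentsD:
  assumes "presents V sc Z B q"
  shows "carrier V = q ` Z" "\<zero>\<^bsub>V\<^esub> = q 0"
    "x \<in> Z \<Longrightarrow> y \<in> Z \<Longrightarrow> q x = q y \<longleftrightarrow> x - y \<in> B"
    "x \<in> Z \<Longrightarrow> y \<in> Z \<Longrightarrow> q x \<oplus>\<^bsub>V\<^esub> q y = q (x + y)"
    "x \<in> Z \<Longrightarrow> c \<odot>\<^bsub>V\<^esub> q x = q (sc c x)"
  using assms by (auto simp: presents_def)

text \<open>The inverse in \<open>\<ominus>\<close> is a definite description over the additive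
  monoid of the record, so its uniqueness has to be derived from the presentation.\<close>

lemma presents_a_minus:
  assumes "presents V sc Z B q" "0 \<in> B" "x \<in> Z" "y \<in> Z"
    and Z: "\<And>x y. x \<in> Z \<Longrightarrow> y \<in> Z \<Longrightarrow> x + y \<in> Z" "\<And>x. x \<in> Z \<Longrightarrow> - x \<in> Z"
  shows "q x \<ominus>\<^bsub>V\<^esub> q y = q (x - y)"
proof -
  note p = presentsD[OF assms(1)]
  have 0: "0 \<in> Z" using Z(1)[OF assms(4) Z(2)[OF assms(4)]] by simp
  have "a_inv V (q y) = q (- y)"
    unfolding a_inv_def m_inv_def
  proof (rule the_equality)
    show "q (- y) \<in> carrier (add_monoid V) \<and>
        q y \<otimes>\<^bsub>add_monoid V\<^esub> q (- y) = \<one>\<^bsub>add_monoid V\<^esub> \<and>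
        q (- y) \<otimes>\<^bsub>add_monoid V\<^esub> q y = \<one>\<^bsub>add_monoid V\<^esub>"
      using assms(4) Z(2) by (simp add: p(1,2,4))
  next
    fix v assume v: "v \<in> carrier (add_monoid V) \<and>
        q y \<otimes>\<^bsub>add_monoid V\<^esub> v = \<one>\<^bsub>add_monoid V\<^esub> \<and> v \<otimes>\<^bsub>add_monoid V\<^esub> q y = \<one>\<^bsub>add_monoid V\<^esub>"
    then obtain w where w: "w \<in> Z" "v = q w" by (auto simp: p(1))
    then have "q (w + y) = q 0" using v assms(4) by (simp add: p(2,4))
    then have "w + y \<in> B" using p(3)[of "w + y" 0] w 0 Z(1) assms(4) by auto
    then show "v = q (- y)" using p(3)[of w "- y"] w Z(2) assms(4) by simp
  qed
  then show ?thesis using assms(3,4) Z(2) p(4)[of x "- y"] by (simp add: a_minus_def)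
qed

context cochain_complex
begin

lemma presents_cohomology:
  "presents (cohomology sc X d n) sc (cocycles n) (d ` X (n - 1)) (coset_class X d n)"
proof -
  let ?B = "d ` X (n - 1)"
  have B: "0 \<in> ?B" "\<And>x y. x \<in> ?B \<Longrightarrow> y \<in> ?B \<Longrightarrow> x + y \<in> ?B" "\<And>x. x \<in> ?B \<Longrightarrow> - x \<in> ?B"
    "\<And>c x. x \<in> ?B \<Longrightarrow> sc c x \<in> ?B"
    using zero_mem d_zero by (force, force simp: add_mem simp flip: d_add,
      force simp: minus_mem simp flip: d_minus, force simp: sc_mem simp flip: d_sc)
  have B': "x - y \<in> ?B" if "x \<in> ?B" "y \<in> ?B" for x y
    using B(2)[OF that(1) B(3)[OF that(2)]] by simp
  have eq: "coset_class X d n x = coset_class X d n y \<longleftrightarrow> x - y \<in> ?B" for x y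
  proof
    assume "coset_class X d n x = coset_class X d n y"
    then have "x \<in> coset_class X d n y" using B(1) mem_coset_class[of x X d n x] by simp
    then show "x - y \<in> ?B" by (simp add: mem_coset_class)
  next
    assume xy: "x - y \<in> ?B"
    show "coset_class X d n x = coset_class X d n y"
    proof (rule Set.set_eqI)
      fix w
      have "w - y \<in> ?B" if "w - x \<in> ?B" using B(2)[OF that xy] by simp
      moreover have "w - x \<in> ?B" if "w - y \<in> ?B" using B'[OF that xy] by simp
      ultimately show "w \<in> coset_class X d n x \<longleftrightarrow> w \<in> coset_class X d n y"
        unfolding mem_coset_class by blast
    qed
  qed
  have add: "coset_class X d n (x + y) = {u + v |u v. u \<in> coset_class X d n x \<and> v \<in> coset_class X d n y}"
    (is "_ = ?S") for x y
  proof (rule Set.set_eqI)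
    fix w
    have "w \<in> ?S" if "w - (x + y) \<in> ?B"
      by (rule CollectI, rule exI[of _ "w - y"], rule exI[of _ y])
        (use that B(1) in \<open>simp add: mem_coset_class algebra_simps\<close>)
    moreover have "w - (x + y) \<in> ?B" if w: "w \<in> ?S"
    proof -
      obtain u v where uv: "w = u + v" "u - x \<in> ?B" "v - y \<in> ?B"
        using w unfolding mem_coset_class by blast
      have "(u - x) + (v - y) \<in> ?B" by (rule B(2)[OF uv(2,3)])
      then show ?thesis by (simp add: uv(1) algebra_simps)
    qed
    ultimately show "w \<in> coset_class X d n (x + y) \<longleftrightarrow> w \<in> ?S"
      unfolding mem_coset_class by blast
  qed
  have smult: "coset_class X d n (sc c x) = {sc c u + b |u b. u \<in> coset_class X d n x \<and> b \<in> ?B}"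
    (is "_ = ?S") for c x
  proof (rule Set.set_eqI)
    fix w
    have "w \<in> ?S" if "w - sc c x \<in> ?B"
      by (rule CollectI, rule exI[of _ x], rule exI[of _ "w - sc c x"])
        (use that B(1) in \<open>simp add: mem_coset_class\<close>)
    moreover have "w - sc c x \<in> ?B" if w: "w \<in> ?S"
    proof -
      obtain u b where ub: "w = sc c u + b" "u - x \<in> ?B" "b \<in> ?B"
        using w unfolding mem_coset_class by blast
      have "sc c (u - x) + b \<in> ?B" by (rule B(2)[OF B(4)[OF ub(2)] ub(3)])
      then show ?thesis by (simp add: ub(1) sc_diff algebra_simps)
    qed
    ultimately show "w \<in> coset_class X d n (sc c x) \<longleftrightarrow> w \<in> ?S"
      unfolding mem_coset_class by blast
  qed
  have "coset_class X d n 0 = ?B" by (simp add: coset_class_def)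
  then show ?thesis
    unfolding presents_def using eq add smult
    by (auto simp: cohomology_def coset_class_def cocycles_def)
qed

text \<open>\<open>induced\<close> unites translates over all representatives of a class. They
  coincide once \<open>\<phi>\<close> is additive and takes coboundaries to coboundaries, so maps on
  cohomology can be evaluated on any one representative.\<close>

lemma induced_coset_class:
  assumes "\<And>x y. \<phi> (x + y) = \<phi> x + \<phi> y"
    and "\<And>x. x \<in> Y (m - 1) \<Longrightarrow> \<phi> (e x) \<in> d ` X (n - 1)" and "0 \<in> Y (m - 1)" "e 0 = 0"
  shows "induced (cohomology sc' X d n) \<phi> (coset_class Y e m z) = coset_class X d n (\<phi> z)"
proof (rule Set.set_eqI)
  fix w
  have 1: "w - \<phi> z \<in> d ` X (n - 1)"
    if w: "u - z \<in> e ` Y (m - 1)" "w - \<phi> u \<in> d ` X (n - 1)" for u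
  proof -
    have "\<phi> u = \<phi> (u - z) + \<phi> z" using assms(1)[of "u - z" z] by simp
    then have "w - \<phi> z = (w - \<phi> u) + \<phi> (u - z)" by simp
    moreover obtain a where "a \<in> X (n - 1)" "w - \<phi> u = d a" using w(2) by auto
    moreover obtain b where "b \<in> X (n - 1)" "\<phi> (u - z) = d b" using w(1) assms(2) by force
    ultimately show ?thesis using d_add[of a b] add_mem by force
  qed
  have 2: "\<exists>u. u - z \<in> e ` Y (m - 1) \<and> w - \<phi> u \<in> d ` X (n - 1)" if "w - \<phi> z \<in> d ` X (n - 1)"
    using that assms(3,4) by (intro exI[of _ z]) force
  have 3: "w \<in> induced (cohomology sc' X d n) \<phi> U \<longleftrightarrow> (\<exists>u. u \<in> U \<and> w - \<phi> u \<in> d ` X (n - 1))" for U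
    using mem_coset_class[of w X d n]
    by (auto simp: induced_def cohomology_def coset_class_def simp del: image_iff)
  show "w \<in> induced (cohomology sc' X d n) \<phi> (coset_class Y e m z) \<longleftrightarrow> w \<in> coset_class X d n (\<phi> z)"
    unfolding 3 mem_coset_class by (rule iffI, elim exE conjE, erule (1) 1, erule 2)
qed

end

section \<open>Direct sums of presentations, complexes and exact sequences\<close>

lemma presents_dsum:
  assumes "presents V sc Z B q" "presents V' sc' Z' B' q'"
  shows "presents (V \<boxplus> V') (\<lambda>c. map_prod (sc c) (sc' c)) (Z \<times> Z') (B \<times> B') (map_prod q q')"
proof -
  have "map_prod q q' ` (Z \<times> Z') = q ` Z \<times> q' ` Z'" by force
  then show ?thesis
    using assms by (auto simp: presents_def dsum_def zero_prod_def)
qed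

lemma cochain_complex_prod:
  assumes "cochain_complex sc X d" "cochain_complex sc' X' d'"
  shows "cochain_complex (\<lambda>c. map_prod (sc c) (sc' c)) (\<lambda>n. X n \<times> X' n) (map_prod d d')"
  using assms by (auto simp: cochain_complex_def zero_prod_def)

lemma cocycles_prod:
  fixes sc :: "'k \<Rightarrow> 'c::ab_group_add \<Rightarrow> 'c" and sc' :: "'k \<Rightarrow> 'd::ab_group_add \<Rightarrow> 'd"
  assumes "cochain_complex sc X d" "cochain_complex sc' X' d'"
  shows "cochain_complex.cocycles (\<lambda>n. X n \<times> X' n) (map_prod d d') n
    = cochain_complex.cocycles X d n \<times> cochain_complex.cocycles X' d' n"
  unfolding cochain_complex.cocycles_def[OF assms(1)] cochain_complex.cocycles_def[OF assms(2)]
    cochain_complex.cocycles_def[OF cochain_complex_prod[OF assms]]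
  by (auto simp: zero_prod_def)

lemma exact_pair_dsum:
  assumes "exact_pair U f V g W" "exact_pair U' f' V' g' W'"
  shows "exact_pair (U \<boxplus> U') (map_prod f f') (V \<boxplus> V') (map_prod g g') (W \<boxplus> W')"
proof -
  have im: "map_prod f f' ` (carrier U \<times> carrier U') = f ` carrier U \<times> f' ` carrier U'" by force
  have "map_prod f f' ` carrier (U \<boxplus> U') = {v \<in> carrier (V \<boxplus> V'). map_prod g g' v = \<zero>\<^bsub>W \<boxplus> W'\<^esub>}"
    using assms by (auto simp: exact_pair_def dsum_def im)
  then show ?thesis
    using assms by (auto simp: exact_pair_def linear_map_def dsum_def Pi_iff)
qed

lemma long_exact_dsum:
  assumes "long_exact X Y Z f g h" "long_exact X' Y' Z' f' g' h'"
  shows "long_exact (\<lambda>n. X n \<boxplus> X' n) (\<lambda>n. Y n \<boxplus> Y' n) (\<lambda>n. Z n \<boxplus> Z' n)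
    (\<lambda>n. map_prod (f n) (f' n)) (\<lambda>n. map_prod (g n) (g' n)) (\<lambda>n. map_prod (h n) (h' n))"
  using assms unfolding long_exact_def by (blast intro: exact_pair_dsum)

text \<open>Exactness on the left is replaced by acyclicity of the kernel of \<open>\<phi>\<close>.
  \<open>neg\<close> selects the degrees in which the connecting map is taken with the opposite
  sign.\<close>

locale cochain_sequence =
  X: cochain_complex scX X dX + Y: cochain_complex scY Y dY + Z: cochain_complex scZ Z dZ
  for scX :: "'k \<Rightarrow> 'x::ab_group_add \<Rightarrow> 'x" and X dX
    and scY :: "'k \<Rightarrow> 'y::ab_group_add \<Rightarrow> 'y" and Y dY
    and scZ :: "'k \<Rightarrow> 'z::ab_group_add \<Rightarrow> 'z" and Z dZ +
  fixes HX :: "int \<Rightarrow> ('k, 'hx) module" and qX and HY :: "int \<Rightarrow> ('k, 'hy) module" and qY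
    and HZ :: "int \<Rightarrow> ('k, 'hz) module" and qZ
    and \<phi> :: "'x \<Rightarrow> 'y" and \<psi> :: "'y \<Rightarrow> 'z" and neg :: "int \<Rightarrow> bool"
  assumes HX: "presents (HX n) scX (X.cocycles n) (dX ` X (n - 1)) (qX n)"
    and HY: "presents (HY n) scY (Y.cocycles n) (dY ` Y (n - 1)) (qY n)"
    and HZ: "presents (HZ n) scZ (Z.cocycles n) (dZ ` Z (n - 1)) (qZ n)"
    and \<phi>_add: "\<phi> (x + x') = \<phi> x + \<phi> x'" and \<phi>_sc: "\<phi> (scX c x) = scY c (\<phi> x)"
    and \<phi>_mem: "x \<in> X n \<Longrightarrow> \<phi> x \<in> Y n" and \<phi>_d: "x \<in> X n \<Longrightarrow> \<phi> (dX x) = dY (\<phi> x)"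
    and \<psi>_add: "\<psi> (y + y') = \<psi> y + \<psi> y'" and \<psi>_sc: "\<psi> (scY c y) = scZ c (\<psi> y)"
    and \<psi>_mem: "y \<in> Y n \<Longrightarrow> \<psi> y \<in> Z n" and \<psi>_d: "y \<in> Y n \<Longrightarrow> \<psi> (dY y) = dZ (\<psi> y)"
    and \<psi>_\<phi>: "x \<in> X n \<Longrightarrow> \<psi> (\<phi> x) = 0"
    and exact: "y \<in> Y n \<Longrightarrow> \<psi> y = 0 \<Longrightarrow> \<exists>x\<in>X n. \<phi> x = y"
    and surj: "z \<in> Z n \<Longrightarrow> \<exists>y\<in>Y n. \<psi> y = z"
    and acyclic: "x \<in> X n \<Longrightarrow> dX x = 0 \<Longrightarrow> \<phi> x = 0 \<Longrightarrow> \<exists>w\<in>X (n - 1). \<phi> w = 0 \<and> dX w = x"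
begin

lemma \<phi>_0: "\<phi> 0 = 0" using \<phi>_add[of 0 0] by simp
lemma \<phi>_minus: "\<phi> (- x) = - \<phi> x" using \<phi>_add[of x "- x"] by (simp add: \<phi>_0 minus_unique)
lemma \<phi>_diff: "\<phi> (x - y) = \<phi> x - \<phi> y" using \<phi>_add[of x "- y"] by (simp add: \<phi>_minus)
lemma \<psi>_0: "\<psi> 0 = 0" using \<psi>_add[of 0 0] by simp
lemma \<psi>_minus: "\<psi> (- x) = - \<psi> x" using \<psi>_add[of x "- x"] by (simp add: \<psi>_0 minus_unique)
lemma \<psi>_diff: "\<psi> (x - y) = \<psi> x - \<psi> y" using \<psi>_add[of x "- y"] by (simp add: \<psi>_minus)

definition sg :: "int \<Rightarrow> 'z \<Rightarrow> 'z" where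
  "sg n z = (if neg n then - z else z)"

lemma sg_simps: "sg n (sg n z) = z" "sg n 0 = 0" "sg n (z + z') = sg n z + sg n z'"
  "sg n (z - z') = sg n z - sg n z'" "sg n (scZ c z) = scZ c (sg n z)" "sg n (dZ z) = dZ (sg n z)"
  "sg n z = 0 \<longleftrightarrow> z = 0"
  by (auto simp: sg_def Z.sc_minus Z.d_minus)

lemma sg_mem: "z \<in> Z m \<Longrightarrow> sg n z \<in> Z m"
  by (simp add: sg_def Z.minus_mem)

text \<open>\<open>x\<close> represents the image of the class of \<open>z\<close> under the connecting map, up to the sign \<open>sg n\<close>.\<close>

definition snake :: "int \<Rightarrow> 'z \<Rightarrow> 'y \<Rightarrow> 'x \<Rightarrow> bool" where
  "snake n z y x \<longleftrightarrow> y \<in> Y n \<and> x \<in> X.cocycles (n + 1) \<and> \<phi> x = dY y \<and> \<psi> y = sg n z"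

text \<open>A preimage of a cocycle need not be a cocycle, but its differential is a cocycle in the
  acyclic kernel. Subtracting a primitive taken from the kernel repairs it without changing its
  image.\<close>

lemma lift_cocycle:
  assumes y: "y \<in> Y.cocycles n" and "\<psi> y = 0"
  shows "\<exists>x\<in>X.cocycles n. \<phi> x = y"
proof -
  have y: "y \<in> Y n" "dY y = 0" using y by (auto simp: Y.cocycles_def)
  obtain x where x: "x \<in> X n" "\<phi> x = y" using exact[OF y(1) assms(2)] by auto
  have "\<exists>w\<in>X (n + 1 - 1). \<phi> w = 0 \<and> dX w = dX x"
    using x y by (intro acyclic) (auto simp: X.d_mem X.d_d \<phi>_d[OF x(1)])
  then obtain w where w: "w \<in> X n" "\<phi> w = 0" "dX w = dX x" by auto
  have "x - w \<in> X.cocycles n" "\<phi> (x - w) = y"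
    using x w by (auto simp: X.cocycles_def X.diff_mem X.d_diff \<phi>_diff)
  then show ?thesis by blast
qed

lemma snake_ex:
  assumes "z \<in> Z.cocycles n"
  shows "\<exists>y x. snake n z y x"
proof -
  have "sg n z \<in> Z n" using assms by (simp add: Z.cocycles_def sg_mem)
  then obtain y where y: "y \<in> Y n" "\<psi> y = sg n z" using surj by blast
  have "\<psi> (dY y) = 0"
    using y assms by (simp add: \<psi>_d Z.cocycles_def sg_simps(2) flip: sg_simps(6))
  then obtain x where "x \<in> X.cocycles (n + 1)" "\<phi> x = dY y"
    using lift_cocycle[OF Y.d_cocycles[OF y(1)]] by auto
  then show ?thesis using y by (auto simp: snake_def)
qed

text \<open>Where an injective \<open>\<phi>\<close> would give \<open>x - x' = dX x0\<close>, the
  two sides here differ by a cocycle of the kernel, which is a coboundary as well.\<close>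

lemma snake_unique:
  assumes "snake n z y x" "snake n z' y' x'" "z - z' \<in> dZ ` Z (n - 1)"
  shows "qX (n + 1) x = qX (n + 1) x'"
proof -
  obtain c where c: "c \<in> Z (n - 1)" "z - z' = dZ c" using assms(3) by auto
  obtain b where b: "b \<in> Y (n - 1)" "\<psi> b = sg n c" using surj[OF sg_mem[OF c(1)]] by blast
  note s = assms(1,2)[unfolded snake_def]
  have bY: "dY b \<in> Y n" using Y.d_mem[OF b(1)] by simp
  then have "y - y' - dY b \<in> Y n" using s by (simp add: Y.diff_mem)
  moreover have "dZ (sg n c) = sg n z - sg n z'"
    by (simp only: sg_simps(4)[symmetric] c(2) sg_simps(6))
  then have "\<psi> (y - y' - dY b) = 0"
    using s b by (simp add: \<psi>_diff \<psi>_d[OF b(1)])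
  ultimately obtain x0 where x0: "x0 \<in> X n" "\<phi> x0 = y - y' - dY b" using exact by blast
  have "x - x' - dX x0 \<in> X (n + 1)" "dX (x - x' - dX x0) = 0" "\<phi> (x - x' - dX x0) = 0"
    using s x0 b by (auto simp: X.cocycles_def X.diff_mem X.d_mem X.d_d[OF x0(1)] X.d_diff \<phi>_diff
        \<phi>_d[OF x0(1)] Y.d_diff Y.d_d[OF b(1)])
  then obtain w where w: "w \<in> X n" "dX w = x - x' - dX x0" using acyclic[of _ "n + 1"] by force
  have "x - x' = dX (x0 + w)" by (simp add: X.d_add w(2))
  then have "x - x' \<in> dX ` X (n + 1 - 1)" using X.add_mem[OF x0(1) w(1)] by simp
  then show ?thesis using s presentsD(3)[OF HX] by blast
qed

definition connecting :: "int \<Rightarrow> 'hz \<Rightarrow> 'hx" where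
  "connecting n U = (SOME W. \<exists>z y x. z \<in> Z.cocycles n \<and> qZ n z = U \<and> snake n z y x \<and> W = qX (n + 1) x)"

lemma connecting_eq:
  assumes "z \<in> Z.cocycles n" "snake n z y x"
  shows "connecting n (qZ n z) = qX (n + 1) x"
  unfolding connecting_def
proof (rule some_equality)
  fix W assume "\<exists>z' y' x'. z' \<in> Z.cocycles n \<and> qZ n z' = qZ n z \<and> snake n z' y' x' \<and> W = qX (n + 1) x'"
  then obtain z' y' x' where "z' \<in> Z.cocycles n" "qZ n z' = qZ n z" "snake n z' y' x'" "W = qX (n + 1) x'"
    by blast
  then show "W = qX (n + 1) x"
    using snake_unique[OF _ assms(2)] presentsD(3)[OF HZ] assms(1) by blast
qed (use assms in blast)

text \<open>The maps are tested on classes only, so this covers \<open>connecting\<close> as well as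
  \<open>connes_B\<close>, which has a definition of its own. For \<open>h\<close> one snake per
  cocycle suffices by uniqueness.\<close>

lemma long_exact_cohomology:
  assumes f: "\<And>n x. x \<in> X.cocycles n \<Longrightarrow> f n (qX n x) = qY n (\<phi> x)"
    and g: "\<And>n y. y \<in> Y.cocycles n \<Longrightarrow> g n (qY n y) = qZ n (\<psi> y)"
    and h_ex: "\<And>n z. z \<in> Z.cocycles n \<Longrightarrow> \<exists>y x. snake n z y x \<and> h n (qZ n z) = qX (n + 1) x"
  shows "long_exact HX HY HZ f g h"
proof -
  have h: "h n (qZ n z) = qX (n + 1) x" if z: "z \<in> Z.cocycles n" and s: "snake n z y x" for n z y x
  proof -
    obtain y' x' where s': "snake n z y' x'" "h n (qZ n z) = qX (n + 1) x'" using h_ex[OF z] by auto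
    have "z - z \<in> dZ ` Z (n - 1)" using Z.zero_mem Z.d_zero by force
    then show ?thesis using snake_unique[OF s'(1) s] s'(2) by simp
  qed
  have \<phi>Z: "\<phi> x \<in> Y.cocycles n" if "x \<in> X.cocycles n" for x n
    using that by (auto simp: X.cocycles_def Y.cocycles_def \<phi>_mem \<phi>_0 simp flip: \<phi>_d)
  have \<psi>Z: "\<psi> y \<in> Z.cocycles n" if "y \<in> Y.cocycles n" for y n
    using that by (auto simp: Y.cocycles_def Z.cocycles_def \<psi>_mem \<psi>_0 simp flip: \<psi>_d)
  have lf: "linear_map (HX n) (HY n) (f n)" for n
    using \<phi>Z by (auto simp: linear_map_def presentsD(1,4,5)[OF HX] presentsD(1,4,5)[OF HY] f
        X.cocycles_add X.cocycles_sc \<phi>_add \<phi>_sc)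
  have lg: "linear_map (HY n) (HZ n) (g n)" for n
    using \<psi>Z by (auto simp: linear_map_def presentsD(1,4,5)[OF HY] presentsD(1,4,5)[OF HZ] g
        Y.cocycles_add Y.cocycles_sc \<psi>_add \<psi>_sc)
  have snakeX: "snake n z y x \<Longrightarrow> x \<in> X.cocycles (n + 1)" for n z y x by (simp add: snake_def)
  have lh: "linear_map (HZ n) (HX (n + 1)) (h n)" for n
    unfolding linear_map_def
  proof (intro conjI ballI allI)
    show "h n \<in> carrier (HZ n) \<rightarrow> carrier (HX (n + 1))"
    proof
      fix U assume "U \<in> carrier (HZ n)"
      then obtain z where z: "z \<in> Z.cocycles n" "U = qZ n z" by (auto simp: presentsD(1)[OF HZ])
      obtain y x where "snake n z y x" "h n (qZ n z) = qX (n + 1) x" using h_ex[OF z(1)] by blast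
      then show "h n U \<in> carrier (HX (n + 1))" using snakeX z by (auto simp: presentsD(1)[OF HX])
    qed
  next
    fix U U' assume "U \<in> carrier (HZ n)" "U' \<in> carrier (HZ n)"
    then obtain z z' where z: "z \<in> Z.cocycles n" "U = qZ n z" "z' \<in> Z.cocycles n" "U' = qZ n z'"
      by (auto simp: presentsD(1)[OF HZ])
    obtain y x y' x' where s: "snake n z y x" "snake n z' y' x'"
      using snake_ex[OF z(1)] snake_ex[OF z(3)] by blast
    then have "snake n (z + z') (y + y') (x + x')"
      by (simp add: snake_def Y.add_mem X.cocycles_add \<phi>_add Y.d_add \<psi>_add sg_simps)
    then have "h n (qZ n (z + z')) = qX (n + 1) (x + x')"
      using z by (intro h) (auto simp: Z.cocycles_add)
    then show "h n (U \<oplus>\<^bsub>HZ n\<^esub> U') = h n U \<oplus>\<^bsub>HX (n + 1)\<^esub> h n U'"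
      using z s snakeX by (simp add: presentsD(4)[OF HZ] h[OF z(1) s(1)] h[OF z(3) s(2)] presentsD(4)[OF HX])
  next
    fix c U assume "U \<in> carrier (HZ n)"
    then obtain z where z: "z \<in> Z.cocycles n" "U = qZ n z" by (auto simp: presentsD(1)[OF HZ])
    obtain y x where s: "snake n z y x" using snake_ex[OF z(1)] by blast
    then have "snake n (scZ c z) (scY c y) (scX c x)"
      by (simp add: snake_def Y.sc_mem X.cocycles_sc \<phi>_sc Y.d_sc \<psi>_sc sg_simps)
    then have "h n (qZ n (scZ c z)) = qX (n + 1) (scX c x)"
      using z by (intro h) (auto simp: Z.cocycles_sc)
    then show "h n (c \<odot>\<^bsub>HZ n\<^esub> U) = c \<odot>\<^bsub>HX (n + 1)\<^esub> h n U"
      using z s snakeX by (simp add: presentsD(5)[OF HZ] h[OF z(1) s(1)] presentsD(5)[OF HX])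
  qed
  have fg: "f n ` carrier (HX n) = {v \<in> carrier (HY n). g n v = \<zero>\<^bsub>HZ n\<^esub>}" for n
  proof (intro equalityI subsetI)
    fix V assume "V \<in> f n ` carrier (HX n)"
    then obtain x where x: "x \<in> X.cocycles n" "V = f n (qX n x)" by (auto simp: presentsD(1)[OF HX])
    then have "\<psi> (\<phi> x) = 0" by (auto simp: X.cocycles_def intro: \<psi>_\<phi>)
    then show "V \<in> {v \<in> carrier (HY n). g n v = \<zero>\<^bsub>HZ n\<^esub>}"
      using x \<phi>Z by (auto simp: f g presentsD(1)[OF HY] presentsD(2)[OF HZ])
  next
    fix V assume "V \<in> {v \<in> carrier (HY n). g n v = \<zero>\<^bsub>HZ n\<^esub>}"
    then obtain y where y: "y \<in> Y.cocycles n" "V = qY n y" and gy: "qZ n (\<psi> y) = qZ n 0"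
      by (auto simp: presentsD(1)[OF HY] presentsD(2)[OF HZ] g)
    have "\<psi> y \<in> dZ ` Z (n - 1)"
      using gy presentsD(3)[OF HZ \<psi>Z[OF y(1)] Z.cocycles_0] by simp
    then obtain c where c: "c \<in> Z (n - 1)" "\<psi> y = dZ c" by auto
    obtain b where b: "b \<in> Y (n - 1)" "\<psi> b = c" using surj[OF c(1)] by blast
    have db: "dY b \<in> Y.cocycles n" using Y.d_cocycles[OF b(1)] by simp
    have yb: "y - dY b \<in> Y.cocycles n" using Y.cocycles_add[OF y(1) Y.cocycles_minus[OF db]] by simp
    have "\<psi> (y - dY b) = 0" by (simp add: \<psi>_diff \<psi>_d[OF b(1)] b(2) c(2))
    then obtain x where x: "x \<in> X.cocycles n" "\<phi> x = y - dY b" using lift_cocycle[OF yb] by blast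
    have "\<phi> x - y \<in> dY ` Y (n - 1)"
      using x(2) Y.minus_mem[OF b(1)] Y.d_minus[of b] by force
    then have "f n (qX n x) = V"
      using presentsD(3)[OF HY \<phi>Z[OF x(1)] y(1)] x(1) y(2) by (simp add: f)
    then show "V \<in> f n ` carrier (HX n)" using x(1) by (auto simp: presentsD(1)[OF HX])
  qed
  have gh: "g n ` carrier (HY n) = {v \<in> carrier (HZ n). h n v = \<zero>\<^bsub>HX (n + 1)\<^esub>}" for n
  proof (intro equalityI subsetI)
    fix V assume "V \<in> g n ` carrier (HY n)"
    then obtain y where y: "y \<in> Y.cocycles n" "V = g n (qY n y)" by (auto simp: presentsD(1)[OF HY])
    \<comment> \<open>The snake of \<open>\<psi> y\<close> must lift \<open>sg n (\<psi> y)\<close>,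
      so the sign is put on \<open>y\<close>; the lift being a cocycle, 0 represents its
      image.\<close>
    define y' where "y' = (if neg n then - y else y)"
    have "snake n (\<psi> y) y' 0"
      using y(1) by (auto simp: snake_def X.cocycles_0 y'_def sg_def \<phi>_0 Y.cocycles_def Y.minus_mem Y.d_minus \<psi>_minus)
    then have "h n (qZ n (\<psi> y)) = qX (n + 1) 0" using h \<psi>Z y(1) by blast
    then show "V \<in> {v \<in> carrier (HZ n). h n v = \<zero>\<^bsub>HX (n + 1)\<^esub>}"
      using y \<psi>Z by (auto simp: g presentsD(1)[OF HZ] presentsD(2)[OF HX])
  next
    fix V assume "V \<in> {v \<in> carrier (HZ n). h n v = \<zero>\<^bsub>HX (n + 1)\<^esub>}"
    then obtain z where z: "z \<in> Z.cocycles n" "V = qZ n z" and hz: "h n (qZ n z) = qX (n + 1) 0"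
      by (auto simp: presentsD(1)[OF HZ] presentsD(2)[OF HX])
    obtain y x where s: "snake n z y x" using snake_ex[OF z(1)] by blast
    have "x \<in> dX ` X (n + 1 - 1)"
      using hz h[OF z(1) s] presentsD(3)[OF HX snakeX[OF s] X.cocycles_0] by simp
    then obtain w where w: "w \<in> X n" "x = dX w" by auto
    \<comment> \<open>As \<open>x = dX w\<close>, subtracting \<open>\<phi> w\<close> turns the lift
      \<open>y\<close> into a cocycle and keeps its image under \<open>\<psi>\<close>.\<close>
    define u where "u = y - \<phi> w"
    define y' where "y' = (if neg n then - u else u)"
    have u: "u \<in> Y.cocycles n" "\<psi> u = sg n z"
      using s w \<psi>_\<phi>[OF w(1)] by (auto simp: u_def snake_def Y.cocycles_def Y.diff_mem \<phi>_mem Y.d_diff \<phi>_d[OF w(1), symmetric] \<psi>_diff)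
    then have "y' \<in> Y.cocycles n" "\<psi> y' = z"
      by (auto simp: y'_def Y.cocycles_minus \<psi>_minus sg_def)
    then have "V = g n (qY n y')" "qY n y' \<in> carrier (HY n)"
      using z by (auto simp: g presentsD(1)[OF HY])
    then show "V \<in> g n ` carrier (HY n)" by blast
  qed
  have hf: "h n ` carrier (HZ n) = {v \<in> carrier (HX (n + 1)). f (n + 1) v = \<zero>\<^bsub>HY (n + 1)\<^esub>}" for n
  proof (intro equalityI subsetI)
    fix V assume "V \<in> h n ` carrier (HZ n)"
    then obtain z where z: "z \<in> Z.cocycles n" "V = h n (qZ n z)" by (auto simp: presentsD(1)[OF HZ])
    obtain y x where s: "snake n z y x" using snake_ex[OF z(1)] by blast
    then have "\<phi> x - 0 \<in> dY ` Y (n + 1 - 1)" by (auto simp: snake_def)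
    then have "qY (n + 1) (\<phi> x) = qY (n + 1) 0"
      using presentsD(3)[OF HY \<phi>Z[OF snakeX[OF s]] Y.cocycles_0] by simp
    then show "V \<in> {v \<in> carrier (HX (n + 1)). f (n + 1) v = \<zero>\<^bsub>HY (n + 1)\<^esub>}"
      using z h[OF z(1) s] snakeX[OF s] by (auto simp: f presentsD(1)[OF HX] presentsD(2)[OF HY])
  next
    fix V assume "V \<in> {v \<in> carrier (HX (n + 1)). f (n + 1) v = \<zero>\<^bsub>HY (n + 1)\<^esub>}"
    then obtain x where x: "x \<in> X.cocycles (n + 1)" "V = qX (n + 1) x" and fx: "qY (n + 1) (\<phi> x) = qY (n + 1) 0"
      by (auto simp: presentsD(1)[OF HX] presentsD(2)[OF HY] f)
    have "\<phi> x \<in> dY ` Y (n + 1 - 1)"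
      using fx presentsD(3)[OF HY \<phi>Z[OF x(1)] Y.cocycles_0] by simp
    then obtain y where y: "y \<in> Y n" "\<phi> x = dY y" by auto
    have "x \<in> X (n + 1)" using x(1) by (simp add: X.cocycles_def)
    then have "dZ (\<psi> y) = 0" using \<psi>_\<phi>[of x "n + 1"] y by (simp flip: \<psi>_d)
    then have z: "sg n (\<psi> y) \<in> Z.cocycles n"
      using y(1) by (simp add: Z.cocycles_def sg_mem \<psi>_mem sg_simps(2) flip: sg_simps(6))
    have "snake n (sg n (\<psi> y)) y x" using x y by (simp add: snake_def sg_simps)
    then have "V = h n (qZ n (sg n (\<psi> y)))" using h[OF z] x(2) by simp
    then show "V \<in> h n ` carrier (HZ n)" using z by (auto simp: presentsD(1)[OF HZ])
  qed
  show ?thesis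
    unfolding long_exact_def exact_pair_def by (intro allI conjI lf lg lh fg gh hf)
qed

end

section \<open>Multilinear forms\<close>

locale algebra_carrier =
  fixes scale :: "'k::field \<Rightarrow> 'r::ring \<Rightarrow> 'r" and A :: "'r set" and u :: 'r
  assumes zero_in: "0 \<in> A"
    and add_in: "x \<in> A \<Longrightarrow> y \<in> A \<Longrightarrow> x + y \<in> A"
    and scale_in: "x \<in> A \<Longrightarrow> scale c x \<in> A"
    and mult_in: "x \<in> A \<Longrightarrow> y \<in> A \<Longrightarrow> x * y \<in> A"
    and scale_left: "scale c x * y = scale c (x * y)"
    and scale_right: "x * scale c y = scale c (x * y)"
    and u_in: "u \<in> A"
    and u_left: "x \<in> A \<Longrightarrow> u * x = x"
    and u_right: "x \<in> A \<Longrightarrow> x * u = x"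
begin

definition lin :: "('r \<Rightarrow> 'k) \<Rightarrow> bool" where
  "lin g \<longleftrightarrow> (\<forall>x\<in>A. \<forall>y\<in>A. g (x + y) = g x + g y) \<and> (\<forall>c. \<forall>x\<in>A. g (scale c x) = c * g x)"

abbreviation ml :: "('r list \<Rightarrow> 'k) \<Rightarrow> bool" where
  "ml \<equiv> multilinear_on scale A (*)"

lemma ml_iff: "ml f \<longleftrightarrow> (\<forall>xs ys. set xs \<subseteq> A \<longrightarrow> set ys \<subseteq> A \<longrightarrow> lin (\<lambda>x. f (xs @ x # ys)))"
  by (simp add: multilinear_on_def lin_def)

lemma lin_mult: "lin g \<Longrightarrow> a \<in> A \<Longrightarrow> lin (\<lambda>x. g (a * x))" "lin g \<Longrightarrow> a \<in> A \<Longrightarrow> lin (\<lambda>x. g (x * a))"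
  by (simp_all add: lin_def mult_in distrib_left distrib_right scale_left scale_right)

lemma lin_zero: "lin (\<lambda>x. 0)"
  and lin_plus: "lin g \<Longrightarrow> lin h \<Longrightarrow> lin (\<lambda>x. g x + h x)"
  and lin_diff: "lin g \<Longrightarrow> lin h \<Longrightarrow> lin (\<lambda>x. g x - h x)"
  and lin_uminus: "lin g \<Longrightarrow> lin (\<lambda>x. - g x)"
  and lin_cmult: "lin g \<Longrightarrow> lin (\<lambda>x. c * g x)"
  by (simp_all add: lin_def algebra_simps)

lemma lin_sum: "(\<And>i. i \<in> I \<Longrightarrow> lin (g i)) \<Longrightarrow> lin (\<lambda>x. \<Sum>i\<in>I. g i x)"
  by (simp add: lin_def sum.distrib sum_distrib_left)

lemma lin_cong: "(\<And>x. x \<in> A \<Longrightarrow> g x = h x) \<Longrightarrow> lin g = lin h"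
  by (simp add: lin_def add_in scale_in)

lemma lin_0: "lin g \<Longrightarrow> g 0 = 0"
  using zero_in by (force simp: lin_def)

lemma lin_sum_arg:
  assumes "lin g" "finite I" "\<And>i. i \<in> I \<Longrightarrow> w i \<in> A"
  shows "g (\<Sum>i\<in>I. w i) = (\<Sum>i\<in>I. g (w i))"
proof -
  have "(\<Sum>i\<in>I. w i) \<in> A \<and> g (\<Sum>i\<in>I. w i) = (\<Sum>i\<in>I. g (w i))"
    using assms(2,3) by induction (use assms(1) in \<open>auto simp: lin_0 zero_in add_in, auto simp: lin_def\<close>)
  then show ?thesis by simp
qed

lemma mlD: "ml f \<Longrightarrow> set xs \<subseteq> A \<Longrightarrow> set ys \<subseteq> A \<Longrightarrow> lin (\<lambda>x. f (xs @ x # ys))"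
  by (simp add: ml_iff)

lemma mlD_hd: "ml f \<Longrightarrow> set ys \<subseteq> A \<Longrightarrow> lin (\<lambda>x. f (x # ys))"
  using mlD[of f "[]" ys] by simp

lemma ml_eq_0:
  assumes "ml f" "set xs \<subseteq> A" "0 \<in> set xs"
  shows "f xs = 0"
proof -
  obtain ys zs where xs: "xs = ys @ 0 # zs" using split_list[OF assms(3)] by blast
  then show ?thesis using lin_0[OF mlD[OF assms(1), of ys zs]] assms(2) by simp
qed

lemma ml_Cons: "ml f \<Longrightarrow> a \<in> A \<Longrightarrow> ml (\<lambda>zs. f (a # zs))"
  using mlD[of f "a # _"] by (simp add: ml_iff)

lemma ml_zero: "ml (\<lambda>x. 0)"
  and ml_plus: "ml g \<Longrightarrow> ml h \<Longrightarrow> ml (\<lambda>x. g x + h x)"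
  and ml_diff: "ml g \<Longrightarrow> ml h \<Longrightarrow> ml (\<lambda>x. g x - h x)"
  and ml_uminus: "ml g \<Longrightarrow> ml (\<lambda>x. - g x)"
  and ml_cmult: "ml g \<Longrightarrow> ml (\<lambda>x. c * g x)"
  by (simp_all add: ml_iff lin_zero lin_plus lin_diff lin_uminus lin_cmult)

text \<open>The number of summands depends on the length alone, which stays fixed while one entry
  varies.\<close>

lemma ml_length_sum:
  assumes "\<And>i. ml (g i)"
  shows "ml (\<lambda>xs. \<Sum>i<length xs. g i xs)"
  unfolding ml_iff length_append list.size by (intro allI impI lin_sum mlD assms)

lemma ml_cong:
  assumes "\<And>xs. set xs \<subseteq> A \<Longrightarrow> xs \<noteq> [] \<Longrightarrow> f xs = g xs"
  shows "ml f = ml g"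
  unfolding ml_iff by (intro iff_allI imp_cong refl lin_cong assms) auto

text \<open>Here the variable sits in the form and not in the list, as happens once the recursion of
  \<open>b'\<close> has frozen the varying entry.\<close>

lemma lin_dual_b':
  "(\<And>w. set w \<subseteq> A \<Longrightarrow> lin (\<lambda>x. F x w)) \<Longrightarrow> set ys \<subseteq> A \<Longrightarrow> lin (\<lambda>x. dual_b' (F x) ys)"
  unfolding dual_b'_def using set_face[of _ ys A] mult_in
  by (intro lin_sum lin_cmult) auto

text \<open>Induction on the entries to the left of the varying one, which the recursion at the head
  moves into the form one at a time.\<close>

lemma ml_dual_b':
  assumes "ml f"
  shows "ml (dual_b' f)"
proof -
  have "lin (\<lambda>x. dual_b' f (xs @ x # ys))" if "ml f" "set xs \<subseteq> A" "set ys \<subseteq> A" for xs ys f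
    using that
  proof (induction xs arbitrary: f)
    case Nil
    show ?case
    proof (cases ys)
      case (Cons z zs)
      have "lin (\<lambda>x. f (x * z # zs))" "lin (\<lambda>x. dual_b' (\<lambda>w. f (x # w)) (z # zs))"
        using Nil Cons lin_mult(2)[OF mlD_hd[of f zs], of z]
        by (auto intro!: lin_dual_b' mlD_hd)
      then show ?thesis by (simp add: Cons dual_b'_Cons2 lin_diff)
    qed (simp add: lin_zero)
  next
    case (Cons a xs)
    have IH: "lin (\<lambda>x. dual_b' (\<lambda>zs. f (a # zs)) (xs @ x # ys))"
      using Cons.prems by (intro Cons.IH ml_Cons) auto
    show ?case
    proof (cases xs)
      case Nil
      have "lin (\<lambda>x. f (a * x # ys))" using Cons.prems lin_mult(1)[OF mlD_hd[of f ys], of a] by simp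
      then show ?thesis using IH Nil by (simp add: dual_b'_Cons2 lin_diff)
    next
      case (Cons b bs)
      then have "lin (\<lambda>x. f ((a * b # bs) @ x # ys))" using Cons.prems by (intro mlD) (auto simp: mult_in)
      then show ?thesis using IH Cons by (simp add: dual_b'_Cons2 lin_diff)
    qed
  qed
  then show ?thesis using assms by (simp add: ml_iff)
qed

lemma ml_dual_c:
  assumes f: "ml f"
  shows "ml (dual_c f)"
  unfolding ml_iff
proof (intro allI impI)
  fix xs ys assume A: "set xs \<subseteq> A" "set ys \<subseteq> A"
  show "lin (\<lambda>x. dual_c f (xs @ x # ys))"
  proof (cases ys rule: rev_cases)
    case Nil
    show ?thesis
    proof (cases xs)
      case (Cons a as)
      then show ?thesis
        using Nil A lin_mult(2)[OF mlD_hd[of f as], of a] f dual_c_snoc[of "a # as" f]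
        by (simp add: lin_cmult lin_uminus)
    qed (simp add: Nil lin_zero)
  next
    case (snoc zs r)
    show ?thesis
    proof (cases xs)
      case Nil
      then show ?thesis
        using snoc A lin_mult(1)[OF mlD_hd[of f zs], of r] f dual_c_snoc[of "_ # zs" f r]
        by (simp add: lin_cmult lin_uminus)
    next
      case (Cons a as)
      then show ?thesis
        using snoc A mlD[of f "r * a # as" zs] f dual_c_snoc[of "a # as @ _ # zs" f r]
        by (simp add: lin_cmult lin_uminus mult_in)
    qed
  qed
qed

lemma ml_dual_b: "ml f \<Longrightarrow> ml (dual_b f)"
  using ml_plus[OF ml_dual_b' ml_dual_c, of f f] by (simp add: dual_b_eq[abs_def])

lemma ml_dual_t:
  assumes f: "ml f"
  shows "ml (dual_t f)"
  unfolding ml_iff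
proof (intro allI impI)
  fix xs ys assume A: "set xs \<subseteq> A" "set ys \<subseteq> A"
  show "lin (\<lambda>x. dual_t f (xs @ x # ys))"
  proof (cases ys rule: rev_cases)
    case Nil
    then show ?thesis using mlD_hd[OF f A(1)] by (simp add: dual_t_def lin_cmult)
  next
    case (snoc zs r)
    have "rotate_right (xs @ x # zs @ [r]) = r # xs @ x # zs" for x
      using rotate_right_snoc(1)[of "xs @ x # zs" r] by simp
    then show ?thesis using snoc mlD[OF f, of "r # xs" zs] A by (simp add: dual_t_def lin_cmult lin_uminus)
  qed
qed

lemma ml_dual_N: "ml f \<Longrightarrow> ml (dual_N f)"
proof -
  assume f: "ml f"
  have "ml ((dual_t ^^ j) f)" for j
    by (induction j) (simp_all add: f ml_dual_t)
  then show ?thesis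
    unfolding dual_N_def[abs_def] by (rule ml_length_sum)
qed

end

section \<open>The contracting homotopy\<close>

text \<open>In closed form: the alternating sum over \<open>j\<close> and all indices in
  \<open>I\<close> of the values at \<open>x_0 v_{i_0}, v_{i_0} x_1 v_{i_1}, ..., v_{i_{j-1}} x_j
  v_{i_j}, v_{i_j}, x_{j+1}, ...\<close>. With the unit as only idempotent, the unit is inserted
  behind each entry in turn.\<close>

fun ins :: "'i set \<Rightarrow> ('i \<Rightarrow> 'r::ring) \<Rightarrow> ('r list \<Rightarrow> 'k::field) \<Rightarrow> 'r list \<Rightarrow> 'k" where
  "ins I v f [] = 0"
| "ins I v f [x] = (\<Sum>i\<in>I. f [x * v i, v i])"
| "ins I v f (x # y # ys) =
     (\<Sum>i\<in>I. f (x * v i # v i # y # ys) - ins I v (\<lambda>zs. f (x * v i # zs)) (v i * y # ys))"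

text \<open>The summand of \<open>ins\<close> that inserts behind the last entry. There every entry
  is cut by idempotents, so that wrapping around produces a closed walk.\<close>

fun ins_last :: "'i set \<Rightarrow> ('i \<Rightarrow> 'r::ring) \<Rightarrow> ('r list \<Rightarrow> 'k::field) \<Rightarrow> 'r list \<Rightarrow> 'k" where
  "ins_last I v f [] = 0"
| "ins_last I v f [x] = (\<Sum>i\<in>I. f [x * v i, v i])"
| "ins_last I v f (x # y # ys) = - (\<Sum>i\<in>I. ins_last I v (\<lambda>zs. f (x * v i # zs)) (v i * y # ys))"

text \<open>The recursion of \<open>ins\<close> changes both the form and the head of the shorter
  list, so the hypothesis has to cover every form and every head.\<close>

lemma list_step_induct [case_names Nil single Cons2]:
  assumes "\<And>f. P f []" "\<And>f x. P f [x]"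
    and "\<And>f x y ys. (\<And>g z. P g (z # ys)) \<Longrightarrow> P f (x # y # ys)"
  shows "P f xs"
proof (cases xs)
  case (Cons x ys)
  have "P f (x # ys)"
    by (induction ys arbitrary: f x) (use assms in auto)
  then show ?thesis using Cons by simp
qed (simp add: assms)

lemma ins_diff: "ins I v (\<lambda>zs. f zs - g zs) xs = ins I v f xs - ins I v g xs"
  by (induction f xs arbitrary: g rule: list_step_induct; simp add: sum_subtractf; simp add: algebra_simps)

lemma ins_cmult: "ins I v (\<lambda>zs. c * f zs) xs = c * ins I v f xs"
  by (induction f xs rule: list_step_induct) (simp_all add: sum_subtractf algebra_simps sum_distrib_left)

lemma ins_hd: "ins I v (\<lambda>zs. f (a * hd zs # tl zs)) (y # ys) = ins I v f (a * y # ys)"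
  by (cases ys) (simp_all add: mult.assoc)

text \<open>An insertion in front of the last entry leaves that entry alone, so these insertions are
  \<open>ins\<close> of the shorter list; the one behind it remains.\<close>

lemma ins_snoc:
  assumes "ys \<noteq> []"
  shows "ins I v f (ys @ [r]) = ins I v (\<lambda>zs. f (zs @ [r])) ys + ins_last I v f (ys @ [r])"
proof -
  have "ins I v f (y # ys @ [r]) = ins I v (\<lambda>zs. f (zs @ [r])) (y # ys) + ins_last I v f (y # ys @ [r])" for y ys
  proof (induction ys arbitrary: y f)
    case Nil
    show ?case by (simp add: sum_subtractf)
  next
    case (Cons z zs)
    then show ?case by (simp add: sum_subtractf algebra_simps sum.distrib)
  qed
  then show ?thesis using assms by (cases ys) auto
qed

section \<open>Contraction by idempotents that add up to the unit\<close>

locale idempotent_system = algebra_carrier scale A u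
  for scale :: "'k::field \<Rightarrow> 'r::ring \<Rightarrow> 'r" and A u +
  fixes I :: "'i set" and v :: "'i \<Rightarrow> 'r"
  assumes I: "finite I"
    and v_in: "i \<in> I \<Longrightarrow> v i \<in> A"
    and v_idem: "i \<in> I \<Longrightarrow> v i * v i = v i"
    and v_sum: "(\<Sum>i\<in>I. v i) = u"
begin

lemma ins_cong:
  assumes "\<And>zs. set zs \<subseteq> A \<Longrightarrow> length zs = Suc (length xs) \<Longrightarrow> f zs = g zs" "set xs \<subseteq> A"
  shows "ins I v f xs = ins I v g xs"
  using assms
proof (induction f xs arbitrary: g rule: list_step_induct)
  case (single f x)
  then show ?case by (auto intro!: sum.cong simp: v_in mult_in)
next
  case (Cons2 f x y ys)
  have "ins I v (\<lambda>zs. f (x * v i # zs)) (v i * y # ys) = ins I v (\<lambda>zs. g (x * v i # zs)) (v i * y # ys)"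
    if "i \<in> I" for i
    using that Cons2.prems by (intro Cons2.IH) (auto simp: v_in mult_in)
  then show ?case using Cons2.prems by (auto intro!: sum.cong simp: v_in mult_in)
qed simp

lemma ins_zero: "ins I v (\<lambda>zs. 0) xs = 0"
  using ins_cmult[of I v 0 "\<lambda>zs. 0" xs] by simp

lemma lin_ins:
  "\<lbrakk>\<And>w. set w \<subseteq> A \<Longrightarrow> lin (\<lambda>x. F x w); set ys \<subseteq> A\<rbrakk> \<Longrightarrow> lin (\<lambda>x. ins I v (F x) ys)"
proof (induction F ys rule: list_step_induct)
  case (Cons2 F x y ys)
  have "lin (\<lambda>t. ins I v (\<lambda>zs. F t (x * v i # zs)) (v i * y # ys))" if "i \<in> I" for i
    using that Cons2.prems by (intro Cons2.IH) (auto simp: v_in mult_in)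
  then show ?case using Cons2.prems by (auto intro!: lin_sum lin_diff simp: v_in mult_in)
qed (auto intro!: lin_sum lin_zero simp: v_in mult_in)

lemma ml_ins:
  assumes "ml f"
  shows "ml (ins I v f)"
proof -
  have "lin (\<lambda>x. ins I v f (xs @ x # ys))" if "ml f" "set xs \<subseteq> A" "set ys \<subseteq> A" for xs ys f
    using that
  proof (induction f xs rule: list_step_induct)
    case (Nil f)
    show ?case
    proof (cases ys)
      case Nil
      have "lin (\<lambda>x. f [x * v i, v i])" if "i \<in> I" for i
        using that lin_mult(2)[OF mlD_hd[OF \<open>ml f\<close>, of "[v i]"], of "v i"] by (simp add: v_in)
      then show ?thesis by (simp add: Nil lin_sum)
    next
      case (Cons z zs)
      have "lin (\<lambda>x. f (x * v i # v i # z # zs))" if "i \<in> I" for i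
        using that lin_mult(2)[OF mlD_hd[OF \<open>ml f\<close>, of "v i # z # zs"], of "v i"] Nil Cons by (simp add: v_in)
      moreover have "lin (\<lambda>x. ins I v (\<lambda>w. f (x * v i # w)) (v i * z # zs))" if "i \<in> I" for i
        using that Nil Cons lin_mult(2)[OF mlD_hd[OF \<open>ml f\<close>], of _ "v i"]
        by (intro lin_ins) (auto simp: v_in mult_in)
      ultimately show ?thesis by (simp add: Cons lin_sum lin_diff)
    qed
  next
    case (single f a)
    have "lin (\<lambda>x. f (a * v i # v i # x # ys))" if "i \<in> I" for i
      using that mlD[OF \<open>ml f\<close>, of "[a * v i, v i]" ys] single by (simp add: v_in mult_in)
    moreover have "lin (\<lambda>x. ins I v (\<lambda>w. f (a * v i # w)) (v i * x # ys))" if i: "i \<in> I" for i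
    proof -
      have g: "ml (\<lambda>w. f (a * v i # w))" using single i by (intro ml_Cons) (auto simp: v_in mult_in)
      \<comment> \<open>In the recursive call the variable has become the head
        \<open>v i * x\<close>. Linearity in the head comes first and is then composed with left
        multiplication by \<open>v i\<close>.\<close>
      have "lin (\<lambda>x. ins I v (\<lambda>w. f (a * v i # w)) (x # ys))"
      proof (cases ys)
        case Nil
        have "lin (\<lambda>x. f [a * v i, x * v j, v j])" if "j \<in> I" for j
          using that lin_mult(2)[OF mlD_hd[OF g, of "[v j]"], of "v j"] by (simp add: v_in)
        then show ?thesis by (simp add: Nil lin_sum)
      next
        case (Cons z zs)
        have "lin (\<lambda>x. f (a * v i # x * v j # v j # z # zs))" if "j \<in> I" for j
          using that lin_mult(2)[OF mlD_hd[OF g, of "v j # z # zs"], of "v j"] single Cons by (simp add: v_in)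
        moreover have "lin (\<lambda>x. ins I v (\<lambda>w. f (a * v i # x * v j # w)) (v j * z # zs))" if "j \<in> I" for j
          using that single Cons lin_mult(2)[OF mlD_hd[OF g], of _ "v j"]
          by (intro lin_ins) (auto simp: v_in mult_in)
        ultimately show ?thesis by (simp add: Cons lin_sum lin_diff)
      qed
      from lin_mult(1)[OF this v_in[OF i]] show ?thesis .
    qed
    ultimately show ?case by (simp add: lin_sum lin_diff)
  next
    case (Cons2 f a b bs)
    have "lin (\<lambda>x. f (a * v i # v i # b # bs @ x # ys))" if "i \<in> I" for i
      using that mlD[OF \<open>ml f\<close>, of "a * v i # v i # b # bs" ys] Cons2.prems by (simp add: v_in mult_in)
    moreover have "lin (\<lambda>x. ins I v (\<lambda>w. f (a * v i # w)) ((v i * b # bs) @ x # ys))" if "i \<in> I" for i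
      using that Cons2.prems by (intro Cons2.IH ml_Cons) (auto simp: v_in mult_in)
    ultimately show ?case by (simp add: lin_sum lin_diff)
  qed
  then show ?thesis using assms by (simp add: ml_iff)
qed

lemma sum_mult_v: "x \<in> A \<Longrightarrow> (\<Sum>i\<in>I. x * v i) = x"
  by (simp add: v_sum u_right flip: sum_distrib_left)

lemma sum_mult_v_mult: "x \<in> A \<Longrightarrow> (\<Sum>i\<in>I. x * v i * y) = x * y"
  by (simp add: sum_mult_v flip: sum_distrib_right)

text \<open>Inserting idempotents contracts the bar differential: the two faces next to the inserted idempotent
  telescope.\<close>

lemma ins_dual_b':
  "\<lbrakk>ml f; set xs \<subseteq> A; xs \<noteq> []\<rbrakk> \<Longrightarrow> ins I v (dual_b' f) xs + dual_b' (ins I v f) xs = f xs"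
proof (induction f xs rule: list_step_induct)
  case (single f x)
  have "(\<Sum>i\<in>I. dual_b' f [x * v i, v i]) = (\<Sum>i\<in>I. f [x * v i])"
    by (rule sum.cong) (simp_all add: dual_b'_Cons2 mult.assoc v_idem)
  also have "\<dots> = f [\<Sum>i\<in>I. x * v i]"
    using single I by (intro lin_sum_arg[OF mlD_hd, symmetric]) (auto simp: v_in mult_in)
  finally show ?case using single by (simp add: sum_mult_v)
next
  case (Cons2 f x y ys)
  have A: "x \<in> A" "y \<in> A" "set ys \<subseteq> A" using Cons2.prems by auto
  let ?f = "\<lambda>i zs. f (x * v i # zs)"
  have f: "ml (?f i)" if "i \<in> I" for i
    using Cons2.prems that by (intro ml_Cons) (auto simp: v_in mult_in)
  have 1: "dual_b' f (x * v i # v i # y # ys)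
      = f (x * v i # y # ys) - f (x * v i # v i * y # ys) + dual_b' (\<lambda>zs. ?f i (v i # zs)) (y # ys)"
    if "i \<in> I" for i
    using that by (simp add: dual_b'_Cons2[of _ _ "v i"] dual_b'_Cons2[of _ "v i" y] mult.assoc v_idem)
  \<comment> \<open>The term \<open>f (x * v i # v i * y # ys)\<close> has the same sign here as in
    the preceding expansion; \<open>ins\<close> subtracts its recursive call, so the two cancel.
    This is the telescoping.\<close>
  have 2: "ins I v (\<lambda>zs. dual_b' f (x * v i # zs)) (v i * y # ys)
      = ins I v f (x * v i * y # ys) - f (x * v i # v i * y # ys) + dual_b' (ins I v (?f i)) (v i * y # ys)"
    if i: "i \<in> I" for i
  proof -
    have "ins I v (\<lambda>zs. dual_b' f (x * v i # zs)) (v i * y # ys)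
      = ins I v (\<lambda>zs. f (x * v i * hd zs # tl zs) - dual_b' (?f i) zs) (v i * y # ys)"
      by (rule ins_cong) (use A i in \<open>auto simp: v_in mult_in length_Suc_conv dual_b'_Cons2\<close>)
    also have "\<dots> = ins I v f (x * v i * (v i * y) # ys) - ins I v (dual_b' (?f i)) (v i * y # ys)"
      by (simp only: ins_diff ins_hd)
    also have "x * v i * (v i * y) = x * v i * y" using i by (metis mult.assoc v_idem)
    also have "ins I v (dual_b' (?f i)) (v i * y # ys)
      = f (x * v i # v i * y # ys) - dual_b' (ins I v (?f i)) (v i * y # ys)"
      using Cons2.IH[OF f[OF i], of "v i * y"] A i by (simp add: v_in mult_in algebra_simps)
    finally show ?thesis by simp
  qed
  have 3: "dual_b' (\<lambda>zs. ins I v f (x # zs)) (y # ys)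
      = (\<Sum>i\<in>I. dual_b' (\<lambda>zs. ?f i (v i # zs)) (y # ys) - dual_b' (ins I v (?f i)) (v i * y # ys))"
  proof -
    have "dual_b' (\<lambda>zs. ins I v f (x # zs)) (y # ys)
      = dual_b' (\<lambda>zs. \<Sum>i\<in>I. ?f i (v i # zs) - ins I v (?f i) (v i * hd zs # tl zs)) (y # ys)"
      by (rule dual_b'_cong_UNIV) (auto simp: neq_Nil_conv)
    also have "\<dots> = (\<Sum>i\<in>I. dual_b' (\<lambda>zs. ?f i (v i # zs)) (y # ys)
        - dual_b' (\<lambda>zs. ins I v (?f i) (v i * hd zs # tl zs)) (y # ys))"
      by (simp only: dual_b'_sum dual_b'_minus)
    finally show ?thesis by (simp only: dual_b'_hd)
  qed
  \<comment> \<open>Summation over \<open>i\<close> removes the idempotent by linearity in the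
    head.\<close>
  have "(\<Sum>i\<in>I. ins I v f (x * v i * y # ys)) = ins I v f ((\<Sum>i\<in>I. x * v i * y) # ys)"
    using A I Cons2.prems by (intro lin_sum_arg[OF mlD_hd[OF ml_ins], symmetric]) (auto simp: v_in mult_in)
  then have 4: "(\<Sum>i\<in>I. ins I v f (x * v i * y # ys)) = ins I v f (x * y # ys)"
    using A by (simp add: sum_mult_v_mult)
  have "(\<Sum>i\<in>I. f (x * v i # y # ys)) = f ((\<Sum>i\<in>I. x * v i) # y # ys)"
    using A I Cons2.prems by (intro lin_sum_arg[OF mlD_hd, symmetric]) (auto simp: v_in mult_in)
  then have 5: "(\<Sum>i\<in>I. f (x * v i # y # ys)) = f (x # y # ys)"
    using A by (simp add: sum_mult_v)
  have "ins I v (dual_b' f) (x # y # ys)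
    = (\<Sum>i\<in>I. f (x * v i # y # ys) + dual_b' (\<lambda>zs. ?f i (v i # zs)) (y # ys)
        - ins I v f (x * v i * y # ys) - dual_b' (ins I v (?f i)) (v i * y # ys))"
    by (auto intro!: sum.cong simp: 1 2)
  then show ?case
    by (simp add: dual_b'_Cons2[of "ins I v f"] 3 sum_subtractf sum.distrib 4 5)
qed simp

text \<open>Wrapping around affects the outer entries only by a left multiplication of the first.
  Insertions in front of the last entry commute with it up to a sign and cancel; the insertion
  behind the last entry has no counterpart.\<close>

lemma ins_dual_c:
  assumes "ml f" "set xs \<subseteq> A"
  shows "ins I v (dual_c f) xs + dual_c (ins I v f) xs = ins_last I v (dual_c f) xs"
proof (cases xs rule: rev_cases)
  case (snoc ys r)
  show ?thesis
  proof (cases ys)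
    case (Cons y zs)
    have "ins I v (\<lambda>zs. dual_c f (zs @ [r])) ys
      = ins I v (\<lambda>zs. (- 1) ^ Suc (length ys) * f (r * hd zs # tl zs)) ys"
    proof (rule ins_cong)
      show "set ys \<subseteq> A" using assms(2) snoc by simp
      fix zs :: "'r list" assume "length zs = Suc (length ys)"
      then show "dual_c f (zs @ [r]) = (- 1) ^ Suc (length ys) * f (r * hd zs # tl zs)"
        by (subst dual_c_snoc) auto
    qed
    also have "\<dots> = (- 1) ^ Suc (length ys) * ins I v f (r * y # zs)"
      unfolding Cons ins_cmult by (simp only: ins_hd)
    finally show ?thesis
      using dual_c_snoc[of ys "ins I v f" r] ins_snoc[of ys I v "dual_c f" r]
      by (simp add: snoc Cons)
  qed (simp add: snoc)
qed simp

section \<open>Walks in the Peirce decomposition\<close>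

fun walk :: "'i \<Rightarrow> 'r list \<Rightarrow> 'i \<Rightarrow> bool" where
  "walk i [] j \<longleftrightarrow> i = j"
| "walk i (z # zs) j \<longleftrightarrow> (\<exists>l\<in>I. v i * z = z \<and> z * v l = z \<and> walk l zs j)"

text \<open>The recursion reaches the end vertex \<open>j\<close> only at the last entry, so the
  hypothesis ranges over all \<open>j\<close>, while \<open>a\<close> remembers the idempotent in
  front of the list. The trailing \<open>v j\<close> is what the wrap-around face later uses to
  close the walk.\<close>

lemma ins_last_eq_0:
  assumes "xs \<noteq> []" "set xs \<subseteq> A" "a * hd xs = hd xs"
    and "\<And>z l zs j. \<lbrakk>z \<in> A; set zs \<subseteq> A; a * z = z; l \<in> I; j \<in> I; z * v l = z; walk l zs j;
      Suc (length zs) = length xs\<rbrakk> \<Longrightarrow> f (z # zs @ [v j]) = 0"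
  shows "ins_last I v f xs = 0"
  using assms
proof (induction f xs arbitrary: a rule: list_step_induct)
  case (single f x)
  have "f ((x * v i) # [] @ [v i]) = 0" if "i \<in> I" for i
    using that single(2,3) by (intro single(4)[where l = i]) (auto simp: v_in mult_in mult.assoc v_idem simp flip: mult.assoc[of a])
  then show ?case by simp
next
  case (Cons2 f x y ys)
  have "ins_last I v (\<lambda>zs. f (x * v i # zs)) (v i * y # ys) = 0" if i: "i \<in> I" for i
  proof (rule Cons2.IH[where a = "v i"])
    fix z l zs j
    assume z: "z \<in> A" "set zs \<subseteq> A" "v i * z = z" "l \<in> I" "j \<in> I" "z * v l = z" "walk l zs j"
      "Suc (length zs) = length (v i * y # ys)"
    have "f (x * v i # (z # zs) @ [v j]) = 0"
      using z i Cons2.prems(2,3)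
      by (intro Cons2.prems(4)[where l = i]) (auto simp: v_in mult_in mult.assoc v_idem simp flip: mult.assoc[of a])
    then show "f (x * v i # z # zs @ [v j]) = 0" by simp
  qed (use i Cons2.prems in \<open>auto simp: v_in mult_in v_idem simp flip: mult.assoc\<close>)
  then show ?case by simp
qed simp

text \<open>The homotopy preserves vanishing on \<open>B\<close>: an inserted idempotent either lies
  in \<open>B\<close>, and so does the enlarged list, or it annihilates \<open>B\<close> from the
  right and creates an entry 0.\<close>

lemma ins_eq_0:
  assumes "ml f" "B \<subseteq> A" "0 \<in> B" "\<And>x y. x \<in> B \<Longrightarrow> y \<in> B \<Longrightarrow> x * y \<in> B"
    and "\<And>i. i \<in> I \<Longrightarrow> v i \<in> B \<or> (\<forall>x\<in>B. x * v i = 0)"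
    and "\<And>zs. zs \<noteq> [] \<Longrightarrow> set zs \<subseteq> B \<Longrightarrow> f zs = 0" "set xs \<subseteq> B"
  shows "ins I v f xs = 0"
  using assms(1,6,7)
proof (induction f xs rule: list_step_induct)
  case (single f x)
  have "f [x * v i, v i] = 0" if i: "i \<in> I" for i
    using assms(5)[OF i] single assms(2,4) i ml_eq_0[of f "[0, v i]"] zero_in v_in[OF i] by auto
  then show ?case by simp
next
  case (Cons2 f x y ys)
  have A: "x \<in> B" "y \<in> B" "set ys \<subseteq> B" using Cons2.prems by auto
  have "f (x * v i # v i # y # ys) - ins I v (\<lambda>zs. f (x * v i # zs)) (v i * y # ys) = 0" if i: "i \<in> I" for i
  proof (cases "v i \<in> B")
    case True
    then have "ins I v (\<lambda>zs. f (x * v i # zs)) (v i * y # ys) = 0"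
      using A assms(2,4) Cons2.prems by (intro Cons2.IH ml_Cons) auto
    then show ?thesis using True A assms(4) Cons2.prems(2) by simp
  next
    case False
    then have "x * v i = 0" using assms(5)[OF i] A by auto
    moreover have "f (0 # zs) = 0" if "set zs \<subseteq> A" for zs
      using that Cons2.prems(1) zero_in by (intro ml_eq_0) auto
    moreover have "ins I v (\<lambda>zs. f (0 # zs)) (v i * y # ys) = ins I v (\<lambda>zs. 0) (v i * y # ys)"
      using A assms(2) i by (intro ins_cong calculation) (auto simp: v_in mult_in)
    moreover have "set (v i # y # ys) \<subseteq> A" using A assms(2) v_in[OF i] by auto
    ultimately show ?thesis by (simp add: ins_zero)
  qed
  then show ?case by simp
qed simp

end

section \<open>The total complexes\<close>

definition vdiff :: "nat \<Rightarrow> ('r::ring list \<Rightarrow> 'k::field) \<Rightarrow> 'r list \<Rightarrow> 'k" where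
  "vdiff p f xs = (if even p then dual_b f xs else - dual_b' f xs)"

definition hdiff :: "nat \<Rightarrow> ('r::ring list \<Rightarrow> 'k::field) \<Rightarrow> 'r list \<Rightarrow> 'k" where
  "hdiff p f xs = (if p = 0 then 0 else if odd p then f xs - dual_t f xs else dual_N f xs)"

lemma tot_diff_eq:
  "tot_diff A P f p xs =
    (if p \<in> P \<and> xs \<noteq> [] \<and> set xs \<subseteq> A then vdiff p (f p) xs + hdiff p (f (p - 1)) xs else 0)"
  by (simp add: tot_diff_def vdiff_def hdiff_def)

lemma set_cyclic_face:
  assumes "2 \<le> length xs" "set xs \<subseteq> A" "\<And>x y. x \<in> A \<Longrightarrow> y \<in> A \<Longrightarrow> x * y \<in> A"
  shows "set (cyclic_face xs) \<subseteq> A"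
proof -
  obtain x ys y where "xs = x # ys @ [y]"
    using assms(1) by (cases xs; cases "tl xs" rule: rev_cases) auto
  then show ?thesis using assms(2,3) by (auto simp: cyclic_face_def)
qed

lemma length_cyclic_face: "2 \<le> length xs \<Longrightarrow> length (cyclic_face xs) = length xs - 1"
  by (simp add: cyclic_face_def)

lemma dual_c_cong:
  assumes "\<And>zs. zs \<noteq> [] \<Longrightarrow> Suc (length zs) = length xs \<Longrightarrow> set zs \<subseteq> A \<Longrightarrow> f zs = g zs"
    and "set xs \<subseteq> A" "\<And>x y. x \<in> A \<Longrightarrow> y \<in> A \<Longrightarrow> x * y \<in> A"
  shows "dual_c f xs = dual_c g xs"
proof (cases "2 \<le> length xs")
  case True
  then have "f (cyclic_face xs) = g (cyclic_face xs)"
    using length_cyclic_face[OF True] set_cyclic_face[OF True assms(2,3)]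
    by (intro assms(1)) (auto simp: cyclic_face_def)
  then show ?thesis by (simp add: dual_c_def)
qed (simp add: dual_c_def)

lemma vdiff_cong:
  assumes "\<And>zs. zs \<noteq> [] \<Longrightarrow> Suc (length zs) = length xs \<Longrightarrow> set zs \<subseteq> A \<Longrightarrow> f zs = g zs"
    and "set xs \<subseteq> A" "\<And>x y. x \<in> A \<Longrightarrow> y \<in> A \<Longrightarrow> x * y \<in> A"
  shows "vdiff p f xs = vdiff p g xs"
  using dual_b'_cong[of xs A f g, OF assms] dual_c_cong[of xs A f g, OF assms]
  by (simp add: vdiff_def dual_b_eq)

lemma hdiff_cong:
  assumes "\<And>zs. zs \<noteq> [] \<Longrightarrow> length zs = length xs \<Longrightarrow> set zs \<subseteq> A \<Longrightarrow> f zs = g zs"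
    and "set xs \<subseteq> A" "xs \<noteq> []"
  shows "hdiff p f xs = hdiff p g xs"
  using dual_t_cong[OF assms(3,2,1)] dual_N_cong[OF assms(3,2,1)] assms
  by (simp add: hdiff_def)

lemma dual_b'_add: "dual_b' (\<lambda>zs. f zs + g zs) xs = dual_b' f xs + dual_b' g xs"
  by (simp add: dual_b'_def sum.distrib distrib_left)

lemma vdiff_add: "vdiff p (\<lambda>zs. f zs + g zs) xs = vdiff p f xs + vdiff p g xs"
  by (simp add: vdiff_def dual_b_def dual_b'_add distrib_left)

lemma vdiff_diff: "vdiff p (\<lambda>zs. f zs - g zs) xs = vdiff p f xs - vdiff p g xs"
  by (simp add: vdiff_def dual_b_def dual_b'_minus right_diff_distrib)

lemma vdiff_cmult: "vdiff p (\<lambda>zs. c * f zs) xs = c * vdiff p f xs"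
  by (simp add: vdiff_def dual_b_def dual_b'_cmult algebra_simps)

lemma hdiff_add: "xs \<noteq> [] \<Longrightarrow> hdiff p (\<lambda>zs. f zs + g zs) xs = hdiff p f xs + hdiff p g xs"
  by (simp add: hdiff_def dual_t_def dual_N_def funpow_dual_t sum.distrib algebra_simps)

lemma hdiff_diff: "xs \<noteq> [] \<Longrightarrow> hdiff p (\<lambda>zs. f zs - g zs) xs = hdiff p f xs - hdiff p g xs"
  by (simp add: hdiff_def dual_t_def dual_N_minus algebra_simps)

lemma hdiff_cmult: "xs \<noteq> [] \<Longrightarrow> hdiff p (\<lambda>zs. c * f zs) xs = c * hdiff p f xs"
  by (simp add: hdiff_def dual_t_def dual_N_def funpow_dual_t sum_distrib_left algebra_simps)

lemma vdiff_zero: "vdiff p (\<lambda>zs. 0) xs = 0"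
  using vdiff_cmult[of p 0 "\<lambda>zs. 0" xs] by simp

lemma hdiff_zero: "xs \<noteq> [] \<Longrightarrow> hdiff p (\<lambda>zs. 0) xs = 0"
  using hdiff_cmult[of xs p 0 "\<lambda>zs. 0"] by simp

lemma vdiff_vdiff: "vdiff p (vdiff p f) xs = 0"
proof (cases "even p")
  case True
  then have "vdiff p (vdiff p f) xs = dual_b (dual_b f) xs" by (simp add: vdiff_def[abs_def])
  then show ?thesis by (simp add: dual_b_dual_b)
next
  case False
  then have "vdiff p (vdiff p f) xs = - dual_b' (\<lambda>zs. (- 1) * dual_b' f zs) xs" by (simp add: vdiff_def[abs_def])
  then show ?thesis by (simp only: dual_b'_cmult dual_b'_dual_b') simp
qed

text \<open>The squares of the bicomplex anticommute because \<open>b'\<close> carries a minus sign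
  in odd columns.\<close>

lemma vdiff_hdiff:
  assumes "xs \<noteq> []" "0 < p"
  shows "vdiff p (hdiff p f) xs + hdiff p (vdiff (p - 1) f) xs = 0"
proof (cases "even p")
  case True
  then have "hdiff p (vdiff (p - 1) f) xs = hdiff p (\<lambda>zs. (- 1) * dual_b' f zs) xs"
    using assms by (simp add: vdiff_def[abs_def])
  also have "\<dots> = - dual_N (dual_b' f) xs"
    unfolding hdiff_cmult[OF assms(1)] using True assms by (simp add: hdiff_def)
  moreover have "vdiff p (hdiff p f) xs = dual_b (dual_N f) xs"
    using True assms by (simp add: vdiff_def hdiff_def[abs_def])
  ultimately show ?thesis using assms by (simp add: dual_b_dual_N)
next
  case False
  then show ?thesis
    using assms by (simp add: vdiff_def[abs_def] hdiff_def[abs_def] dual_t_dual_b)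
qed

lemma hdiff_hdiff:
  assumes "xs \<noteq> []"
  shows "hdiff (Suc p) (hdiff p f) xs = 0"
proof -
  consider "p = 0" | "odd p" | "even p" "p \<noteq> 0" by blast
  then show ?thesis
  proof cases
    case 2
    then show ?thesis
      using assms by (cases p) (auto simp: hdiff_def[abs_def] dual_N_minus dual_N_dual_t)
  next
    case 3
    then show ?thesis using assms by (simp add: hdiff_def[abs_def] dual_t_dual_N)
  qed (simp add: hdiff_def[abs_def] dual_t_def)
qed

abbreviation tot_scale :: "'k::field \<Rightarrow> (nat \<Rightarrow> 'r list \<Rightarrow> 'k) \<Rightarrow> nat \<Rightarrow> 'r list \<Rightarrow> 'k" where
  "tot_scale \<equiv> \<lambda>c f p xs. c * f p xs"

abbreviation down_closed :: "nat set \<Rightarrow> bool" where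
  "down_closed P \<equiv> (\<forall>p. Suc p \<in> P \<longrightarrow> p \<in> P)"

lemma tot_diff_add: "tot_diff A P (f + g) = tot_diff A P f + tot_diff A P g"
  by (rule ext)+ (simp add: tot_diff_eq plus_fun_def vdiff_add hdiff_add)

lemma tot_diff_scale: "tot_diff A P (tot_scale c f) = tot_scale c (tot_diff A P f)"
  by (rule ext)+ (simp add: tot_diff_eq vdiff_cmult hdiff_cmult algebra_simps)

context algebra_carrier
begin

abbreviation cochains :: "nat set \<Rightarrow> int \<Rightarrow> (nat \<Rightarrow> 'r list \<Rightarrow> 'k) set" where
  "cochains \<equiv> tot_cochains scale A"

lemma ml_vdiff: "ml f \<Longrightarrow> ml (vdiff p f)"
  by (cases "even p") (simp_all add: vdiff_def[abs_def] ml_dual_b ml_dual_b' ml_uminus)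

lemma ml_hdiff: "ml f \<Longrightarrow> ml (hdiff p f)"
  unfolding hdiff_def[abs_def]
  by (cases "p = 0"; cases "odd p") (simp_all add: ml_zero ml_diff ml_dual_t ml_dual_N)

lemma cochainsD:
  assumes "f \<in> cochains P n"
  shows "ml (f p)" "f p xs \<noteq> 0 \<Longrightarrow> p \<in> P" "f p xs \<noteq> 0 \<Longrightarrow> xs \<noteq> []" "f p xs \<noteq> 0 \<Longrightarrow> set xs \<subseteq> A"
    "f p xs \<noteq> 0 \<Longrightarrow> int p + (int (length xs) - 1) = n"
  using assms unfolding tot_cochains_def by blast+

lemma cochainsI:
  assumes "\<And>p. ml (f p)"
    "\<And>p xs. f p xs \<noteq> 0 \<Longrightarrow> p \<in> P \<and> xs \<noteq> [] \<and> set xs \<subseteq> A \<and> int p + (int (length xs) - 1) = n"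
  shows "f \<in> cochains P n"
  using assms unfolding tot_cochains_def by blast

lemma vdiff_neq_0:
  assumes "vdiff p f xs \<noteq> 0" "set xs \<subseteq> A"
  shows "\<exists>zs. zs \<noteq> [] \<and> Suc (length zs) = length xs \<and> f zs \<noteq> 0"
  using vdiff_cong[of xs A f "\<lambda>zs. 0" p] assms mult_in by (auto simp: vdiff_zero)

lemma hdiff_neq_0:
  assumes "hdiff p f xs \<noteq> 0" "set xs \<subseteq> A" "xs \<noteq> []"
  shows "p \<noteq> 0 \<and> (\<exists>zs. zs \<noteq> [] \<and> length zs = length xs \<and> f zs \<noteq> 0)"
proof
  show "p \<noteq> 0" using assms(1) by (auto simp: hdiff_def split: if_splits)
  show "\<exists>zs. zs \<noteq> [] \<and> length zs = length xs \<and> f zs \<noteq> 0"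
    using hdiff_cong[of xs A f "\<lambda>zs. 0" p] assms by (auto simp: hdiff_zero)
qed

lemma tot_diff_mem:
  assumes f: "f \<in> cochains P n"
  shows "tot_diff A P f \<in> cochains P (n + 1)"
proof (rule cochainsI)
  fix p
  have "ml (\<lambda>xs. vdiff p (f p) xs + hdiff p (f (p - 1)) xs)"
    by (intro ml_plus ml_vdiff ml_hdiff cochainsD(1)[OF f])
  then have "ml (\<lambda>xs. if p \<in> P then vdiff p (f p) xs + hdiff p (f (p - 1)) xs else 0)"
    by (cases "p \<in> P") (simp_all add: ml_zero)
  then show "ml (tot_diff A P f p)"
    by (subst ml_cong) (auto simp: tot_diff_eq)
  fix xs assume nz: "tot_diff A P f p xs \<noteq> 0"
  then have p: "p \<in> P" "xs \<noteq> []" "set xs \<subseteq> A"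
    and "vdiff p (f p) xs \<noteq> 0 \<or> hdiff p (f (p - 1)) xs \<noteq> 0"
    by (auto simp: tot_diff_eq split: if_splits)
  then have "int p + (int (length xs) - 1) = n + 1"
    using vdiff_neq_0[of p "f p" xs] hdiff_neq_0[of p "f (p - 1)" xs] cochainsD(5)[OF f] by force
  then show "p \<in> P \<and> xs \<noteq> [] \<and> set xs \<subseteq> A \<and> int p + (int (length xs) - 1) = n + 1"
    using p by simp
qed

text \<open>If \<open>P\<close> is closed downwards, column \<open>p - 1\<close> is present together
  with column \<open>p\<close>, so the columns in \<open>P\<close> see the same differential as in
  the full bicomplex.\<close>

lemma tot_diff_tot_diff:
  assumes P: "down_closed P"
  shows "tot_diff A P (tot_diff A P f) = 0"
proof (intro ext)
  fix p xs
  show "tot_diff A P (tot_diff A P f) p xs = 0 p xs"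
  proof (cases "p \<in> P \<and> xs \<noteq> [] \<and> set xs \<subseteq> A")
    case True
    then have p: "p \<in> P" "p - 1 \<in> P" and xs: "xs \<noteq> []" "set xs \<subseteq> A"
      using P by (cases p; simp)+
    have "vdiff p (tot_diff A P f p) xs = vdiff p (\<lambda>zs. vdiff p (f p) zs + hdiff p (f (p - 1)) zs) xs"
      using xs p mult_in by (intro vdiff_cong[where A = A]) (auto simp: tot_diff_eq)
    then have 1: "vdiff p (tot_diff A P f p) xs = vdiff p (hdiff p (f (p - 1))) xs"
      by (simp add: vdiff_add vdiff_vdiff)
    have "hdiff p (tot_diff A P f (p - 1)) xs
      = hdiff p (\<lambda>zs. vdiff (p - 1) (f (p - 1)) zs + hdiff (p - 1) (f (p - 1 - 1)) zs) xs"
      using xs p by (intro hdiff_cong[where A = A]) (auto simp: tot_diff_eq)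
    then have 2: "hdiff p (tot_diff A P f (p - 1)) xs
      = hdiff p (vdiff (p - 1) (f (p - 1))) xs + hdiff p (hdiff (p - 1) (f (p - 1 - 1))) xs"
      by (simp add: hdiff_add xs)
    show ?thesis
    proof (cases p)
      case 0
      have "vdiff 0 (hdiff 0 (f 0)) xs = vdiff 0 (\<lambda>zs. 0) xs"
        by (simp add: hdiff_def[abs_def])
      then show ?thesis using True 1 0 by (simp add: tot_diff_eq[of A P "tot_diff A P f"] vdiff_zero hdiff_def)
    next
      case (Suc m)
      then show ?thesis
        using True 1 2 vdiff_hdiff[of xs p "f (p - 1)"] hdiff_hdiff[of xs m "f (p - 1 - 1)"]
        by (simp add: tot_diff_eq[of A P "tot_diff A P f"] del: add.assoc flip: add.assoc)
    qed
  qed (auto simp: tot_diff_eq)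
qed

lemma tot_complex:
  assumes "down_closed P"
  shows "cochain_complex tot_scale (cochains P) (tot_diff A P)"
proof
  fix f g :: "nat \<Rightarrow> 'r list \<Rightarrow> 'k" and c n
  show "tot_scale c (f + g) = tot_scale c f + tot_scale c g"
    by (simp add: plus_fun_def algebra_simps)
  show "0 \<in> cochains P n"
    by (rule cochainsI) (simp_all add: zero_fun_def ml_zero)
  show "tot_diff A P (f + g) = tot_diff A P f + tot_diff A P g" by (rule tot_diff_add)
  show "tot_diff A P (tot_scale c f) = tot_scale c (tot_diff A P f)" by (rule tot_diff_scale)
  assume f: "f \<in> cochains P n"
  note D = cochainsD[OF f]
  show "f + g \<in> cochains P n" if g: "g \<in> cochains P n"
  proof (rule cochainsI)
    fix p xs
    show "ml ((f + g) p)" using ml_plus[OF D(1) cochainsD(1)[OF g]] by (simp add: plus_fun_def)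
    assume "(f + g) p xs \<noteq> 0"
    then have "f p xs \<noteq> 0 \<or> g p xs \<noteq> 0" by auto
    then show "p \<in> P \<and> xs \<noteq> [] \<and> set xs \<subseteq> A \<and> int p + (int (length xs) - 1) = n"
      using D cochainsD[OF g] by blast
  qed
  show "- f \<in> cochains P n"
    using D ml_uminus by (intro cochainsI) (auto simp: fun_Compl_def)
  show "tot_scale c f \<in> cochains P n"
  proof (rule cochainsI)
    show "ml (tot_scale c f p)" for p using ml_cmult[OF D(1)] by simp
    show "p \<in> P \<and> xs \<noteq> [] \<and> set xs \<subseteq> A \<and> int p + (int (length xs) - 1) = n"
      if "tot_scale c f p xs \<noteq> 0" for p xs
    proof -
      have "f p xs \<noteq> 0" using that by auto
      then show ?thesis using D by blast
    qed
  qed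
  show "tot_diff A P f \<in> cochains P (n + 1)" by (rule tot_diff_mem[OF f])
  show "tot_diff A P (tot_diff A P f) = 0" by (rule tot_diff_tot_diff[OF assms])
qed

end

section \<open>Acyclicity\<close>

text \<open>The one-element system contracts the odd columns over any algebra with unit; it serves
  to extend column 0 to column 1.\<close>

lemma (in algebra_carrier) idempotent_system_unit: "idempotent_system scale A u {()} (\<lambda>_. u)"
  by unfold_locales (simp_all add: u_in u_left)

context idempotent_system
begin

lemma ins_vdiff:
  assumes "ml f" "set xs \<subseteq> A" "xs \<noteq> []"
    and "even p \<Longrightarrow> ins_last I v (dual_c f) xs = 0"
  shows "ins I v (vdiff p f) xs + vdiff p (ins I v f) xs = (if even p then f xs else - f xs)"
proof (cases "even p")
  case True
  have "ins I v (dual_b f) xs = ins I v (\<lambda>zs. dual_b' f zs - (- 1) * dual_c f zs) xs"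
    by (simp add: dual_b_eq[abs_def])
  also have "\<dots> = ins I v (dual_b' f) xs + ins I v (dual_c f) xs"
    by (simp only: ins_diff ins_cmult) simp
  finally have "ins I v (dual_b f) xs + dual_b (ins I v f) xs
    = (ins I v (dual_b' f) xs + dual_b' (ins I v f) xs) + (ins I v (dual_c f) xs + dual_c (ins I v f) xs)"
    by (simp add: dual_b_eq[of "ins I v f"])
  also have "\<dots> = f xs"
    unfolding ins_dual_b'[OF assms(1-3)] ins_dual_c[OF assms(1,2)] using assms(4) True by simp
  finally show ?thesis using True by (simp add: vdiff_def[abs_def])
next
  case False
  have "ins I v (\<lambda>zs. (- 1) * dual_b' f zs) xs = - ins I v (dual_b' f) xs"
    by (simp only: ins_cmult) simp
  then show ?thesis
    using False unfolding ins_dual_b'[OF assms(1-3), symmetric] by (simp add: vdiff_def[abs_def])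
qed

text \<open>With this sign, \<open>homotopy p\<close> contracts column \<open>p\<close>.\<close>

definition homotopy :: "nat \<Rightarrow> ('r list \<Rightarrow> 'k) \<Rightarrow> 'r list \<Rightarrow> 'k" where
  "homotopy p f xs = (if set xs \<subseteq> A then if even p then ins I v f xs else - ins I v f xs else 0)"

lemma ml_homotopy: "ml f \<Longrightarrow> ml (homotopy p f)"
proof -
  assume "ml f"
  then have "ml (\<lambda>xs. if even p then ins I v f xs else - ins I v f xs)"
    by (cases "even p") (simp_all add: ml_ins ml_uminus)
  then show ?thesis by (subst ml_cong) (auto simp: homotopy_def)
qed

lemma homotopy_neq_0:
  assumes "homotopy p f xs \<noteq> 0"
  shows "set xs \<subseteq> A \<and> xs \<noteq> [] \<and> (\<exists>zs. zs \<noteq> [] \<and> length zs = Suc (length xs) \<and> set zs \<subseteq> A \<and> f zs \<noteq> 0)"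
proof (intro conjI)
  show A: "set xs \<subseteq> A" "xs \<noteq> []" using assms by (auto simp: homotopy_def split: if_splits)
  show "\<exists>zs. zs \<noteq> [] \<and> length zs = Suc (length xs) \<and> set zs \<subseteq> A \<and> f zs \<noteq> 0"
    using ins_cong[of xs f "\<lambda>_. 0"] assms A by (force simp: homotopy_def ins_zero split: if_splits)
qed

text \<open>On a vertical cocycle one half of the homotopy formula vanishes, and the sign built into
  \<open>homotopy\<close> undoes that of the odd columns.\<close>

lemma vdiff_homotopy:
  assumes "ml f" "set xs \<subseteq> A" "xs \<noteq> []"
    and "even p \<Longrightarrow> ins_last I v (dual_c f) xs = 0"
    and "\<And>zs. set zs \<subseteq> A \<Longrightarrow> zs \<noteq> [] \<Longrightarrow> vdiff p f zs = 0"
  shows "vdiff p (homotopy p f) xs = f xs"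
proof -
  have 1: "ins I v (vdiff p f) xs = 0"
    using ins_cong[of xs "vdiff p f" "\<lambda>zs. 0"] assms(2,5) by (force simp: ins_zero)
  have "vdiff p (homotopy p f) xs = vdiff p (\<lambda>zs. (if even p then 1 else - 1) * ins I v f zs) xs"
    by (rule vdiff_cong[OF _ assms(2) mult_in]) (auto simp: homotopy_def)
  then show ?thesis
    using ins_vdiff[OF assms(1-3), of p] assms(4) 1 unfolding vdiff_cmult by (auto split: if_splits)
qed

end

text \<open>The forms to be killed vanish on the members of \<open>\<B>\<close>. The rank makes every closed walk of
  nonzero elements stay at one vertex, so that its elements lie in a common member of \<open>\<B>\<close>.\<close>

locale idempotent_cover = idempotent_system scale A u I v
  for scale :: "'k::field \<Rightarrow> 'r::ring \<Rightarrow> 'r" and A u and I :: "'i set" and v +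
  fixes \<B> :: "'r set set" and \<rho> :: "'i \<Rightarrow> nat"
  assumes B_sub: "B \<in> \<B> \<Longrightarrow> B \<subseteq> A"
    and B_zero: "B \<in> \<B> \<Longrightarrow> 0 \<in> B"
    and B_mult: "B \<in> \<B> \<Longrightarrow> x \<in> B \<Longrightarrow> y \<in> B \<Longrightarrow> x * y \<in> B"
    and B_v: "B \<in> \<B> \<Longrightarrow> i \<in> I \<Longrightarrow> v i \<in> B \<or> (\<forall>x\<in>B. x * v i = 0)"
    and B_loop: "i \<in> I \<Longrightarrow> \<exists>B\<in>\<B>. \<forall>x\<in>A. v i * x * v i = x \<longrightarrow> x \<in> B"
    and rank: "i \<in> I \<Longrightarrow> l \<in> I \<Longrightarrow> i \<noteq> l \<Longrightarrow> \<rho> l \<le> \<rho> i \<Longrightarrow> x \<in> A \<Longrightarrow> v i * x * v l = 0"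
begin

definition good :: "('r list \<Rightarrow> 'k) \<Rightarrow> bool" where
  "good f \<longleftrightarrow> ml f \<and> (\<forall>B\<in>\<B>. \<forall>zs. zs \<noteq> [] \<longrightarrow> set zs \<subseteq> B \<longrightarrow> f zs = 0)"

lemma good_diff: "good f \<Longrightarrow> good g \<Longrightarrow> good (\<lambda>zs. f zs - g zs)"
  by (auto simp: good_def ml_diff)

lemma good_hdiff:
  assumes "good f"
  shows "good (hdiff p f)"
proof -
  have "hdiff p f zs = 0" if "B \<in> \<B>" "zs \<noteq> []" "set zs \<subseteq> B" for B zs
    using hdiff_cong[of zs B f "\<lambda>_. 0" p] that assms by (auto simp: good_def hdiff_zero)
  then show ?thesis using assms by (auto simp: good_def ml_hdiff)
qed

lemma good_homotopy:
  assumes "good f"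
  shows "good (homotopy p f)"
proof -
  have "ins I v f zs = 0" if "B \<in> \<B>" "zs \<noteq> []" "set zs \<subseteq> B" for B zs
    using assms that B_sub B_zero B_mult B_v by (intro ins_eq_0[of f B]) (auto simp: good_def)
  then show ?thesis using assms by (auto simp: good_def ml_homotopy homotopy_def)
qed

text \<open>A nonzero step between different vertices raises the rank strictly, so equal ranks at
  both ends force every step to be a loop at the start.\<close>

lemma walk_rank:
  "\<lbrakk>walk i zs j; i \<in> I; set zs \<subseteq> A; 0 \<notin> set zs\<rbrakk>
    \<Longrightarrow> \<rho> i \<le> \<rho> j \<and> (\<rho> i = \<rho> j \<longrightarrow> (\<forall>z\<in>set zs. v i * z * v i = z))"
proof (induction zs arbitrary: i)
  case (Cons z zs)
  then obtain l where l: "l \<in> I" "v i * z = z" "z * v l = z" "walk l zs j" by auto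
  have IH: "\<rho> l \<le> \<rho> j \<and> (\<rho> l = \<rho> j \<longrightarrow> (\<forall>z\<in>set zs. v l * z * v l = z))"
    using Cons.prems l by (intro Cons.IH) auto
  show ?case
  proof (cases "i = l")
    case True
    then show ?thesis using IH l by auto
  next
    case False
    have "v i * z * v l \<noteq> 0" using l Cons.prems by auto
    then have "\<not> \<rho> l \<le> \<rho> i" using rank[of i l z] False l(1) Cons.prems(2,3) by auto
    then show ?thesis using IH by simp
  qed
qed simp

lemma good_closed_walk:
  assumes f: "good f" and w: "walk j zs j" "j \<in> I" "set zs \<subseteq> A" "zs \<noteq> []"
  shows "f zs = 0"
proof (cases "0 \<in> set zs")
  case True
  then show ?thesis using f w ml_eq_0 by (auto simp: good_def)
next
  case False
  then have loops: "\<forall>z\<in>set zs. v j * z * v j = z" using walk_rank[OF w(1-3)] by auto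
  obtain B where B: "B \<in> \<B>" "\<forall>x\<in>A. v j * x * v j = x \<longrightarrow> x \<in> B" using B_loop[OF w(2)] by blast
  have "set zs \<subseteq> B" using B(2) loops w(3) by blast
  then show ?thesis using f B(1) w(4) by (auto simp: good_def)
qed

text \<open>The wrap-around face multiplies the trailing \<open>v j\<close> onto the first entry.
  The walk then starts at \<open>j\<close>, where it also ends.\<close>

lemma ins_last_good:
  assumes f: "good f" and xs: "set xs \<subseteq> A" "xs \<noteq> []"
  shows "ins_last I v (dual_c f) xs = 0"
proof (rule ins_last_eq_0[where a = u])
  show "u * hd xs = hd xs" using xs by (intro u_left) auto
  fix z l zs j
  assume z: "z \<in> A" "set zs \<subseteq> A" "u * z = z" "l \<in> I" "j \<in> I" "z * v l = z" "walk l zs j"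
  have "f ((v j * z) # zs) = 0"
  proof (rule good_closed_walk[OF f])
    have "v j * (v j * z) = v j * z" "v j * z * v l = v j * z"
      using z by (simp_all add: v_idem mult.assoc flip: mult.assoc[of "v j" "v j"])
    then show "walk j (v j * z # zs) j" using z by auto
  qed (use z in \<open>auto simp: v_in mult_in\<close>)
  then show "dual_c f (z # zs @ [v j]) = 0" using dual_c_snoc[of "z # zs" f "v j"] by simp
qed (use xs in auto)

text \<open>The columns of the bicomplex of forms vanishing on \<open>\<B>\<close> are contractible; a primitive of a total
  cocycle is found one column after the other.\<close>

lemma tot_acyclic:
  assumes P: "down_closed P" and f: "f \<in> cochains P n" and d: "tot_diff A P f = 0"
    and van: "\<And>p. good (f p)"
  shows "\<exists>g\<in>cochains P (n - 1). (\<forall>p. good (g p)) \<and> tot_diff A P g = f"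
proof -
  define g where "g = rec_nat (homotopy 0 (f 0))
    (\<lambda>p gp. homotopy (Suc p) (\<lambda>xs. f (Suc p) xs - hdiff (Suc p) gp xs))"
  have g0: "g 0 = homotopy 0 (f 0)"
    and gS: "g (Suc p) = homotopy (Suc p) (\<lambda>xs. f (Suc p) xs - hdiff (Suc p) (g p) xs)" for p
    by (simp_all add: g_def)
  have vf: "vdiff p (f p) xs + hdiff p (f (p - 1)) xs = 0" if "p \<in> P" "xs \<noteq> []" "set xs \<subseteq> A" for p xs
    using that fun_cong[OF fun_cong[OF d], of p xs] by (simp add: tot_diff_eq)
  have g: "good (g p) \<and> (\<forall>xs. g p xs \<noteq> 0 \<longrightarrow> xs \<noteq> [] \<and> set xs \<subseteq> A \<and> int p + (int (length xs) - 1) = n - 1)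
      \<and> (\<forall>xs. xs \<noteq> [] \<longrightarrow> set xs \<subseteq> A \<longrightarrow> vdiff p (g p) xs + hdiff p (g (p - 1)) xs = f p xs)"
    if "p \<in> P" for p
    using that
  proof (induction p)
    case 0
    have "int 0 + (int (length xs) - 1) = n - 1 \<and> xs \<noteq> [] \<and> set xs \<subseteq> A" if nz: "g 0 xs \<noteq> 0" for xs
    proof -
      obtain zs where "xs \<noteq> []" "set xs \<subseteq> A" "length zs = Suc (length xs)" "f 0 zs \<noteq> 0"
        using homotopy_neq_0[of 0 "f 0" xs] nz by (auto simp: g0)
      then show ?thesis using cochainsD(5)[OF f, of 0 zs] by simp
    qed
    moreover have "vdiff 0 (g 0) xs = f 0 xs" if "xs \<noteq> []" "set xs \<subseteq> A" for xs
      unfolding g0 using that van[of 0] vf[OF 0] ins_last_good[OF van]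
      by (intro vdiff_homotopy) (auto simp: good_def hdiff_def)
    ultimately show ?case using good_homotopy[OF van, of 0 0] by (auto simp: g0 hdiff_def)
  next
    case (Suc p)
    then have p: "p \<in> P" using P by blast
    \<comment> \<open>Column \<open>Suc p\<close> minus what the primitive in column
      \<open>p\<close> contributes there. It is again a vertical cocycle, because the squares
      anticommute and the rows square to zero, and it still vanishes on \<open>\<B>\<close>.\<close>
    define h where "h = (\<lambda>xs. f (Suc p) xs - hdiff (Suc p) (g p) xs)"
    have h: "good h" unfolding h_def using Suc p van by (intro good_diff good_hdiff) auto
    have gh: "g (Suc p) = homotopy (Suc p) h" by (simp add: gS h_def)
    have vh: "vdiff (Suc p) h xs = 0" if xs: "xs \<noteq> []" "set xs \<subseteq> A" for xs
    proof -
      have "hdiff (Suc p) (vdiff p (g p)) xs = hdiff (Suc p) (\<lambda>zs. f p zs - hdiff p (g (p - 1)) zs) xs"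
        using Suc.IH[OF p] xs by (intro hdiff_cong[where A = A]) (auto simp: eq_diff_eq)
      also have "\<dots> = hdiff (Suc p) (f p) xs"
        by (simp add: hdiff_diff hdiff_hdiff xs)
      finally show ?thesis
        using vdiff_hdiff[of xs "Suc p" "g p"] vf[OF Suc.prems xs] xs
        by (simp add: h_def vdiff_diff eq_neg_iff_add_eq_0) (metis add_eq_0_iff add.commute)
    qed
    have "int (Suc p) + (int (length xs) - 1) = n - 1 \<and> xs \<noteq> [] \<and> set xs \<subseteq> A" if nz: "g (Suc p) xs \<noteq> 0" for xs
    proof -
      obtain zs where zs: "xs \<noteq> []" "set xs \<subseteq> A" "zs \<noteq> []" "set zs \<subseteq> A" "length zs = Suc (length xs)" "h zs \<noteq> 0"
        using homotopy_neq_0[of "Suc p" h xs] nz by (auto simp: gh)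
      then consider "f (Suc p) zs \<noteq> 0" | "hdiff (Suc p) (g p) zs \<noteq> 0"
        by (cases "f (Suc p) zs = 0") (auto simp: h_def)
      then show ?thesis
      proof cases
        case 1
        then show ?thesis using zs cochainsD(5)[OF f, of "Suc p" zs] by simp
      next
        case 2
        then obtain ws where "length ws = length zs" "g p ws \<noteq> 0"
          using hdiff_neq_0[of "Suc p" "g p" zs] zs by auto
        then show ?thesis using zs Suc.IH[OF p] by force
      qed
    qed
    moreover have "vdiff (Suc p) (g (Suc p)) xs = h xs" if "xs \<noteq> []" "set xs \<subseteq> A" for xs
      unfolding gh using that h vh ins_last_good[OF h]
      by (intro vdiff_homotopy) (auto simp: good_def)
    ultimately show ?case using good_homotopy[OF h, of "Suc p"] by (auto simp: gh h_def)
  qed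
  \<comment> \<open>The recursion runs past the last column of \<open>P\<close>; the surplus columns
    are set to zero.\<close>
  define g' where "g' = (\<lambda>p. if p \<in> P then g p else (\<lambda>xs. 0))"
  have good: "good (g' p)" for p using g by (auto simp: g'_def good_def ml_zero)
  have "g' \<in> cochains P (n - 1)"
  proof (rule cochainsI)
    show "ml (g' p)" for p using good by (simp add: good_def)
    show "p \<in> P \<and> xs \<noteq> [] \<and> set xs \<subseteq> A \<and> int p + (int (length xs) - 1) = n - 1" if "g' p xs \<noteq> 0" for p xs
      using that g[of p] by (auto simp: g'_def split: if_splits)
  qed
  moreover have "tot_diff A P g' = f"
  proof (intro ext)
    fix p xs
    have "p - 1 \<in> P" if "p \<in> P" using P that by (cases p) auto
    then show "tot_diff A P g' p xs = f p xs"
      using g[of p] cochainsD(2-4)[OF f, of p xs] by (auto simp: tot_diff_eq g'_def)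
  qed
  ultimately show ?thesis using good by blast
qed

end

section \<open>Hochschild cohomology of the dual from the first two columns\<close>

declare One_nat_def [simp del]

lemma nat_cases2:
  obtains "p = 0" | "p = 1" | q where "p = Suc (Suc q)"
proof (cases p)
  case (Suc m)
  then show ?thesis using that by (cases m) (auto simp: One_nat_def)
qed

lemma bscale_dual: "bscale (dual_bimodule scale A) c \<phi> = (\<lambda>x. c * \<phi> x)"
  by (simp add: dual_bimodule_def)

lemma sum_fun_apply: "(\<Sum>i\<in>S. F i) r = (\<Sum>i\<in>S. F i r)"
  by (induction S rule: infinite_finite_induct) simp_all

lemma bar_diff_eq:
  "bar_diff A (dual_bimodule scale A) F xs r =
    (if 2 \<le> length xs \<and> set xs \<subseteq> A then dual_b' (\<lambda>zs. F zs r) xs else 0)"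
  by (simp add: bar_diff_def dual_bimodule_def dual_b'_def sum_fun_apply)

text \<open>The bar differential corresponds to \<open>b\<close> because the last face \<open>r\<^sub>n y\<close> enters the form in the
  position of the cyclic face.\<close>

lemma dual_b'_outer:
  fixes h :: "'r::ring list \<Rightarrow> 'k::field"
  shows "dual_b' (\<lambda>zs. if 2 \<le> length zs then h ((last zs * r * hd zs) # butlast (tl zs)) else 0) (x # as @ [y])
    = dual_b h ((y * r * x) # as)"
proof (cases as)
  case Nil
  then show ?thesis by (simp add: dual_b'_Cons2 dual_b_def)
next
  case (Cons a as')
  obtain ws s where ws: "as = ws @ [s]" using Cons by (metis rev_exhaust list.distinct(1))
  define G where "G = (\<lambda>zs. if 2 \<le> length zs then h ((last zs * r * hd zs) # butlast (tl zs)) else 0)"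
  have "dual_b' G (x # as @ [y]) = G (x * a # as' @ [y]) - dual_b' (\<lambda>zs. G (x # zs)) (as @ [y])"
    by (simp add: Cons dual_b'_Cons2)
  also have "dual_b' (\<lambda>zs. G (x # zs)) (as @ [y])
      = dual_b' (\<lambda>zs. G (x # zs @ [y])) as + (- 1) ^ length ws * G (x # ws @ [s * y])"
    using dual_b'_snoc[of "\<lambda>zs. G (x # zs)" ws s y] by (simp add: ws)
  also have "(\<lambda>zs. G (x # zs @ [y])) = (\<lambda>zs. h ((y * r * x) # zs))"
    by (auto simp: G_def)
  also have "G (x * a # as' @ [y]) = h ((y * r * x) * a # as')" by (simp add: G_def mult.assoc)
  also have "G (x # ws @ [s * y]) = h (s * (y * r * x) # ws)" by (simp add: G_def mult.assoc)
  finally have 1: "dual_b' G (x # as @ [y]) = h ((y * r * x) * a # as')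
      - (dual_b' (\<lambda>zs. h ((y * r * x) # zs)) as + (- 1) ^ length ws * h (s * (y * r * x) # ws))" .
  have "dual_b' h ((y * r * x) # as) = h ((y * r * x) * a # as') - dual_b' (\<lambda>zs. h ((y * r * x) # zs)) as"
    by (simp add: Cons dual_b'_Cons2)
  moreover have "dual_c h ((y * r * x) # as) = - ((- 1) ^ length ws * h (s * (y * r * x) # ws))"
    using dual_c_snoc[of "(y * r * x) # ws" h s] by (simp add: ws)
  ultimately show ?thesis using 1 by (simp add: dual_b_eq G_def)
qed

section \<open>Forms in column 0 as bar cochains\<close>

context algebra_carrier
begin

abbreviation "dual_bar \<equiv> bar_cochains scale A (dual_bimodule scale A)"
abbreviation "dual_bar_diff \<equiv> bar_diff A (dual_bimodule scale A)"
abbreviation "dual_bar_scale \<equiv> (\<lambda>c F xs. bscale (dual_bimodule scale A) c (F xs))"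

lemma to_bar_cong: "g 0 = h 0 \<Longrightarrow> to_bar A g = to_bar A h"
  by (intro ext) (simp add: to_bar_def)

lemma to_bar_add: "to_bar A (g + h) = to_bar A g + to_bar A h"
  and to_bar_minus: "to_bar A (- g) = - to_bar A g"
  and to_bar_zero: "to_bar A 0 = 0"
  and to_bar_scale: "to_bar A (tot_scale c g) = dual_bar_scale c (to_bar A g)"
  by (intro ext; simp add: to_bar_def dual_bimodule_def)+

text \<open>Units in the two outer slots recover the form, so equations between bar cochains can be
  read back in column 0.\<close>

lemma to_bar_eval:
  assumes "xs \<noteq> []" "set xs \<subseteq> A"
  shows "to_bar A g (u # tl xs @ [u]) (hd xs) = g 0 xs"
proof -
  obtain x ys where xs: "xs = x # ys" using assms(1) by (cases xs) auto
  have "u * x * u = x" using assms(2) by (simp add: xs u_left u_right)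
  then show ?thesis using assms(2) by (simp add: to_bar_def xs u_in)
qed

text \<open>Only column 0 is read, where no horizontal differential arrives and the vertical one is
  \<open>b\<close>.\<close>

lemma to_bar_tot_diff:
  assumes "0 \<in> P"
  shows "dual_bar_diff (to_bar A g) = to_bar A (tot_diff A P g)"
proof (intro ext)
  fix xs r
  show "dual_bar_diff (to_bar A g) xs r = to_bar A (tot_diff A P g) xs r"
  proof (cases "2 \<le> length xs \<and> set xs \<subseteq> A")
    case True
    then have xs: "2 \<le> length xs" "set xs \<subseteq> A" by auto
    show ?thesis
    proof (cases "r \<in> A")
      case r: True
      obtain x as y where xs': "xs = x # as @ [y]"
        using xs(1) by (cases xs; cases "tl xs" rule: rev_cases) auto
      have A: "x \<in> A" "y \<in> A" "set as \<subseteq> A" using xs(2) by (auto simp: xs')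
      have "dual_bar_diff (to_bar A g) xs r = dual_b' (\<lambda>zs. to_bar A g zs r) xs"
        using True by (simp add: bar_diff_eq)
      also have "\<dots> = dual_b' (\<lambda>zs. if 2 \<le> length zs then g 0 ((last zs * r * hd zs) # butlast (tl zs)) else 0) xs"
        by (rule dual_b'_cong[OF _ xs(2) mult_in]) (auto simp: to_bar_def r)
      also have "\<dots> = dual_b (g 0) ((y * r * x) # as)" unfolding xs' by (rule dual_b'_outer)
      finally show ?thesis
        using A r assms by (simp add: to_bar_def xs' tot_diff_eq vdiff_def hdiff_def mult_in)
    qed (simp add: bar_diff_eq to_bar_def dual_b'_def)
  next
    case False
    then show ?thesis by (auto simp: bar_diff_eq to_bar_def)
  qed
qed

lemma ml_fun: "(\<And>r. ml (\<lambda>zs. F zs r)) \<Longrightarrow> multilinear_on scale A (\<lambda>c \<phi> x. c * \<phi> x) F"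
  by (simp add: multilinear_on_def fun_eq_iff)

lemma ml_fun': "multilinear_on scale A (\<lambda>c \<phi> x. c * \<phi> x) F \<Longrightarrow> ml (\<lambda>zs. F zs r)"
  by (simp add: multilinear_on_def fun_eq_iff)

lemma ml_to_bar:
  assumes g: "ml (g 0)"
  shows "ml (\<lambda>zs. to_bar A g zs r)"
proof (cases "r \<in> A")
  case r: True
  show ?thesis
    unfolding ml_iff
  proof (intro allI impI)
    fix xs ys assume A: "set xs \<subseteq> A" "set ys \<subseteq> A"
    show "lin (\<lambda>x. to_bar A g (xs @ x # ys) r)"
    proof (cases xs)
      case xs: Nil
      show ?thesis
      proof (cases ys rule: rev_cases)
        case (snoc zs y)
        have "lin (\<lambda>x. to_bar A g (xs @ x # ys) r) = lin (\<lambda>x. g 0 (y * r * x # zs))"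
          using A r by (intro lin_cong) (simp add: to_bar_def xs snoc)
        then show ?thesis using A r snoc lin_mult(1)[OF mlD_hd[OF g, of zs], of "y * r"] by (simp add: mult_in)
      qed (simp add: to_bar_def xs lin_zero)
    next
      case xs: (Cons a as)
      show ?thesis
      proof (cases ys rule: rev_cases)
        case Nil
        have "lin (\<lambda>x. to_bar A g (xs @ x # ys) r) = lin (\<lambda>x. g 0 (x * (r * a) # as))"
          using A r by (intro lin_cong) (simp add: to_bar_def xs Nil mult.assoc)
        then show ?thesis using A r xs lin_mult(2)[OF mlD_hd[OF g, of as], of "r * a"] by (simp add: mult_in)
      next
        case (snoc zs y)
        have "butlast (as @ x # zs @ [y]) = as @ x # zs" for x
          using butlast_append[of "as @ x # zs" "[y]"] by simp
        then have "lin (\<lambda>x. to_bar A g (xs @ x # ys) r) = lin (\<lambda>x. g 0 ((y * r * a # as) @ x # zs))"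
          using A r by (intro lin_cong) (simp add: to_bar_def xs snoc)
        then show ?thesis using A r xs snoc mlD[OF g, of "y * r * a # as" zs] by (simp add: mult_in)
      qed
    qed
  qed
qed (simp add: to_bar_def ml_zero)

lemma to_bar_mem:
  assumes g: "g \<in> cochains P n"
  shows "to_bar A g \<in> dual_bar n"
proof -
  note D = cochainsD[OF g]
  have supp: "2 \<le> length xs \<and> int (length xs) = n + 2 \<and> set xs \<subseteq> A" if nz: "to_bar A g xs \<noteq> 0" for xs
  proof -
    obtain r where r: "to_bar A g xs r \<noteq> 0" using nz by (auto simp: fun_eq_iff)
    then have xs: "2 \<le> length xs" "set xs \<subseteq> A" and "g 0 ((last xs * r * hd xs) # butlast (tl xs)) \<noteq> 0"
      by (auto simp: to_bar_def split: if_splits)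
    then have "int (length xs - 2) = n" using D(5)[of 0] by force
    then show ?thesis using xs by simp
  qed
  have car: "to_bar A g xs \<in> bcarrier (dual_bimodule scale A)" for xs
  proof (cases "2 \<le> length xs \<and> set xs \<subseteq> A")
    case True
    have A: "last xs \<in> A" "hd xs \<in> A" "set (butlast (tl xs)) \<subseteq> A"
      using True by (cases xs; auto dest: in_set_butlastD)+
    have "lin (\<lambda>r. g 0 ((last xs * r * hd xs) # butlast (tl xs)))"
      using A lin_mult(1)[OF lin_mult(2)[OF mlD_hd[OF D(1) A(3)] A(2)] A(1)] by simp
    then show ?thesis
      using True by (simp add: dual_bimodule_def to_bar_def lin_def add_in scale_in)
  qed (auto simp: dual_bimodule_def to_bar_def)
  have act: "to_bar A g ((a * x) # xs @ [y]) = lact (dual_bimodule scale A) a (to_bar A g (x # xs @ [y])) \<and>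
      to_bar A g (x # xs @ [y * a]) = ract (dual_bimodule scale A) (to_bar A g (x # xs @ [y])) a"
    if "a \<in> A" "x \<in> A" "y \<in> A" "set xs \<subseteq> A" for a x y xs
    using that by (auto simp: fun_eq_iff to_bar_def dual_bimodule_def mult_in mult.assoc)
  have "multilinear_on scale A (bscale (dual_bimodule scale A)) (to_bar A g)"
    using ml_fun[OF ml_to_bar[of g, OF D(1)]] by (simp add: dual_bimodule_def)
  then show ?thesis unfolding bar_cochains_def using car supp act by blast
qed

lemma bar_eq_to_bar:
  assumes F: "F \<in> dual_bar n" and P: "0 \<in> P"
  shows "\<exists>g\<in>cochains P n. F = to_bar A g"
proof -
  have car: "\<And>xs. F xs \<in> bcarrier (dual_bimodule scale A)"
    and supp: "\<And>xs. F xs \<noteq> 0 \<Longrightarrow> 2 \<le> length xs \<and> int (length xs) = n + 2 \<and> set xs \<subseteq> A"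
    and ml: "multilinear_on scale A (bscale (dual_bimodule scale A)) F"
    and act: "\<And>a x y xs. \<lbrakk>a \<in> A; x \<in> A; y \<in> A; set xs \<subseteq> A\<rbrakk> \<Longrightarrow>
      F ((a * x) # xs @ [y]) = lact (dual_bimodule scale A) a (F (x # xs @ [y])) \<and>
      F (x # xs @ [y * a]) = ract (dual_bimodule scale A) (F (x # xs @ [y])) a"
    using F unfolding bar_cochains_def by blast+
  have ml': "ml (\<lambda>zs. F zs r)" for r using ml_fun'[of F r] ml by (simp add: dual_bimodule_def)
  have lin_F: "lin (F xs)" for xs using car[of xs] by (simp add: dual_bimodule_def lin_def)
  \<comment> \<open>Compatibility with the outer actions lets both outer entries be moved into the
    argument of the functional, so the values with units outside determine \<open>F\<close>; the
    argument then serves as entry 0.\<close>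
  define g :: "nat \<Rightarrow> 'r list \<Rightarrow> 'k" where "g = (\<lambda>p xs. if p = 0 \<and> xs \<noteq> [] \<and> set xs \<subseteq> A then F (u # tl xs @ [u]) (hd xs) else 0)"
  have mlF: "ml (\<lambda>xs. F (u # tl xs @ [u]) (hd xs))"
    unfolding ml_iff
  proof (intro allI impI)
    fix xs ys assume A: "set xs \<subseteq> A" "set ys \<subseteq> A"
    show "lin (\<lambda>x. F (u # tl (xs @ x # ys) @ [u]) (hd (xs @ x # ys)))"
    proof (cases xs)
      case (Cons a as)
      then show ?thesis using A mlD[OF ml'[of a], of "u # as" "ys @ [u]"] by (simp add: u_in)
    qed (simp add: lin_F)
  qed
  have "g \<in> cochains P n"
  proof (rule cochainsI)
    fix p
    have "ml (g p) = ml (\<lambda>xs. if p = 0 then F (u # tl xs @ [u]) (hd xs) else 0)"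
      by (rule ml_cong) (auto simp: g_def)
    then show "ml (g p)" using mlF ml_zero by (cases "p = 0") simp_all
    fix xs assume "g p xs \<noteq> 0"
    then have *: "p = 0" "xs \<noteq> []" "set xs \<subseteq> A" "F (u # tl xs @ [u]) \<noteq> 0" by (auto simp: g_def split: if_splits)
    then show "p \<in> P \<and> xs \<noteq> [] \<and> set xs \<subseteq> A \<and> int p + (int (length xs) - 1) = n"
      using supp[OF *(4)] P by (cases xs) auto
  qed
  moreover have "F = to_bar A g"
  proof (intro ext)
    fix xs r
    show "F xs r = to_bar A g xs r"
    proof (cases "2 \<le> length xs \<and> set xs \<subseteq> A \<and> r \<in> A")
      case True
      then obtain x as y where xs: "xs = x # as @ [y]" by (cases xs; cases "tl xs" rule: rev_cases) auto
      have A: "x \<in> A" "y \<in> A" "set as \<subseteq> A" "r \<in> A" using True by (auto simp: xs)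
      have "F (x # as @ [y]) r = F (u # as @ [y]) (r * x)"
        using act[of x u y as] A by (simp add: u_in u_right dual_bimodule_def)
      also have "\<dots> = F (u # as @ [u]) (y * (r * x))"
        using act[of y u u as] A by (simp add: u_in u_left dual_bimodule_def mult_in)
      finally show ?thesis using A by (simp add: xs to_bar_def g_def mult_in mult.assoc)
    next
      case False
      then show ?thesis
        using supp[of xs] car[of xs] by (cases "F xs = 0") (auto simp: to_bar_def dual_bimodule_def)
    qed
  qed
  ultimately show ?thesis by blast
qed

text \<open>Every bar cochain comes from a form in column 0 and \<open>to_bar\<close> respects all
  operations, so the axioms are inherited from the one-column complex.\<close>

lemma bar_complex: "cochain_complex dual_bar_scale dual_bar dual_bar_diff"
proof -
  interpret T: cochain_complex tot_scale "cochains {0}" "tot_diff A {0}"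
    by (rule tot_complex) simp
  have ex: "\<exists>g\<in>cochains {0} n. F = to_bar A g" if "F \<in> dual_bar n" for F n
    using bar_eq_to_bar[OF that, of "{0}"] by simp
  have mem: "g \<in> cochains {0} n \<Longrightarrow> to_bar A g \<in> dual_bar n" for g n
    by (rule to_bar_mem)
  have diff: "dual_bar_diff (to_bar A g) = to_bar A (tot_diff A {0} g)" for g by (rule to_bar_tot_diff) simp
  show ?thesis
  proof
    fix c n and F G :: "'r list \<Rightarrow> 'r \<Rightarrow> 'k"
    show "dual_bar_scale c (F + G) = dual_bar_scale c F + dual_bar_scale c G"
      by (simp add: fun_eq_iff dual_bimodule_def algebra_simps)
    show "0 \<in> dual_bar n" using mem[OF T.zero_mem] by (simp add: to_bar_zero)
    show "dual_bar_diff (F + G) = dual_bar_diff F + dual_bar_diff G"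
      by (intro ext) (simp add: bar_diff_eq dual_b'_add)
    show "dual_bar_diff (dual_bar_scale c F) = dual_bar_scale c (dual_bar_diff F)"
      by (intro ext) (simp add: bar_diff_eq bscale_dual dual_b'_cmult)
    assume "F \<in> dual_bar n"
    then obtain f where f: "f \<in> cochains {0} n" "F = to_bar A f" using ex by blast
    show "F + G \<in> dual_bar n" if "G \<in> dual_bar n"
    proof -
      obtain g where "g \<in> cochains {0} n" "G = to_bar A g" using ex[OF \<open>G \<in> dual_bar n\<close>] by blast
      then show ?thesis using mem[OF T.add_mem[OF f(1)]] f(2) by (simp add: to_bar_add)
    qed
    show "- F \<in> dual_bar n" using mem[OF T.minus_mem[OF f(1)]] f(2) by (simp add: to_bar_minus)
    show "dual_bar_scale c F \<in> dual_bar n" using mem[OF T.sc_mem[OF f(1)]] f(2) by (simp add: to_bar_scale)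
    show "dual_bar_diff F \<in> dual_bar (n + 1)" using mem[OF T.d_mem[OF f(1)]] f(2) by (simp add: diff)
    show "dual_bar_diff (dual_bar_diff F) = 0" using T.d_d[OF f(1)] f(2) by (simp add: diff to_bar_zero)
  qed
qed

sublocale T: cochain_complex tot_scale "cochains UNIV" "tot_diff A UNIV"
  by (rule tot_complex) simp

sublocale T2: cochain_complex tot_scale "cochains {0, 1}" "tot_diff A {0, 1}"
  by (rule tot_complex) auto

sublocale bar: cochain_complex dual_bar_scale dual_bar dual_bar_diff
  by (rule bar_complex)

text \<open>Column 1 is contractible, so primitives in column 0 extend.\<close>

lemma extend_column:
  assumes f: "f \<in> cochains {0, 1} n" "tot_diff A {0, 1} f = 0"
    and w: "w \<in> cochains P (n - 1)"
    and wf: "\<And>xs. xs \<noteq> [] \<Longrightarrow> set xs \<subseteq> A \<Longrightarrow> vdiff 0 (w 0) xs = f 0 xs"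
  shows "\<exists>w'\<in>cochains {0, 1} (n - 1). w' 0 = w 0 \<and> tot_diff A {0, 1} w' = f"
proof -
  interpret idempotent_system scale A u "{()}" "\<lambda>_. u" by (rule idempotent_system_unit)
  note D = cochainsD[OF f(1)] and W = cochainsD[OF w]
  \<comment> \<open>What is left of column 1 once column 0 of the primitive is fixed. This column
    carries \<open>- b'\<close>, so the homotopy contracts it without any condition on
    walks.\<close>
  define h where "h = (\<lambda>xs. f 1 xs - hdiff 1 (w 0) xs)"
  have h: "ml h" unfolding h_def by (intro ml_diff ml_hdiff D W)
  have vh: "vdiff 1 h xs = 0" if xs: "set xs \<subseteq> A" "xs \<noteq> []" for xs
  proof -
    have "hdiff 1 (vdiff 0 (w 0)) xs = hdiff 1 (f 0) xs"
      using wf xs by (intro hdiff_cong[where A = A]) auto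
    moreover have "vdiff 1 (f 1) xs + hdiff 1 (f 0) xs = 0"
      using fun_cong[OF fun_cong[OF f(2)], of 1 xs] xs by (simp add: tot_diff_eq)
    moreover have "vdiff 1 (hdiff 1 (w 0)) xs + hdiff 1 (vdiff 0 (w 0)) xs = 0"
      using vdiff_hdiff[of xs 1 "w 0"] xs by simp
    ultimately show ?thesis by (simp add: h_def vdiff_diff add_eq_0_iff2)
  qed
  define w' :: "nat \<Rightarrow> 'r list \<Rightarrow> 'k" where "w' = (\<lambda>p. if p = 0 then w 0 else if p = 1 then homotopy 1 h else (\<lambda>xs. 0))"
  have "w' \<in> cochains {0, 1} (n - 1)"
  proof (rule cochainsI)
    show "ml (w' p)" for p using W(1) h by (simp add: w'_def ml_homotopy ml_zero)
    fix p xs assume nz: "w' p xs \<noteq> 0"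
    then consider "p = 0" "w 0 xs \<noteq> 0" | "p = 1" "homotopy 1 h xs \<noteq> 0"
      by (auto simp: w'_def split: if_splits)
    then show "p \<in> {0, 1} \<and> xs \<noteq> [] \<and> set xs \<subseteq> A \<and> int p + (int (length xs) - 1) = n - 1"
    proof cases
      case 1
      then show ?thesis using W(3-5)[of 0 xs] by simp
    next
      case 2
      then obtain zs where zs: "xs \<noteq> []" "set xs \<subseteq> A" "zs \<noteq> []" "set zs \<subseteq> A"
        "length zs = Suc (length xs)" "h zs \<noteq> 0"
        using homotopy_neq_0[OF 2(2)] by auto
      then consider "f 1 zs \<noteq> 0" | "hdiff 1 (w 0) zs \<noteq> 0" by (cases "f 1 zs = 0") (auto simp: h_def)
      then show ?thesis
      proof cases
        case 1
        then show ?thesis using zs 2 D(5)[of 1 zs] by simp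
      next
        case 2
        then obtain ws where "length ws = length zs" "w 0 ws \<noteq> 0"
          using hdiff_neq_0[of 1 "w 0" zs] zs by auto
        then show ?thesis using zs \<open>p = 1\<close> W(5)[of 0 ws] by simp
      qed
    qed
  qed
  moreover have "tot_diff A {0, 1} w' = f"
  proof (intro ext)
    fix p xs
    have "vdiff 1 (homotopy 1 h) xs = h xs" if "set xs \<subseteq> A" "xs \<noteq> []"
      using that h vh by (intro vdiff_homotopy) auto
    then show "tot_diff A {0, 1} w' p xs = f p xs"
      using D(2-4)[of p xs] wf[of xs]
      by (cases p rule: nat_cases2) (auto simp: tot_diff_eq w'_def h_def hdiff_def[of 0])
  qed
  moreover have "w' 0 = w 0" by (simp add: w'_def)
  ultimately show ?thesis by blast
qed

end

text \<open>Criterion for an isomorphism on cohomology in one degree: cocycles lift to cocycles, and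
  a cocycle with coboundary image is a coboundary. The cohomology of the target is then presented by
  the source.\<close>

lemma presents_surj_chain_map:
  assumes "cochain_complex scX X d" "cochain_complex scY Y e"
    and \<phi>: "\<And>x y. \<phi> (x + y) = \<phi> x + \<phi> y" "\<And>c x. \<phi> (scX c x) = scY c (\<phi> x)"
      "\<And>x. x \<in> X n \<Longrightarrow> \<phi> x \<in> Y n" "\<And>x. x \<in> X n \<Longrightarrow> \<phi> (d x) = e (\<phi> x)"
      "\<And>x. x \<in> X (n - 1) \<Longrightarrow> \<phi> x \<in> Y (n - 1)" "\<And>x. x \<in> X (n - 1) \<Longrightarrow> \<phi> (d x) = e (\<phi> x)"
    and surj: "\<And>y. y \<in> Y n \<Longrightarrow> e y = 0 \<Longrightarrow> \<exists>x\<in>X n. d x = 0 \<and> \<phi> x = y"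
    and inj: "\<And>x. x \<in> X n \<Longrightarrow> d x = 0 \<Longrightarrow> \<phi> x \<in> e ` Y (n - 1) \<Longrightarrow> x \<in> d ` X (n - 1)"
  shows "presents (cohomology scY Y e n) scX (cochain_complex.cocycles X d n) (d ` X (n - 1))
    (\<lambda>x. coset_class Y e n (\<phi> x))"
proof -
  interpret X: cochain_complex scX X d by fact
  interpret Y: cochain_complex scY Y e by fact
  note p = presentsD[OF Y.presents_cohomology[of n]]
  have \<phi>0: "\<phi> 0 = 0" using \<phi>(1)[of 0 0] by simp
  have \<phi>d: "\<phi> (x - y) = \<phi> x - \<phi> y" for x y using \<phi>(1)[of "x - y" y] by simp
  have mem: "\<phi> x \<in> Y.cocycles n" if "x \<in> X.cocycles n" for x
    using that \<phi>(3,4)[of x] by (auto simp: X.cocycles_def Y.cocycles_def \<phi>0)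
  have "\<phi> ` X.cocycles n = Y.cocycles n"
    using mem surj by (force simp: X.cocycles_def Y.cocycles_def)
  then have car: "carrier (cohomology scY Y e n) = (\<lambda>x. coset_class Y e n (\<phi> x)) ` X.cocycles n"
    using p(1) by (metis image_image)
  have "coset_class Y e n (\<phi> x) = coset_class Y e n (\<phi> y) \<longleftrightarrow> x - y \<in> d ` X (n - 1)"
    if "x \<in> X.cocycles n" "y \<in> X.cocycles n" for x y
  proof -
    have "coset_class Y e n (\<phi> x) = coset_class Y e n (\<phi> y) \<longleftrightarrow> \<phi> (x - y) \<in> e ` Y (n - 1)"
      unfolding \<phi>d by (rule p(3)[OF mem[OF that(1)] mem[OF that(2)]])
    moreover have "x - y \<in> X n" "d (x - y) = 0"
      using that by (auto simp: X.cocycles_def X.diff_mem X.d_diff)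
    ultimately show ?thesis using inj[of "x - y"] \<phi>(5,6) by force
  qed
  then show ?thesis
    unfolding presents_def using car p(2,4,5) mem by (simp add: \<phi>0 \<phi>(1,2))
qed

section \<open>Cochain maps behind the Connes sequence\<close>

definition connes_shift :: "(nat \<Rightarrow> 'r list \<Rightarrow> 'k::field) \<Rightarrow> nat \<Rightarrow> 'r list \<Rightarrow> 'k" where
  "connes_shift f p = (if 2 \<le> p then f (p - 2) else 0)"

definition connes_trunc :: "(nat \<Rightarrow> 'r list \<Rightarrow> 'k::field) \<Rightarrow> nat \<Rightarrow> 'r list \<Rightarrow> 'k" where
  "connes_trunc f p = (if p < 2 then f p else 0)"

definition connes_boundary :: "'r::ring set \<Rightarrow> (nat \<Rightarrow> 'r list \<Rightarrow> 'k::field) \<Rightarrow> nat \<Rightarrow> 'r list \<Rightarrow> 'k" where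
  "connes_boundary A g p = tot_diff A UNIV g (p + 2)"

lemma connes_shift_zero: "connes_shift 0 = 0"
  and connes_trunc_zero: "connes_trunc 0 = 0"
  by (intro ext; simp add: connes_shift_def connes_trunc_def)+

lemma connes_shift_add: "connes_shift (f + g) = connes_shift f + connes_shift g"
  and connes_shift_scale: "connes_shift (tot_scale c f) = tot_scale c (connes_shift f)"
  and connes_trunc_add: "connes_trunc (f + g) = connes_trunc f + connes_trunc g"
  and connes_trunc_scale: "connes_trunc (tot_scale c f) = tot_scale c (connes_trunc f)"
  and connes_trunc_minus: "connes_trunc (- f) = - connes_trunc f"
  and connes_shift_minus: "connes_shift (- f) = - connes_shift f"
  and connes_boundary_add: "connes_boundary A (f + g) = connes_boundary A f + connes_boundary A g"
  by (rule ext; simp add: connes_shift_def connes_trunc_def connes_boundary_def zero_fun_def fun_eq_iff tot_diff_add)+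

lemma connes_boundary_minus: "connes_boundary A (- f) = - connes_boundary A f"
proof (rule minus_unique[symmetric])
  have "connes_boundary A (f - f) = 0"
    using connes_boundary_add[of A "f - f" "f - f"] by simp
  then show "connes_boundary A f + connes_boundary A (- f) = 0" by (simp flip: connes_boundary_add)
qed

context algebra_carrier
begin

definition HH_class :: "int \<Rightarrow> (nat \<Rightarrow> 'r list \<Rightarrow> 'k) \<Rightarrow> ('r list \<Rightarrow> 'r \<Rightarrow> 'k) set" where
  "HH_class n g = coset_class dual_bar dual_bar_diff n (to_bar A g)"

abbreviation HC_class :: "int \<Rightarrow> (nat \<Rightarrow> 'r list \<Rightarrow> 'k) \<Rightarrow> (nat \<Rightarrow> 'r list \<Rightarrow> 'k) set" where
  "HC_class \<equiv> coset_class (cochains UNIV) (tot_diff A UNIV)"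

abbreviation HC2_class :: "int \<Rightarrow> (nat \<Rightarrow> 'r list \<Rightarrow> 'k) \<Rightarrow> (nat \<Rightarrow> 'r list \<Rightarrow> 'k) set" where
  "HC2_class \<equiv> coset_class (cochains {0, 1}) (tot_diff A {0, 1})"

lemma HC_presents:
  "presents (HC scale A n) tot_scale (T.cocycles n) (tot_diff A UNIV ` cochains UNIV (n - 1)) (HC_class n)"
  unfolding HC_def tot_cohomology_def by (rule T.presents_cohomology)

lemma HC2_presents:
  "presents (HC2 scale A n) tot_scale (T2.cocycles n) (tot_diff A {0, 1} ` cochains {0, 1} (n - 1)) (HC2_class n)"
  unfolding tot_cohomology_def by (rule T2.presents_cohomology)

text \<open>With the same cocycles and coboundaries as for the two-column complex, \<open>B\<close>,
  \<open>I\<close> and the restrictions of Hochschild classes can be computed on forms.\<close>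

lemma HH_presents:
  "presents (HH scale A n) tot_scale (T2.cocycles n) (tot_diff A {0, 1} ` cochains {0, 1} (n - 1)) (HH_class n)"
proof -
  have diff: "dual_bar_diff (to_bar A g) = to_bar A (tot_diff A {0, 1} g)" for g by (rule to_bar_tot_diff) simp
  have col0: "vdiff 0 (g 0) xs = f 0 xs"
    if "dual_bar_diff (to_bar A g) = to_bar A f" "xs \<noteq> []" "set xs \<subseteq> A" for f g xs
    using that to_bar_eval[OF that(2,3), of f] to_bar_eval[OF that(2,3), of "tot_diff A {0, 1} g"]
    by (simp add: diff tot_diff_eq hdiff_def)
  show ?thesis
    unfolding HH_def hochschild_def HH_class_def
  proof (rule presents_surj_chain_map[OF T2.cochain_complex_axioms bar.cochain_complex_axioms])
    fix F assume F: "F \<in> dual_bar n" "dual_bar_diff F = 0"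
    obtain g where g: "g \<in> cochains {0, 1} n" "F = to_bar A g"
      using bar_eq_to_bar[OF F(1), of "{0, 1}"] by auto
    \<comment> \<open>A cocycle in column 0 is a partial primitive of the zero cochain one degree
      higher; extending it over column 1 gives a two-column cocycle.\<close>
    have "\<exists>w'\<in>cochains {0, 1} (n + 1 - 1). w' 0 = g 0 \<and> tot_diff A {0, 1} w' = 0"
    proof (rule extend_column)
      show "vdiff 0 (g 0) xs = 0 0 xs" if "xs \<noteq> []" "set xs \<subseteq> A" for xs
        using col0[OF _ that, of g 0] F(2) g(2) by (simp add: to_bar_zero)
      show "g \<in> cochains {0, 1} (n + 1 - 1)" using g(1) by simp
    qed (rule T2.zero_mem T2.d_zero)+
    then show "\<exists>x\<in>cochains {0, 1} n. tot_diff A {0, 1} x = 0 \<and> to_bar A x = F"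
      using g(2) to_bar_cong by force
  next
    fix f assume f: "f \<in> cochains {0, 1} n" "tot_diff A {0, 1} f = 0"
      and "to_bar A f \<in> dual_bar_diff ` dual_bar (n - 1)"
    then obtain G where G: "G \<in> dual_bar (n - 1)" "dual_bar_diff G = to_bar A f" by auto
    obtain g where g: "g \<in> cochains {0, 1} (n - 1)" "G = to_bar A g"
      using bar_eq_to_bar[OF G(1), of "{0, 1}"] by auto
    have "\<exists>w'\<in>cochains {0, 1} (n - 1). w' 0 = g 0 \<and> tot_diff A {0, 1} w' = f"
      using G(2) g(2) by (intro extend_column[OF f g(1)] col0) auto
    then show "f \<in> tot_diff A {0, 1} ` cochains {0, 1} (n - 1)" by auto
  qed (auto simp: to_bar_add to_bar_scale diff intro: to_bar_mem)
qed

lemma HC2_to_HH_class: "HC2_to_HH scale A n (HC2_class n g) = HH_class n g"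
  unfolding HC2_to_HH_def HH_def hochschild_def HH_class_def
proof (rule bar.induced_coset_class)
  fix x assume "x \<in> cochains {0, 1} (n - 1)"
  then have "to_bar A (tot_diff A {0, 1} x) = dual_bar_diff (to_bar A x)" "to_bar A x \<in> dual_bar (n - 1)"
    by (auto simp: to_bar_tot_diff[of "{0, 1}"] to_bar_mem)
  then show "to_bar A (tot_diff A {0, 1} x) \<in> dual_bar_diff ` dual_bar (n - 1)" by simp
qed (simp_all add: to_bar_add T2.zero_mem T2.d_zero)

section \<open>The Connes sequence\<close>

text \<open>Both spaces are presented by the same cocycles and coboundaries, which makes the
  comparison injective and the choice in \<open>connes_B\<close> explicit.\<close>

lemma inv_HC2_to_HH:
  assumes "g \<in> T2.cocycles n"
  shows "inv_into (carrier (HC2 scale A n)) (HC2_to_HH scale A n) (HH_class n g) = HC2_class n g"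
proof -
  have "inj_on (HC2_to_HH scale A n) (carrier (HC2 scale A n))"
    unfolding presentsD(1)[OF HC2_presents] inj_on_def
    by (simp add: HC2_to_HH_class presentsD(3)[OF HC2_presents] presentsD(3)[OF HH_presents])
  moreover have "HC2_class n g \<in> carrier (HC2 scale A n)"
    using assms by (simp add: presentsD(1)[OF HC2_presents])
  ultimately show ?thesis by (metis HC2_to_HH_class inv_into_f_f)
qed

lemma connes_shift_mem:
  assumes f: "f \<in> cochains UNIV (n - 2)"
  shows "connes_shift f \<in> cochains UNIV n"
proof (rule cochainsI)
  fix p
  show "ml (connes_shift f p)" using cochainsD(1)[OF f] ml_zero by (simp add: connes_shift_def zero_fun_def)
  fix xs assume "connes_shift f p xs \<noteq> 0"
  then have *: "2 \<le> p" "f (p - 2) xs \<noteq> 0" by (auto simp: connes_shift_def split: if_splits)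
  then show "p \<in> UNIV \<and> xs \<noteq> [] \<and> set xs \<subseteq> A \<and> int p + (int (length xs) - 1) = n"
    using cochainsD(3-5)[OF f *(2)] by simp
qed

lemma connes_trunc_mem:
  assumes f: "f \<in> cochains UNIV n"
  shows "connes_trunc f \<in> cochains {0, 1} n"
proof (rule cochainsI)
  fix p
  show "ml (connes_trunc f p)" using cochainsD(1)[OF f] ml_zero by (simp add: connes_trunc_def zero_fun_def)
  fix xs assume "connes_trunc f p xs \<noteq> 0"
  then have *: "p < 2" "f p xs \<noteq> 0" by (auto simp: connes_trunc_def split: if_splits)
  then show "p \<in> {0, 1} \<and> xs \<noteq> [] \<and> set xs \<subseteq> A \<and> int p + (int (length xs) - 1) = n"
    using cochainsD(3-5)[OF f *(2)] by auto
qed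

lemma cochains_mono: "f \<in> cochains P n \<Longrightarrow> P \<subseteq> Q \<Longrightarrow> f \<in> cochains Q n"
  unfolding tot_cochains_def by blast

lemma connes_trunc_eq:
  assumes "f \<in> cochains {0, 1} n"
  shows "connes_trunc f = f"
proof (intro ext)
  fix p xs
  show "connes_trunc f p xs = f p xs" using cochainsD(2)[OF assms, of p xs] by (cases "f p xs = 0") (auto simp: connes_trunc_def)
qed

text \<open>A shift by two preserves the parity on which both differentials depend. At the seam,
  column 2 receives nothing from the zero column 1, just as column 0 has no left neighbour.\<close>

lemma connes_shift_diff: "connes_shift (tot_diff A UNIV f) = tot_diff A UNIV (connes_shift f)"
proof (intro ext)
  fix p :: nat and xs
  consider "p < 2" | "p = 2" | "3 \<le> p" by linarith
  then show "connes_shift (tot_diff A UNIV f) p xs = tot_diff A UNIV (connes_shift f) p xs"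
  proof cases
    case 1
    then show ?thesis
      by (simp add: connes_shift_def tot_diff_eq zero_fun_def vdiff_zero hdiff_zero)
  next
    case 2
    then show ?thesis using hdiff_zero[of xs 2]
      by (auto simp: connes_shift_def tot_diff_eq zero_fun_def vdiff_def hdiff_def[of 0])
  next
    case 3
    define q where "q = p - 3"
    then have "p = q + 3" using 3 by simp
    then show ?thesis by (simp add: connes_shift_def tot_diff_eq vdiff_def hdiff_def)
  qed
qed

lemma connes_trunc_diff: "connes_trunc (tot_diff A UNIV f) = tot_diff A {0, 1} (connes_trunc f)"
  by (intro ext) (auto simp: connes_trunc_def tot_diff_eq)

text \<open>In columns 0 and 1 the full differential is the truncated one, which vanishes on a
  two-column cocycle.\<close>

lemma connes_shift_boundary:
  assumes "tot_diff A {0, 1} g = 0"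
  shows "connes_shift (connes_boundary A g) = tot_diff A UNIV g"
proof (intro ext)
  fix p xs
  have "tot_diff A UNIV g p xs = 0" if "p < 2"
    using less_2_cases[OF that] fun_cong[OF fun_cong[OF assms], of p xs] by (auto simp: tot_diff_eq)
  then show "connes_shift (connes_boundary A g) p xs = tot_diff A UNIV g p xs"
    by (cases p rule: nat_cases2) (auto simp: connes_shift_def connes_boundary_def)
qed

lemma connes_boundary_mem:
  assumes "g \<in> cochains {0, 1} n"
  shows "connes_boundary A g \<in> cochains UNIV (n - 1)"
proof -
  have d: "tot_diff A UNIV g \<in> cochains UNIV (n + 1)"
    by (rule T.d_mem) (use cochains_mono[OF assms] in simp)
  show ?thesis
  proof (rule cochainsI)
    fix p
    show "ml (connes_boundary A g p)" using cochainsD(1)[OF d] by (simp add: connes_boundary_def)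
    fix xs assume "connes_boundary A g p xs \<noteq> 0"
    then have "tot_diff A UNIV g (p + 2) xs \<noteq> 0" by (simp add: connes_boundary_def)
    from cochainsD(3-5)[OF d this]
    show "p \<in> UNIV \<and> xs \<noteq> [] \<and> set xs \<subseteq> A \<and> int p + (int (length xs) - 1) = n - 1" by simp
  qed
qed

lemma connes_shift_eq_0: "connes_shift f = 0 \<Longrightarrow> f = 0"
proof (intro ext)
  fix p xs assume "connes_shift f = 0"
  from fun_cong[OF fun_cong[OF this], of "p + 2" xs] show "f p xs = 0 p xs"
    by (simp add: connes_shift_def)
qed

text \<open>The full differential is the truncated one plus the shifted boundary. That it squares to
  zero, read in the columns from 2 on, gives the minus sign, which has to be compensated in the
  Mayer--Vietoris connecting maps.\<close>

lemma connes_boundary_diff: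
  "connes_boundary A (tot_diff A {0, 1} g) = - tot_diff A UNIV (connes_boundary A g)"
proof (intro ext)
  fix p xs
  have "tot_diff A UNIV g = tot_diff A {0, 1} g + connes_shift (connes_boundary A g)"
  proof (intro ext)
    fix p xs
    show "tot_diff A UNIV g p xs = (tot_diff A {0, 1} g + connes_shift (connes_boundary A g)) p xs"
      by (cases p rule: nat_cases2) (auto simp: tot_diff_eq connes_shift_def connes_boundary_def)
  qed
  then have "tot_diff A UNIV (tot_diff A {0, 1} g) + connes_shift (tot_diff A UNIV (connes_boundary A g)) = 0"
    using tot_diff_tot_diff[of UNIV g] by (simp add: tot_diff_add connes_shift_diff)
  from fun_cong[OF fun_cong[OF this], of "p + 2" xs]
  show "connes_boundary A (tot_diff A {0, 1} g) p xs = (- tot_diff A UNIV (connes_boundary A g)) p xs"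
    by (simp add: connes_boundary_def connes_shift_def eq_neg_iff_add_eq_0)
qed

end

context algebra_carrier
begin

lemma connes_B_class:
  assumes "g \<in> T2.cocycles n"
  shows "connes_B scale A n (HH_class n g) = HC_class (n - 1) (connes_boundary A g)"
proof -
  have "induced (HC scale A (n - 1)) (connes_boundary A) (HC2_class n g) = HC_class (n - 1) (connes_boundary A g)"
    unfolding HC_def tot_cohomology_def
  proof (rule T.induced_coset_class)
    fix x assume x: "x \<in> cochains {0, 1} (n - 1)"
    then have "- connes_boundary A x \<in> cochains UNIV (n - 1 - 1)"
      by (intro T.minus_mem connes_boundary_mem)
    moreover have "connes_boundary A (tot_diff A {0, 1} x) = tot_diff A UNIV (- connes_boundary A x)"
      by (simp add: connes_boundary_diff T.d_minus)
    ultimately show "connes_boundary A (tot_diff A {0, 1} x)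
        \<in> tot_diff A UNIV ` cochains UNIV (n - 1 - 1)" by blast
  qed (simp_all add: connes_boundary_add T2.zero_mem T2.d_zero)
  moreover have "(\<lambda>(g :: nat \<Rightarrow> 'r list \<Rightarrow> 'k) p. tot_diff A UNIV g (p + 2)) = connes_boundary A"
    by (intro ext) (simp add: connes_boundary_def)
  ultimately show ?thesis by (simp add: connes_B_def inv_HC2_to_HH[OF assms])
qed

lemma connes_S_class: "connes_S scale A n (HC_class (n - 1) f) = HC_class (n + 1) (connes_shift f)"
proof -
  have "induced (HC scale A (n + 1)) connes_shift (HC_class (n - 1) f) = HC_class (n + 1) (connes_shift f)"
    unfolding HC_def tot_cohomology_def
  proof (rule T.induced_coset_class)
    fix x assume x: "x \<in> cochains UNIV (n - 1 - 1)"
    then have "connes_shift x \<in> cochains UNIV (n + 1 - 1)"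
      by (intro connes_shift_mem) (simp add: algebra_simps)
    then show "connes_shift (tot_diff A UNIV x) \<in> tot_diff A UNIV ` cochains UNIV (n + 1 - 1)"
      unfolding connes_shift_diff by blast
  qed (simp_all add: connes_shift_add T.zero_mem T.d_zero)
  moreover have "(\<lambda>(f :: nat \<Rightarrow> 'r list \<Rightarrow> 'k) p. if 2 \<le> p then f (p - 2) else 0) = connes_shift"
    by (intro ext) (simp add: connes_shift_def)
  ultimately show ?thesis by (simp add: connes_S_def)
qed

lemma connes_I_class: "connes_I scale A n (HC_class (n + 1) f) = HH_class (n + 1) (connes_trunc f)"
proof -
  have "induced (HC2 scale A (n + 1)) connes_trunc (HC_class (n + 1) f) = HC2_class (n + 1) (connes_trunc f)"
    unfolding tot_cohomology_def
  proof (rule T2.induced_coset_class)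
    fix x assume x: "x \<in> cochains UNIV (n + 1 - 1)"
    then have "connes_trunc x \<in> cochains {0, 1} (n + 1 - 1)" by (rule connes_trunc_mem)
    then show "connes_trunc (tot_diff A UNIV x) \<in> tot_diff A {0, 1} ` cochains {0, 1} (n + 1 - 1)"
      unfolding connes_trunc_diff by blast
  qed (simp_all add: connes_trunc_add T.zero_mem T.d_zero)
  moreover have "(\<lambda>(f :: nat \<Rightarrow> 'r list \<Rightarrow> 'k) p. if p < 2 then f p else 0) = connes_trunc"
    by (intro ext) (simp add: connes_trunc_def)
  ultimately show ?thesis by (simp add: connes_I_def HC2_to_HH_class)
qed

lemma connes_boundary_cocycle:
  assumes "g \<in> T2.cocycles n"
  shows "connes_boundary A g \<in> T.cocycles (n - 1)"
proof -
  have g: "g \<in> cochains {0, 1} n" "tot_diff A {0, 1} g = 0"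
    using assms by (auto simp: T2.cocycles_def)
  have "connes_shift (tot_diff A UNIV (connes_boundary A g)) = 0"
    by (simp add: connes_shift_diff connes_shift_boundary[OF g(2)] tot_diff_tot_diff)
  then show ?thesis
    using connes_boundary_mem[OF g(1)] connes_shift_eq_0 by (simp add: T.cocycles_def)
qed

lemma connes_shift_cocycle: "f \<in> T.cocycles (n - 1) \<Longrightarrow> connes_shift f \<in> T.cocycles (n + 1)"
  using connes_shift_mem[of f "n + 1"] connes_shift_diff[of f]
  by (simp add: T.cocycles_def connes_shift_zero)

lemma connes_trunc_cocycle: "f \<in> T.cocycles n \<Longrightarrow> connes_trunc f \<in> T2.cocycles n"
  using connes_trunc_mem[of f n] connes_trunc_diff[of f]
  by (simp add: T.cocycles_def T2.cocycles_def connes_trunc_zero)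

lemma Connes_long_exact:
  "long_exact (HH scale A) (\<lambda>n. HC scale A (n - 1)) (\<lambda>n. HC scale A (n + 1))
    (connes_B scale A) (connes_S scale A) (connes_I scale A)"
proof -
  interpret X: cochain_complex tot_scale "\<lambda>n. cochains UNIV (n - 2)" "tot_diff A UNIV"
    by (rule T.shift)
  have X_cocycles: "X.cocycles n = T.cocycles (n - 2)" for n
    by (simp add: X.cocycles_def T.cocycles_def)
  interpret S: cochain_sequence tot_scale "\<lambda>n. cochains UNIV (n - 2)" "tot_diff A UNIV"
    tot_scale "cochains UNIV" "tot_diff A UNIV"
    tot_scale "cochains {0, 1}" "tot_diff A {0, 1}"
    "\<lambda>n. HC scale A (n - 2)" "\<lambda>n. HC_class (n - 2)" "HC scale A" HC_class "HH scale A" HH_class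
    connes_shift connes_trunc "\<lambda>_. False"
  proof
    fix n :: int and c and f g :: "nat \<Rightarrow> 'r list \<Rightarrow> 'k"
    have "n - 2 - 1 = n - 1 - 2" by simp
    then show "presents (HC scale A (n - 2)) tot_scale (X.cocycles n)
        (tot_diff A UNIV ` cochains UNIV (n - 1 - 2)) (HC_class (n - 2))"
      using HC_presents[of "n - 2"] by (simp only: X_cocycles)
    show "\<exists>x\<in>cochains UNIV (n - 2). connes_shift x = f"
      if f: "f \<in> cochains UNIV n" "connes_trunc f = 0"
    proof
      have z: "f p xs = 0" if "p < 2" for p xs
        using fun_cong[OF fun_cong[OF f(2)], of p xs] that by (simp add: connes_trunc_def)
      show "connes_shift (\<lambda>p. f (p + 2)) = f"
      proof (intro ext)
        show "connes_shift (\<lambda>p. f (p + 2)) p xs = f p xs" for p xs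
          by (cases p rule: nat_cases2) (auto simp: connes_shift_def z)
      qed
      show "(\<lambda>p. f (p + 2)) \<in> cochains UNIV (n - 2)"
        using cochainsD[OF f(1)] by (intro cochainsI) force+
    qed
    show "\<exists>y\<in>cochains UNIV n. connes_trunc y = f"
      if "f \<in> cochains {0, 1} n"
      using that connes_trunc_eq[OF that] cochains_mono[OF that, of UNIV] by blast
    \<comment> \<open>The shift is injective, so its kernel is trivially acyclic.\<close>
    show "\<exists>w\<in>cochains UNIV (n - 1 - 2). connes_shift w = 0 \<and> tot_diff A UNIV w = f"
      if "connes_shift f = 0"
      using connes_shift_eq_0[OF that] T.zero_mem T.d_zero that by auto
    show "connes_trunc (connes_shift f) = 0"
      by (intro ext) (simp add: connes_trunc_def connes_shift_def)
  qed (simp_all add: HC_presents HH_presents connes_shift_add connes_shift_scale connes_shift_mem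
      connes_shift_diff connes_trunc_add connes_trunc_scale connes_trunc_mem connes_trunc_diff)
  have "long_exact (\<lambda>n. HC scale A (n - 2)) (HC scale A) (HH scale A)
    (\<lambda>n. connes_S scale A (n - 1)) (\<lambda>n. connes_I scale A (n - 1)) (connes_B scale A)"
  proof (rule S.long_exact_cohomology)
    fix n :: int and f :: "nat \<Rightarrow> 'r list \<Rightarrow> 'k"
    show "connes_S scale A (n - 1) (HC_class (n - 2) f) = HC_class n (connes_shift f)"
      using connes_S_class[of "n - 1" f] by simp
    show "connes_I scale A (n - 1) (HC_class n f) = HH_class n (connes_trunc f)"
      using connes_I_class[of "n - 1" f] by simp
    show "\<exists>y x. S.snake n f y x \<and> connes_B scale A n (HH_class n f) = HC_class (n + 1 - 2) x"
      if f: "f \<in> T2.cocycles n"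
    proof (intro exI conjI)
      have f': "f \<in> cochains {0, 1} n" "tot_diff A {0, 1} f = 0"
        using f by (auto simp: T2.cocycles_def)
      \<comment> \<open>A two-column cocycle, extended by zero columns, is its own lift.\<close>
      show "S.snake n f f (connes_boundary A f)"
        using connes_boundary_cocycle[OF f] connes_trunc_eq[OF f'(1)] cochains_mono[OF f'(1), of UNIV]
          connes_shift_boundary[OF f'(2)]
        by (simp add: S.snake_def X_cocycles S.sg_def)
      show "connes_B scale A n (HH_class n f) = HC_class (n + 1 - 2) (connes_boundary A f)"
        using connes_B_class[OF f] by simp
    qed
  qed
  \<comment> \<open>The sequence obtained begins with the shifted complex, the claim with
    \<open>HH\<close>; the three exactness statements are taken from neighbouring degrees.\<close>
  then have *: "exact_pair (HC scale A (n - 2)) (connes_S scale A (n - 1)) (HC scale A n) (connes_I scale A (n - 1)) (HH scale A n)"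
    "exact_pair (HC scale A n) (connes_I scale A (n - 1)) (HH scale A n) (connes_B scale A n) (HC scale A (n + 1 - 2))"
    "exact_pair (HH scale A n) (connes_B scale A n) (HC scale A (n + 1 - 2)) (connes_S scale A (n + 1 - 1)) (HC scale A (n + 1))"
    for n
    by (simp_all only: long_exact_def)
  show ?thesis
    unfolding long_exact_def
  proof (intro allI conjI)
    fix n
    show "exact_pair (HH scale A n) (connes_B scale A n) (HC scale A (n - 1)) (connes_S scale A n) (HC scale A (n + 1))"
      using *(3)[of n] by simp
    show "exact_pair (HC scale A (n - 1)) (connes_S scale A n) (HC scale A (n + 1)) (connes_I scale A n) (HH scale A (n + 1))"
      using *(1)[of "n + 1"] by simp
    show "exact_pair (HC scale A (n + 1)) (connes_I scale A n) (HH scale A (n + 1)) (connes_B scale A (n + 1)) (HC scale A (n + 1 - 1))"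
      using *(2)[of "n + 1"] by simp
  qed
qed

end

section \<open>Restriction\<close>

definition restr :: "'r set \<Rightarrow> (nat \<Rightarrow> 'r list \<Rightarrow> 'k::zero) \<Rightarrow> nat \<Rightarrow> 'r list \<Rightarrow> 'k" where
  "restr B f p xs = (if set xs \<subseteq> B then f p xs else 0)"

lemma restr_add: "restr B (f + g) = restr B f + restr B (g :: nat \<Rightarrow> 'r list \<Rightarrow> 'k::field)"
  and restr_scale: "restr B (tot_scale c f) = tot_scale c (restr B f)"
  by (intro ext; simp add: restr_def)+

lemma restr_zero: "restr B 0 = (0 :: nat \<Rightarrow> 'r list \<Rightarrow> 'k::field)"
  by (intro ext) (simp add: restr_def)

lemma restr_shift: "restr B (connes_shift f) = connes_shift (restr B f)"
  and restr_trunc: "restr B (connes_trunc f) = connes_trunc (restr B f)"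
  by (intro ext; simp add: restr_def connes_shift_def connes_trunc_def)+

lemma restr_restrict: "C \<subseteq> B \<Longrightarrow> restr C (restr B f) = restr C f"
  by (intro ext) (auto simp: restr_def)

locale subcarrier = A: algebra_carrier scale A u + B: algebra_carrier scale B w
  for scale :: "'k::field \<Rightarrow> 'r::ring \<Rightarrow> 'r" and A u B w +
  assumes sub: "B \<subseteq> A"
begin

lemma restrict_mem:
  assumes "f \<in> A.cochains P n"
  shows "restr B f \<in> B.cochains P n"
proof (rule B.cochainsI)
  fix p
  have "B.ml (f p)"
    using A.cochainsD(1)[OF assms, of p] sub unfolding multilinear_on_def by (meson subset_iff)
  then show "B.ml (restr B f p)"
    by (subst B.ml_cong) (auto simp: restr_def)
  fix xs assume "restr B f p xs \<noteq> 0"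
  then have "set xs \<subseteq> B" "f p xs \<noteq> 0" by (auto simp: restr_def split: if_splits)
  then show "p \<in> P \<and> xs \<noteq> [] \<and> set xs \<subseteq> B \<and> int p + (int (length xs) - 1) = n"
    using A.cochainsD[OF assms] by blast
qed

text \<open>The differentials involve only products and rotations of entries, under which
  \<open>B\<close> is closed; hence restriction is a cochain map although the units of
  \<open>A\<close> and \<open>B\<close> may differ.\<close>

lemma restrict_tot_diff: "restr B (tot_diff A P f) = tot_diff B P (restr B f)"
proof (intro ext)
  fix p xs
  show "restr B (tot_diff A P f) p xs = tot_diff B P (restr B f) p xs"
  proof (cases "p \<in> P \<and> xs \<noteq> [] \<and> set xs \<subseteq> B")
    case True
    then have xs: "xs \<noteq> []" "set xs \<subseteq> B" by auto
    have "vdiff p (restr B f p) xs = vdiff p (f p) xs"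
      by (rule vdiff_cong[OF _ xs(2) B.mult_in]) (auto simp: restr_def)
    moreover have "hdiff p (restr B f (p - 1)) xs = hdiff p (f (p - 1)) xs"
      by (rule hdiff_cong[OF _ xs(2,1)]) (auto simp: restr_def)
    ultimately show ?thesis using True sub by (auto simp: tot_diff_eq restr_def[of B "tot_diff A P f"])
  qed (auto simp: tot_diff_eq restr_def)
qed

lemma restrict_cocycle2: "f \<in> A.T2.cocycles n \<Longrightarrow> restr B f \<in> B.T2.cocycles n"
  and restrict_cocycle: "f \<in> A.T.cocycles n \<Longrightarrow> restr B f \<in> B.T.cocycles n"
  using restrict_mem restr_zero[of B]
  by (auto simp: A.T2.cocycles_def B.T2.cocycles_def A.T.cocycles_def B.T.cocycles_def simp flip: restrict_tot_diff)

lemma restrict_boundary: "restr B (connes_boundary A f) = connes_boundary B (restr B f)"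
proof (intro ext)
  fix p xs
  have "restr B (connes_boundary A f) p xs = restr B (tot_diff A UNIV f) (p + 2) xs"
    by (simp add: restr_def connes_boundary_def)
  then show "restr B (connes_boundary A f) p xs = connes_boundary B (restr B f) p xs"
    by (simp add: connes_boundary_def restrict_tot_diff)
qed

lemma res_HC_class: "res_HC scale B n (A.HC_class n f) = B.HC_class n (restr B f)"
proof -
  have "induced (HC scale B n) (restr B) (A.HC_class n f) = B.HC_class n (restr B f)"
    unfolding HC_def tot_cohomology_def
  proof (rule B.T.induced_coset_class)
    fix x assume "x \<in> A.cochains UNIV (n - 1)"
    then show "restr B (tot_diff A UNIV x) \<in> tot_diff B UNIV ` B.cochains UNIV (n - 1)"
      unfolding restrict_tot_diff using restrict_mem by blast
  qed (simp_all add: restr_add A.T.zero_mem A.T.d_zero)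
  moreover have "(\<lambda>(f :: nat \<Rightarrow> 'r list \<Rightarrow> 'k) p xs. if set xs \<subseteq> B then f p xs else 0) = restr B"
    by (intro ext) (simp add: restr_def)
  ultimately show ?thesis by (simp add: res_HC_def)
qed

lemma res_HH_class: "res_HH scale B n (A.HH_class n f) = B.HH_class n (restr B f)"
proof -
  define \<rho> where "\<rho> = (\<lambda>(F :: 'r list \<Rightarrow> 'r \<Rightarrow> 'k) xs r. if set xs \<subseteq> B \<and> r \<in> B then F xs r else 0)"
  \<comment> \<open>Entry 0 of the form is a product of elements of \<open>B\<close>, so restricting
    before or after the passage to bar cochains makes no difference.\<close>
  have bar: "\<rho> (to_bar A g) = to_bar B (restr B g)" for g
  proof (intro ext)
    fix xs r
    show "\<rho> (to_bar A g) xs r = to_bar B (restr B g) xs r"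
    proof (cases "2 \<le> length xs \<and> set xs \<subseteq> B \<and> r \<in> B")
      case True
      then obtain x as y where xs: "xs = x # as @ [y]" by (cases xs; cases "tl xs" rule: rev_cases) auto
      show ?thesis
        using True sub by (auto simp: \<rho>_def to_bar_def xs restr_def intro: B.mult_in)
    qed (auto simp: \<rho>_def to_bar_def)
  qed
  have "induced (HH scale B n) \<rho> (A.HH_class n f) = coset_class B.dual_bar B.dual_bar_diff n (\<rho> (to_bar A f))"
    unfolding HH_def hochschild_def A.HH_class_def
  proof (rule B.bar.induced_coset_class)
    fix F assume "F \<in> A.dual_bar (n - 1)"
    then obtain g where g: "g \<in> A.cochains {0} (n - 1)" "F = to_bar A g"
      using A.bar_eq_to_bar[of F "n - 1" "{0}"] by auto
    have "\<rho> (A.dual_bar_diff F) = B.dual_bar_diff (to_bar B (restr B g))"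
      using A.to_bar_tot_diff[of "{0}" g] B.to_bar_tot_diff[of "{0}" "restr B g"]
      by (simp add: g(2) bar restrict_tot_diff)
    then show "\<rho> (A.dual_bar_diff F) \<in> B.dual_bar_diff ` B.dual_bar (n - 1)"
      using B.to_bar_mem[OF restrict_mem[OF g(1)]] by simp
  qed (auto simp: \<rho>_def fun_eq_iff A.bar.zero_mem A.bar.d_zero)
  then show ?thesis unfolding bar unfolding \<rho>_def res_HH_def B.HH_class_def .
qed

lemma res_connes_B:
  "g \<in> A.T2.cocycles n \<Longrightarrow> res_HC scale B (n - 1) (connes_B scale A n (A.HH_class n g))
    = connes_B scale B n (res_HH scale B n (A.HH_class n g))"
  by (simp add: A.connes_B_class B.connes_B_class res_HC_class res_HH_class restrict_cocycle2 restrict_boundary)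

lemma res_connes_S:
  "res_HC scale B (n + 1) (connes_S scale A n (A.HC_class (n - 1) f))
    = connes_S scale B n (res_HC scale B (n - 1) (A.HC_class (n - 1) f))"
  by (simp add: A.connes_S_class B.connes_S_class res_HC_class restr_shift)

lemma res_connes_I:
  "res_HH scale B (n + 1) (connes_I scale A n (A.HC_class (n + 1) f))
    = connes_I scale B n (res_HC scale B (n + 1) (A.HC_class (n + 1) f))"
  by (simp add: A.connes_I_class B.connes_I_class res_HC_class res_HH_class restr_trunc)

end

section \<open>The Mayer--Vietoris sequences\<close>

definition pull :: "'r set \<Rightarrow> ('r \<Rightarrow> 'r) \<Rightarrow> (nat \<Rightarrow> 'r list \<Rightarrow> 'k::zero) \<Rightarrow> nat \<Rightarrow> 'r list \<Rightarrow> 'k" where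
  "pull A \<pi> f p xs = (if set xs \<subseteq> A then f p (map \<pi> xs) else 0)"

definition linear_retraction :: "('k \<Rightarrow> 'r::ring \<Rightarrow> 'r) \<Rightarrow> 'r set \<Rightarrow> 'r set \<Rightarrow> ('r \<Rightarrow> 'r) \<Rightarrow> bool" where
  "linear_retraction scale A B \<pi> \<longleftrightarrow>
     (\<forall>x\<in>A. \<forall>y\<in>A. \<pi> (x + y) = \<pi> x + \<pi> y) \<and> (\<forall>c. \<forall>x\<in>A. \<pi> (scale c x) = scale c (\<pi> x)) \<and>
     \<pi> ` A \<subseteq> B \<and> (\<forall>x\<in>B. \<pi> x = x)"

context subcarrier
begin

lemma pull_mem:
  assumes \<pi>: "linear_retraction scale A B \<pi>" and f: "f \<in> B.cochains P n"
  shows "pull A \<pi> f \<in> A.cochains P n"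
proof (rule A.cochainsI)
  have \<pi>B: "\<pi> ` set xs \<subseteq> B" if "set xs \<subseteq> A" for xs
    using \<pi> that by (auto simp: linear_retraction_def image_subset_iff)
  fix p
  show "A.ml (pull A \<pi> f p)"
    unfolding A.ml_iff
  proof (intro allI impI)
    fix xs ys assume xys: "set xs \<subseteq> A" "set ys \<subseteq> A"
    have "B.lin (\<lambda>x. f p (map \<pi> xs @ x # map \<pi> ys))"
      using xys \<pi>B by (intro B.mlD[OF B.cochainsD(1)[OF f]]) auto
    then have "A.lin (\<lambda>x. f p (map \<pi> xs @ \<pi> x # map \<pi> ys))"
      using \<pi> by (auto simp: A.lin_def B.lin_def linear_retraction_def image_subset_iff)
    moreover have "A.lin (\<lambda>x. pull A \<pi> f p (xs @ x # ys)) = A.lin (\<lambda>x. f p (map \<pi> xs @ \<pi> x # map \<pi> ys))"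
      using xys by (intro A.lin_cong) (simp add: pull_def)
    ultimately show "A.lin (\<lambda>x. pull A \<pi> f p (xs @ x # ys))" by simp
  qed
  fix xs assume "pull A \<pi> f p xs \<noteq> 0"
  then have *: "set xs \<subseteq> A" "f p (map \<pi> xs) \<noteq> 0" by (auto simp: pull_def split: if_splits)
  then show "p \<in> P \<and> xs \<noteq> [] \<and> set xs \<subseteq> A \<and> int p + (int (length xs) - 1) = n"
    using B.cochainsD(2,3,5)[OF f *(2)] by simp
qed

end

lemma linear_retractionD:
  assumes "linear_retraction scale A B \<pi>"
  shows "x \<in> A \<Longrightarrow> y \<in> A \<Longrightarrow> \<pi> (x + y) = \<pi> x + \<pi> y" "x \<in> A \<Longrightarrow> \<pi> (scale c x) = scale c (\<pi> x)"
    "x \<in> A \<Longrightarrow> \<pi> x \<in> B" "x \<in> B \<Longrightarrow> \<pi> x = x"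
  using assms by (auto simp: linear_retraction_def image_subset_iff)

lemma linear_retraction_mono:
  assumes "linear_retraction scale A B \<pi>" "A' \<subseteq> A"
  shows "linear_retraction scale A' B \<pi>"
proof -
  have "x \<in> A' \<Longrightarrow> x \<in> A" for x using assms(2) by blast
  then show ?thesis
    unfolding linear_retraction_def image_subset_iff
    by (intro conjI ballI allI linear_retractionD[OF assms(1)])
qed

text \<open>By \<open>\<pi>_cross\<close>, projecting one of \<open>A1\<close> and \<open>A2\<close>
  to the other lands in \<open>C\<close>. This compatibility is what allows two forms that agree on
  \<open>C\<close> to be extended simultaneously.\<close>

locale mayer_vietoris =
  R: idempotent_cover scale R uR I v "{A1, A2}" \<rho> +
  A1: algebra_carrier scale A1 u1 + A2: algebra_carrier scale A2 u2 + C: algebra_carrier scale C uC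
  for scale :: "'k::field \<Rightarrow> 'r::ring \<Rightarrow> 'r" and R uR and I :: "'i set" and v A1 A2 \<rho> u1 u2 C uC +
  fixes \<pi>1 \<pi>2 \<pi> :: "'r \<Rightarrow> 'r"
  assumes C_sub: "C \<subseteq> A1" "C \<subseteq> A2"
    and \<pi>: "linear_retraction scale R A1 \<pi>1" "linear_retraction scale R A2 \<pi>2" "linear_retraction scale R C \<pi>"
    and \<pi>_cross: "\<And>x. x \<in> A1 \<Longrightarrow> \<pi>2 x = \<pi> x" "\<And>x. x \<in> A2 \<Longrightarrow> \<pi>1 x = \<pi> x"
begin

lemma A_sub: "A1 \<subseteq> R" "A2 \<subseteq> R" "C \<subseteq> R"
  using R.B_sub[of A1] R.B_sub[of A2] C_sub by auto

sublocale RA1: subcarrier scale R uR A1 u1 by unfold_locales (rule A_sub)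
sublocale RA2: subcarrier scale R uR A2 u2 by unfold_locales (rule A_sub)
sublocale RC: subcarrier scale R uR C uC by unfold_locales (rule A_sub)
sublocale A1C: subcarrier scale A1 u1 C uC by unfold_locales (rule C_sub)
sublocale A2C: subcarrier scale A2 u2 C uC by unfold_locales (rule C_sub)

definition \<phi> :: "(nat \<Rightarrow> 'r list \<Rightarrow> 'k) \<Rightarrow> (nat \<Rightarrow> 'r list \<Rightarrow> 'k) \<times> (nat \<Rightarrow> 'r list \<Rightarrow> 'k)" where
  "\<phi> f = (restr A1 f, restr A2 f)"

definition \<psi> :: "(nat \<Rightarrow> 'r list \<Rightarrow> 'k) \<times> (nat \<Rightarrow> 'r list \<Rightarrow> 'k) \<Rightarrow> nat \<Rightarrow> 'r list \<Rightarrow> 'k" where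
  "\<psi> y = restr C (fst y) - restr C (snd y)"

abbreviation "prod_diff P \<equiv> map_prod (tot_diff A1 P) (tot_diff A2 P)"
abbreviation "prod_boundary \<equiv> map_prod (connes_boundary A1) (connes_boundary A2)"

lemma map_\<pi>:
  "set xs \<subseteq> C \<Longrightarrow> map \<pi> xs = xs" "set xs \<subseteq> A1 \<Longrightarrow> map \<pi>1 xs = xs" "set xs \<subseteq> A2 \<Longrightarrow> map \<pi>2 xs = xs"
  "set xs \<subseteq> A1 \<Longrightarrow> map \<pi>2 xs = map \<pi> xs" "set xs \<subseteq> A2 \<Longrightarrow> map \<pi>1 xs = map \<pi> xs"
  "set xs \<subseteq> R \<Longrightarrow> set (map \<pi> xs) \<subseteq> C"
proof -
  show "set xs \<subseteq> C \<Longrightarrow> map \<pi> xs = xs" by (rule map_idI, rule linear_retractionD[OF \<pi>(3)], erule subsetD)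
  show "set xs \<subseteq> A1 \<Longrightarrow> map \<pi>1 xs = xs" by (rule map_idI, rule linear_retractionD[OF \<pi>(1)], erule subsetD)
  show "set xs \<subseteq> A2 \<Longrightarrow> map \<pi>2 xs = xs" by (rule map_idI, rule linear_retractionD[OF \<pi>(2)], erule subsetD)
  show "set xs \<subseteq> A1 \<Longrightarrow> map \<pi>2 xs = map \<pi> xs" "set xs \<subseteq> A2 \<Longrightarrow> map \<pi>1 xs = map \<pi> xs"
    by (rule map_cong[OF refl], rule \<pi>_cross, erule (1) subsetD)+
  show "set xs \<subseteq> R \<Longrightarrow> set (map \<pi> xs) \<subseteq> C" using linear_retractionD(3)[OF \<pi>(3)] by auto
qed

lemma exact_restriction:
  assumes "f1 \<in> A1.cochains P n" "f2 \<in> A2.cochains P n"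
    and eq: "restr C f1 = restr C f2" and P: "down_closed P"
  shows "\<exists>f\<in>R.cochains P n. restr A1 f = f1 \<and> restr A2 f = f2"
proof -
  interpret T: cochain_complex tot_scale "R.cochains P" "tot_diff R P"
    by (rule R.tot_complex[OF P])
  \<comment> \<open>Inclusion and exclusion: on \<open>A1\<close> the second and third terms cancel,
    since \<open>\<pi>2\<close> and \<open>\<pi>\<close> agree there and the forms agree on
    \<open>C\<close>; on \<open>A2\<close> the first and third cancel.\<close>
  define f where "f = pull R \<pi>1 f1 + pull R \<pi>2 f2 - pull R \<pi> (restr C f1)"
  have "f \<in> R.cochains P n"
    unfolding f_def using assms \<pi>
    by (intro T.diff_mem T.add_mem RA1.pull_mem RA2.pull_mem RC.pull_mem A1C.restrict_mem)
  have C1: "f1 p xs = restr C f1 p xs" "f2 p xs = restr C f1 p xs" if "set xs \<subseteq> C" for p xs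
    using that fun_cong[OF fun_cong[OF eq], of p xs] by (simp_all add: restr_def)
  have "restr A1 f p xs = f1 p xs" for p xs
  proof (cases "set xs \<subseteq> A1")
    case True
    then have "set xs \<subseteq> R" using A_sub by auto
    then show ?thesis
      using True by (simp add: restr_def[of A1] f_def pull_def map_\<pi>(2,4) C1(2)[OF map_\<pi>(6)])
  next
    case False
    then show ?thesis using A1.cochainsD(4)[OF assms(1), of p xs]
      by (cases "f1 p xs = 0") (auto simp: restr_def)
  qed
  moreover have "restr A2 f p xs = f2 p xs" for p xs
  proof (cases "set xs \<subseteq> A2")
    case True
    then have "set xs \<subseteq> R" using A_sub by auto
    then show ?thesis
      using True by (simp add: restr_def[of A2] f_def pull_def map_\<pi>(3,5) C1(1)[OF map_\<pi>(6)])
  next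
    case False
    then show ?thesis using A2.cochainsD(4)[OF assms(2), of p xs]
      by (cases "f2 p xs = 0") (auto simp: restr_def)
  qed
  ultimately show ?thesis using \<open>f \<in> _\<close> by (intro bexI[of _ f]) (auto simp: fun_eq_iff)
qed

lemma surj_restriction:
  assumes h: "h \<in> C.cochains P n"
  shows "\<exists>f\<in>A1.cochains P n. restr C f = h"
proof
  have "linear_retraction scale A1 C \<pi>" by (rule linear_retraction_mono[OF \<pi>(3) A_sub(1)])
  then show "pull A1 \<pi> h \<in> A1.cochains P n" by (rule A1C.pull_mem[OF _ h])
  show "restr C (pull A1 \<pi> h) = h"
  proof (intro ext)
    fix p xs
    show "restr C (pull A1 \<pi> h) p xs = h p xs"
      using C_sub C.cochainsD(4)[OF h, of p xs]
      by (cases "h p xs = 0") (auto simp: restr_def pull_def map_\<pi>)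
  qed
qed

lemma acyclic_restriction:
  assumes P: "down_closed P" and f: "f \<in> R.cochains P n" "tot_diff R P f = 0"
    and z: "restr A1 f = 0" "restr A2 f = 0"
  shows "\<exists>w\<in>R.cochains P (n - 1). \<phi> w = 0 \<and> tot_diff R P w = f"
proof -
  have "f p xs = 0" if "set xs \<subseteq> A1 \<or> set xs \<subseteq> A2" for p xs
    using fun_cong[OF fun_cong[OF z(1)], of p xs] fun_cong[OF fun_cong[OF z(2)], of p xs] that
    by (auto simp: restr_def)
  then have "R.good (f p)" for p using R.cochainsD(1)[OF f(1)] by (auto simp: R.good_def)
  then obtain g where g: "g \<in> R.cochains P (n - 1)" "\<And>p. R.good (g p)" "tot_diff R P g = f"
    using R.tot_acyclic[OF P f] by blast
  \<comment> \<open>\<open>good\<close> does not speak about the empty list, which is no tensor;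
    there the cochain is zero by its support.\<close>
  have "g p xs = 0" if "set xs \<subseteq> A1 \<or> set xs \<subseteq> A2" for p xs
    using g(2)[of p] that R.cochainsD(3)[OF g(1), of p xs] by (cases "xs = []") (auto simp: R.good_def)
  then have "\<phi> g = 0" by (auto simp: \<phi>_def zero_prod_def fun_eq_iff restr_def)
  then show ?thesis using g by blast
qed

text \<open>General in \<open>P\<close> and in the presentations, as it is needed with all columns
  and their own cohomology, and with two columns presenting bar cohomology.\<close>

lemma sequence:
  assumes P: "down_closed P"
    and HR: "\<And>n. presents (HR n) tot_scale (cochain_complex.cocycles (R.cochains P) (tot_diff R P) n)
      (tot_diff R P ` R.cochains P (n - 1)) (qR n)"
    and H1: "\<And>n. presents (H1 n) tot_scale (cochain_complex.cocycles (A1.cochains P) (tot_diff A1 P) n)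
      (tot_diff A1 P ` A1.cochains P (n - 1)) (q1 n)"
    and H2: "\<And>n. presents (H2 n) tot_scale (cochain_complex.cocycles (A2.cochains P) (tot_diff A2 P) n)
      (tot_diff A2 P ` A2.cochains P (n - 1)) (q2 n)"
    and H3: "\<And>n. presents (H3 n) tot_scale (cochain_complex.cocycles (C.cochains P) (tot_diff C P) n)
      (tot_diff C P ` C.cochains P (n - 1)) (qC n)"
  shows "cochain_sequence tot_scale (R.cochains P) (tot_diff R P)
    (\<lambda>c. map_prod (tot_scale c) (tot_scale c)) (\<lambda>n. A1.cochains P n \<times> A2.cochains P n)
    (prod_diff P) tot_scale (C.cochains P) (tot_diff C P)
    HR qR (\<lambda>n. H1 n \<boxplus> H2 n) (\<lambda>n. map_prod (q1 n) (q2 n)) H3 qC \<phi> \<psi>"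
proof -
  note c = R.tot_complex[OF P] A1.tot_complex[OF P] A2.tot_complex[OF P] C.tot_complex[OF P]
  interpret C: cochain_complex tot_scale "C.cochains P" "tot_diff C P" by (rule c)
  interpret A2: cochain_complex tot_scale "A2.cochains P" "tot_diff A2 P" by (rule c)
  show ?thesis
  proof (intro cochain_sequence.intro cochain_sequence_axioms.intro c cochain_complex_prod HR H3)
    fix n c and x x' :: "nat \<Rightarrow> 'r list \<Rightarrow> 'k" and y y' :: "(nat \<Rightarrow> 'r list \<Rightarrow> 'k) \<times> (nat \<Rightarrow> 'r list \<Rightarrow> 'k)"
    have "prod_diff P ` (A1.cochains P m \<times> A2.cochains P m)
      = (tot_diff A1 P ` A1.cochains P m) \<times> (tot_diff A2 P ` A2.cochains P m)" for m
      by force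
    then show "presents (H1 n \<boxplus> H2 n) (\<lambda>c. map_prod (tot_scale c) (tot_scale c))
        (cochain_complex.cocycles (\<lambda>n. A1.cochains P n \<times> A2.cochains P n)
          (prod_diff P) n)
        (prod_diff P ` (A1.cochains P (n - 1) \<times> A2.cochains P (n - 1)))
        (map_prod (q1 n) (q2 n))"
      using presents_dsum[OF H1 H2] by (simp only: cocycles_prod[OF c(2,3)])
    show "\<phi> (x + x') = \<phi> x + \<phi> x'" by (simp add: \<phi>_def restr_add)
    show "\<phi> (tot_scale c x) = map_prod (tot_scale c) (tot_scale c) (\<phi> x)"
      by (simp add: \<phi>_def restr_scale)
    show "\<phi> (tot_diff R P x) = prod_diff P (\<phi> x)"
      by (simp add: \<phi>_def RA1.restrict_tot_diff RA2.restrict_tot_diff)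
    show "\<psi> (y + y') = \<psi> y + \<psi> y'" by (simp add: \<psi>_def restr_add)
    show "\<psi> (map_prod (tot_scale c) (tot_scale c) y) = tot_scale c (\<psi> y)"
      by (intro ext, cases y) (simp add: \<psi>_def restr_def right_diff_distrib)
    show "\<psi> (prod_diff P y) = tot_diff C P (\<psi> y)"
      by (cases y) (simp add: \<psi>_def A1C.restrict_tot_diff A2C.restrict_tot_diff C.d_diff)
    show "\<psi> (\<phi> x) = 0" by (simp add: \<psi>_def \<phi>_def restr_restrict C_sub)
    show "\<phi> x \<in> A1.cochains P n \<times> A2.cochains P n" if "x \<in> R.cochains P n"
      using that by (simp add: \<phi>_def RA1.restrict_mem RA2.restrict_mem)
    show "\<psi> y \<in> C.cochains P n" if "y \<in> A1.cochains P n \<times> A2.cochains P n"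
      using that A1C.restrict_mem[of "fst y" P n] A2C.restrict_mem[of "snd y" P n]
      by (auto simp: \<psi>_def intro!: C.diff_mem)
    show "\<exists>x\<in>R.cochains P n. \<phi> x = y"
      if "y \<in> A1.cochains P n \<times> A2.cochains P n" "\<psi> y = 0"
      using that exact_restriction[of "fst y" P n "snd y"] P by (auto simp: \<phi>_def \<psi>_def)
    show "\<exists>y\<in>A1.cochains P n \<times> A2.cochains P n. \<psi> y = x"
      if "x \<in> C.cochains P n"
    proof -
      obtain f where "f \<in> A1.cochains P n" "restr C f = x"
        using surj_restriction[OF \<open>x \<in> _\<close>] by blast
      then have "(f, 0) \<in> A1.cochains P n \<times> A2.cochains P n" "\<psi> (f, 0) = x"
        by (auto simp: \<psi>_def A2.zero_mem restr_zero)
      then show ?thesis by blast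
    qed
    show "\<exists>w\<in>R.cochains P (n - 1). \<phi> w = 0 \<and> tot_diff R P w = x"
      if "x \<in> R.cochains P n" "tot_diff R P x = 0" "\<phi> x = 0"
      using that acyclic_restriction[OF P that(1,2)] by (auto simp: \<phi>_def zero_prod_def)
  qed
qed

text \<open>The sign \<open>(-1)\<^sup>n\<close> makes the squares with \<open>B\<close> commute: without it they anticommute, both maps
  being connecting homomorphisms.\<close>

sublocale HC: cochain_sequence tot_scale "R.cochains UNIV" "tot_diff R UNIV"
  "\<lambda>c. map_prod (tot_scale c) (tot_scale c)" "\<lambda>n. A1.cochains UNIV n \<times> A2.cochains UNIV n"
  "prod_diff UNIV" tot_scale "C.cochains UNIV" "tot_diff C UNIV"
  "HC scale R" R.HC_class "\<lambda>n. HC scale A1 n \<boxplus> HC scale A2 n" "\<lambda>n. map_prod (A1.HC_class n) (A2.HC_class n)"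
  "HC scale C" C.HC_class \<phi> \<psi> odd
  by (rule sequence) (simp_all add: R.HC_presents A1.HC_presents A2.HC_presents C.HC_presents)

sublocale HH: cochain_sequence tot_scale "R.cochains {0, 1}" "tot_diff R {0, 1}"
  "\<lambda>c. map_prod (tot_scale c) (tot_scale c)" "\<lambda>n. A1.cochains {0, 1} n \<times> A2.cochains {0, 1} n"
  "prod_diff {0, 1}" tot_scale "C.cochains {0, 1}" "tot_diff C {0, 1}"
  "HH scale R" R.HH_class "\<lambda>n. HH scale A1 n \<boxplus> HH scale A2 n" "\<lambda>n. map_prod (A1.HH_class n) (A2.HH_class n)"
  "HH scale C" C.HH_class \<phi> \<psi> odd
  by (rule sequence) (auto simp: R.HH_presents A1.HH_presents A2.HH_presents C.HH_presents)

section \<open>The exact columns and the commuting squares\<close>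

lemma HC_cocycles_prod: "HC.Y.cocycles n = A1.T.cocycles n \<times> A2.T.cocycles n"
  by (rule cocycles_prod) (rule A1.T.cochain_complex_axioms A2.T.cochain_complex_axioms)+

lemma HH_cocycles_prod: "HH.Y.cocycles n = A1.T2.cocycles n \<times> A2.T2.cocycles n"
  by (rule cocycles_prod) (rule A1.T2.cochain_complex_axioms A2.T2.cochain_complex_axioms)+

lemma mv_diff_HC:
  assumes "y \<in> A1.T.cocycles n \<times> A2.T.cocycles n"
  shows "mv_diff (HC scale C) (res_HC scale C) n (map_prod (A1.HC_class n) (A2.HC_class n) y) = C.HC_class n (\<psi> y)"
proof -
  have "0 \<in> tot_diff C UNIV ` C.cochains UNIV (n - 1)"
    using C.T.zero_mem C.T.d_zero by (metis imageI)
  then show ?thesis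
    using assms presents_a_minus[OF C.HC_presents[of n]]
    by (auto simp: mv_diff_def \<psi>_def A1C.res_HC_class A2C.res_HC_class A1C.restrict_cocycle A2C.restrict_cocycle
        C.T.cocycles_add C.T.cocycles_minus)
qed

lemma mv_diff_HH:
  assumes "y \<in> A1.T2.cocycles n \<times> A2.T2.cocycles n"
  shows "mv_diff (HH scale C) (res_HH scale C) n (map_prod (A1.HH_class n) (A2.HH_class n) y) = C.HH_class n (\<psi> y)"
proof -
  have "0 \<in> tot_diff C {0, 1} ` C.cochains {0, 1} (n - 1)"
    using C.T2.zero_mem C.T2.d_zero by (metis imageI)
  then show ?thesis
    using assms presents_a_minus[OF C.HH_presents[of n]]
    by (auto simp: mv_diff_def \<psi>_def A1C.res_HH_class A2C.res_HH_class A1C.restrict_cocycle2 A2C.restrict_cocycle2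
        C.T2.cocycles_add C.T2.cocycles_minus)
qed

lemma Mayer_Vietoris_HC:
  "long_exact (HC scale R) (\<lambda>n. HC scale A1 n \<boxplus> HC scale A2 n) (HC scale C)
    (mv_pair (res_HC scale A1) (res_HC scale A2)) (mv_diff (HC scale C) (res_HC scale C)) HC.connecting"
proof (rule HC.long_exact_cohomology)
  fix n z assume "z \<in> C.T.cocycles n"
  then show "\<exists>y x. HC.snake n z y x \<and> HC.connecting n (C.HC_class n z) = R.HC_class (n + 1) x"
    using HC.snake_ex HC.connecting_eq by blast
qed (simp_all add: HC_cocycles_prod mv_diff_HC mv_pair_def \<phi>_def RA1.res_HC_class RA2.res_HC_class)

lemma Mayer_Vietoris_HH:
  "long_exact (HH scale R) (\<lambda>n. HH scale A1 n \<boxplus> HH scale A2 n) (HH scale C)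
    (mv_pair (res_HH scale A1) (res_HH scale A2)) (mv_diff (HH scale C) (res_HH scale C)) HH.connecting"
proof (rule HH.long_exact_cohomology)
  fix n z assume "z \<in> C.T2.cocycles n"
  then show "\<exists>y x. HH.snake n z y x \<and> HH.connecting n (C.HH_class n z) = R.HH_class (n + 1) x"
    using HH.snake_ex HH.connecting_eq by blast
qed (simp_all add: HH_cocycles_prod mv_diff_HH mv_pair_def \<phi>_def RA1.res_HH_class RA2.res_HH_class)

lemma ladder_restriction:
  "commuting_ladder (HH scale R) (\<lambda>n. HC scale R (n - 1)) (\<lambda>n. HC scale R (n + 1))
      (connes_B scale R) (connes_S scale R) (connes_I scale R)
      (\<lambda>n. map_prod (connes_B scale A1 n) (connes_B scale A2 n))
      (\<lambda>n. map_prod (connes_S scale A1 n) (connes_S scale A2 n))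
      (\<lambda>n. map_prod (connes_I scale A1 n) (connes_I scale A2 n))
      (mv_pair (res_HH scale A1) (res_HH scale A2))
      (\<lambda>n. mv_pair (res_HC scale A1) (res_HC scale A2) (n - 1))
      (\<lambda>n. mv_pair (res_HC scale A1) (res_HC scale A2) (n + 1))"
  by (auto simp: commuting_ladder_def mv_pair_def presentsD(1)[OF R.HH_presents] presentsD(1)[OF R.HC_presents]
      RA1.res_connes_B RA2.res_connes_B RA1.res_connes_S RA2.res_connes_S RA1.res_connes_I RA2.res_connes_I)

lemma \<psi>_boundary:
  "\<psi> (prod_boundary y) = connes_boundary C (\<psi> y)"
  using connes_boundary_add[of C "restr C (fst y)" "- restr C (snd y)"]
  by (cases y) (simp add: \<psi>_def A1C.restrict_boundary A2C.restrict_boundary connes_boundary_minus)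

lemma \<psi>_shift: "\<psi> (map_prod connes_shift connes_shift y) = connes_shift (\<psi> y)"
  using connes_shift_add[of "restr C (fst y)" "- restr C (snd y)"]
  by (cases y) (simp add: \<psi>_def restr_shift connes_shift_minus)

lemma \<psi>_trunc: "\<psi> (map_prod connes_trunc connes_trunc y) = connes_trunc (\<psi> y)"
  using connes_trunc_add[of "restr C (fst y)" "- restr C (snd y)"]
  by (cases y) (simp add: \<psi>_def restr_trunc connes_trunc_minus)

lemma carrier_dsum: "carrier (V \<boxplus> W) = carrier V \<times> carrier W"
  by (simp add: dsum_def)

lemma ladder_difference:
  "commuting_ladder (\<lambda>n. HH scale A1 n \<boxplus> HH scale A2 n)
      (\<lambda>n. HC scale A1 (n - 1) \<boxplus> HC scale A2 (n - 1))
      (\<lambda>n. HC scale A1 (n + 1) \<boxplus> HC scale A2 (n + 1))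
      (\<lambda>n. map_prod (connes_B scale A1 n) (connes_B scale A2 n))
      (\<lambda>n. map_prod (connes_S scale A1 n) (connes_S scale A2 n))
      (\<lambda>n. map_prod (connes_I scale A1 n) (connes_I scale A2 n))
      (connes_B scale C) (connes_S scale C) (connes_I scale C)
      (mv_diff (HH scale C) (res_HH scale C))
      (\<lambda>n. mv_diff (HC scale C) (res_HC scale C) (n - 1))
      (\<lambda>n. mv_diff (HC scale C) (res_HC scale C) (n + 1))"
  unfolding commuting_ladder_def carrier_dsum
proof (intro allI conjI ballI)
  fix n y assume "y \<in> carrier (HH scale A1 n) \<times> carrier (HH scale A2 n)"
  then obtain f where f: "f \<in> A1.T2.cocycles n \<times> A2.T2.cocycles n" "y = map_prod (A1.HH_class n) (A2.HH_class n) f"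
    by (force simp: presentsD(1)[OF A1.HH_presents] presentsD(1)[OF A2.HH_presents])
  have "map_prod (connes_B scale A1 n) (connes_B scale A2 n) y
    = map_prod (A1.HC_class (n - 1)) (A2.HC_class (n - 1)) (prod_boundary f)"
    using f by (auto simp: A1.connes_B_class A2.connes_B_class)
  moreover have "prod_boundary f \<in> A1.T.cocycles (n - 1) \<times> A2.T.cocycles (n - 1)"
    using f(1) A1.connes_boundary_cocycle A2.connes_boundary_cocycle by auto
  \<comment> \<open>The formula for \<open>connes_B\<close> holds on classes of two-column cocycles,
    so the difference of the restrictions has to be one.\<close>
  moreover have "\<psi> f \<in> C.T2.cocycles n"
    using f(1) A1C.restrict_cocycle2[of "fst f" n] C.T2.cocycles_minus[OF A2C.restrict_cocycle2[of "snd f" n]] C.T2.cocycles_add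
    by (auto simp: \<psi>_def) (metis diff_conv_add_uminus)
  ultimately show "mv_diff (HC scale C) (res_HC scale C) (n - 1) (map_prod (connes_B scale A1 n) (connes_B scale A2 n) y)
      = connes_B scale C n (mv_diff (HH scale C) (res_HH scale C) n y)"
    using f by (simp add: mv_diff_HC mv_diff_HH C.connes_B_class \<psi>_boundary)
next
  fix n y assume "y \<in> carrier (HC scale A1 (n - 1)) \<times> carrier (HC scale A2 (n - 1))"
  then obtain f where f: "f \<in> A1.T.cocycles (n - 1) \<times> A2.T.cocycles (n - 1)"
      "y = map_prod (A1.HC_class (n - 1)) (A2.HC_class (n - 1)) f"
    by (force simp: presentsD(1)[OF A1.HC_presents] presentsD(1)[OF A2.HC_presents])
  have "map_prod (connes_S scale A1 n) (connes_S scale A2 n) y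
    = map_prod (A1.HC_class (n + 1)) (A2.HC_class (n + 1)) (map_prod connes_shift connes_shift f)"
    using f by (auto simp: A1.connes_S_class A2.connes_S_class)
  moreover have "map_prod connes_shift connes_shift f \<in> A1.T.cocycles (n + 1) \<times> A2.T.cocycles (n + 1)"
    using f(1) A1.connes_shift_cocycle A2.connes_shift_cocycle by auto
  ultimately show "mv_diff (HC scale C) (res_HC scale C) (n + 1) (map_prod (connes_S scale A1 n) (connes_S scale A2 n) y)
      = connes_S scale C n (mv_diff (HC scale C) (res_HC scale C) (n - 1) y)"
    using f by (simp add: mv_diff_HC C.connes_S_class \<psi>_shift)
next
  fix n y assume "y \<in> carrier (HC scale A1 (n + 1)) \<times> carrier (HC scale A2 (n + 1))"
  then obtain f where f: "f \<in> A1.T.cocycles (n + 1) \<times> A2.T.cocycles (n + 1)"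
      "y = map_prod (A1.HC_class (n + 1)) (A2.HC_class (n + 1)) f"
    by (force simp: presentsD(1)[OF A1.HC_presents] presentsD(1)[OF A2.HC_presents])
  have "map_prod (connes_I scale A1 n) (connes_I scale A2 n) y
    = map_prod (A1.HH_class (n + 1)) (A2.HH_class (n + 1)) (map_prod connes_trunc connes_trunc f)"
    using f by (auto simp: A1.connes_I_class A2.connes_I_class)
  moreover have "map_prod connes_trunc connes_trunc f \<in> A1.T2.cocycles (n + 1) \<times> A2.T2.cocycles (n + 1)"
    using f(1) A1.connes_trunc_cocycle A2.connes_trunc_cocycle by auto
  ultimately show "mv_diff (HH scale C) (res_HH scale C) (n + 1) (map_prod (connes_I scale A1 n) (connes_I scale A2 n) y)
      = connes_I scale C n (mv_diff (HC scale C) (res_HC scale C) (n + 1) y)"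
    using f by (simp add: mv_diff_HC mv_diff_HH C.connes_I_class \<psi>_trunc)
qed

text \<open>Here two connecting maps meet. The boundary anticommutes with the differential, so the
  lift changes sign; passing from degree \<open>n\<close> to \<open>n - 1\<close> flips the parity
  in \<open>sg\<close> and absorbs this sign.\<close>

lemma snake_boundary:
  assumes s: "HH.snake n z y x"
  shows "HC.snake (n - 1) (connes_boundary C z) (- prod_boundary y)
    (connes_boundary R x)"
proof -
  obtain y1 y2 where y: "y = (y1, y2)" by (cases y)
  note s' = s[unfolded HH.snake_def y]
  have y12: "y1 \<in> A1.cochains {0, 1} n" "y2 \<in> A2.cochains {0, 1} n"
    and x: "x \<in> R.T2.cocycles (n + 1)"
    and \<phi>x: "restr A1 x = tot_diff A1 {0, 1} y1" "restr A2 x = tot_diff A2 {0, 1} y2"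
    using s' by (auto simp: \<phi>_def)
  have "\<phi> (connes_boundary R x) = prod_diff UNIV
      (- prod_boundary y)"
    by (simp add: \<phi>_def y RA1.restrict_boundary RA2.restrict_boundary \<phi>x A1.connes_boundary_diff
        A2.connes_boundary_diff A1.T.d_minus A2.T.d_minus)
  moreover have "\<psi> (- prod_boundary y) = HC.sg (n - 1) (connes_boundary C z)"
    using s by (simp add: HH.snake_def HC.\<psi>_minus \<psi>_boundary HC.sg_def HH.sg_def connes_boundary_minus)
  moreover have "- prod_boundary y
      \<in> A1.cochains UNIV (n - 1) \<times> A2.cochains UNIV (n - 1)"
    using y12 by (simp add: y A1.T.minus_mem A2.T.minus_mem A1.connes_boundary_mem A2.connes_boundary_mem)
  moreover have "connes_boundary R x \<in> R.T.cocycles (n - 1 + 1)"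
    using R.connes_boundary_cocycle[OF x] by simp
  ultimately show ?thesis by (simp add: HC.snake_def)
qed

text \<open>The degrees \<open>n - 1\<close> and \<open>n + 1\<close> have the same parity, so both
  snakes carry the same sign.\<close>

lemma snake_shift:
  assumes s: "HC.snake (n - 1) z y x"
  shows "HC.snake (n + 1) (connes_shift z) (map_prod connes_shift connes_shift y) (connes_shift x)"
proof -
  obtain y1 y2 where y: "y = (y1, y2)" by (cases y)
  note s' = s[unfolded HC.snake_def y]
  have "connes_shift x \<in> R.T.cocycles (n + 1 + 1)"
    using s' R.connes_shift_cocycle[of x "n + 1"] by simp
  moreover have "\<phi> (connes_shift x) = prod_diff UNIV (map_prod connes_shift connes_shift y)"
    using s' by (simp add: \<phi>_def y restr_shift A1.connes_shift_diff A2.connes_shift_diff)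
  ultimately show ?thesis
    using s' A1.connes_shift_mem[of y1 "n + 1"] A2.connes_shift_mem[of y2 "n + 1"] \<psi>_shift[of y]
    by (auto simp: HC.snake_def y HC.sg_def connes_shift_minus)
qed

lemma snake_trunc:
  assumes s: "HC.snake n z y x"
  shows "HH.snake n (connes_trunc z) (map_prod connes_trunc connes_trunc y) (connes_trunc x)"
proof -
  obtain y1 y2 where y: "y = (y1, y2)" by (cases y)
  note s' = s[unfolded HC.snake_def y]
  have "\<phi> (connes_trunc x) = prod_diff {0, 1} (map_prod connes_trunc connes_trunc y)"
    using s' by (simp add: \<phi>_def y restr_trunc A1.connes_trunc_diff A2.connes_trunc_diff)
  then show ?thesis
    using s' A1.connes_trunc_mem[of y1 n] A2.connes_trunc_mem[of y2 n] \<psi>_trunc[of y] R.connes_trunc_cocycle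
    by (auto simp: HC.snake_def HH.snake_def y HC.sg_def HH.sg_def connes_trunc_minus)
qed

text \<open>The cochain maps behind \<open>B\<close>, \<open>S\<close> and \<open>I\<close> take
  snakes to snakes, and a connecting map can be read off from any snake.\<close>

lemma ladder_connecting:
  "commuting_ladder (HH scale C) (\<lambda>n. HC scale C (n - 1)) (\<lambda>n. HC scale C (n + 1))
      (connes_B scale C) (connes_S scale C) (connes_I scale C)
      (\<lambda>n. connes_B scale R (n + 1)) (\<lambda>n. connes_S scale R (n + 1)) (\<lambda>n. connes_I scale R (n + 1))
      HH.connecting (\<lambda>n. HC.connecting (n - 1)) (\<lambda>n. HC.connecting (n + 1))"
  unfolding commuting_ladder_def
proof (intro allI conjI ballI)
  fix n U assume "U \<in> carrier (HH scale C n)"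
  then obtain z where z: "z \<in> C.T2.cocycles n" "U = C.HH_class n z" by (auto simp: presentsD(1)[OF C.HH_presents])
  obtain y x where s: "HH.snake n z y x" using HH.snake_ex[OF z(1)] by blast
  then have x: "x \<in> R.T2.cocycles (n + 1)" by (simp add: HH.snake_def)
  show "HC.connecting (n - 1) (connes_B scale C n U) = connes_B scale R (n + 1) (HH.connecting n U)"
    using HC.connecting_eq[OF C.connes_boundary_cocycle[OF z(1)] snake_boundary[OF s]] R.connes_B_class[OF x]
    by (simp add: z(2) HH.connecting_eq[OF z(1) s] C.connes_B_class[OF z(1)])
next
  fix n U assume "U \<in> carrier (HC scale C (n - 1))"
  then obtain z where z: "z \<in> C.T.cocycles (n - 1)" "U = C.HC_class (n - 1) z" by (auto simp: presentsD(1)[OF C.HC_presents])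
  obtain y x where s: "HC.snake (n - 1) z y x" using HC.snake_ex[OF z(1)] by blast
  show "HC.connecting (n + 1) (connes_S scale C n U) = connes_S scale R (n + 1) (HC.connecting (n - 1) U)"
    using HC.connecting_eq[OF C.connes_shift_cocycle[OF z(1)] snake_shift[OF s]] R.connes_S_class[of "n + 1" x]
    by (simp add: z(2) HC.connecting_eq[OF z(1) s] C.connes_S_class)
next
  fix n U assume "U \<in> carrier (HC scale C (n + 1))"
  then obtain z where z: "z \<in> C.T.cocycles (n + 1)" "U = C.HC_class (n + 1) z" by (auto simp: presentsD(1)[OF C.HC_presents])
  obtain y x where s: "HC.snake (n + 1) z y x" using HC.snake_ex[OF z(1)] by blast
  show "HH.connecting (n + 1) (connes_I scale C n U) = connes_I scale R (n + 1) (HC.connecting (n + 1) U)"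
    using HH.connecting_eq[OF C.connes_trunc_cocycle[OF z(1)] snake_trunc[OF s]] R.connes_I_class[of "n + 1" x]
    by (simp add: z(2) HC.connecting_eq[OF z(1) s] C.connes_I_class)
qed

end

section \<open>Corner algebras\<close>

lemma corner_iff:
  assumes "u * u = (u :: 'r::ring)"
  shows "x \<in> corner u \<longleftrightarrow> u * x * u = x"
proof
  assume "x \<in> corner u"
  then obtain y where "x = u * y * u" by (auto simp: corner_def)
  then show "u * x * u = x" by (metis assms mult.assoc)
qed (metis corner_def rangeI)

lemma corner_mult:
  assumes "u * u = (u :: 'r::ring)" "x \<in> corner u"
  shows "u * x = x" "x * u = x"
proof -
  have x: "x = u * x * u" using assms by (simp add: corner_iff)
  show "u * x = x" by (subst (1 2) x) (simp add: assms(1) flip: mult.assoc)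
  show "x * u = x" by (subst (1 2) x) (simp add: assms(1) mult.assoc)
qed

lemma (in k_algebra) corner_carrier:
  assumes "u * u = u"
  shows "algebra_carrier scale (corner u) u"
proof
  fix x y c
  show "0 \<in> corner u" "u \<in> corner u" by (simp_all add: corner_iff assms)
  show "x + y \<in> corner u" if "x \<in> corner u" "y \<in> corner u"
    using that by (simp add: corner_iff assms distrib_left distrib_right)
  show "scale c x \<in> corner u" if "x \<in> corner u"
    using that by (simp add: corner_iff assms scale_mult_left scale_mult_right)
  show "x * y \<in> corner u" if "x \<in> corner u" "y \<in> corner u"
    using corner_mult[OF assms that(1)] corner_mult[OF assms that(2)]
    by (simp add: corner_iff assms mult.assoc) (simp flip: mult.assoc)
qed (simp_all add: scale_mult_left scale_mult_right corner_mult[OF assms])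

lemma (in k_algebra) UNIV_carrier: "algebra_carrier scale UNIV unit"
  by unfold_locales (simp_all add: scale_mult_left scale_mult_right unit_left unit_right)

lemma (in k_algebra) linear_retraction_corner:
  assumes "u * u = u"
  shows "linear_retraction scale UNIV (corner u) (\<lambda>x. u * x * u)"
  using assms
  by (auto simp: linear_retraction_def corner_iff distrib_left distrib_right scale_mult_left scale_mult_right)
    (metis mult.assoc)

lemma (in k_algebra) oriented_mayer_vietoris:
  fixes e e1' e2' :: 'r
  defines "v \<equiv> \<lambda>i::nat. if i = 0 then e1' else if i = 1 then e else e2'"
  assumes "oriented unit e e1' e2'"
  shows "\<exists>\<rho>. mayer_vietoris scale UNIV unit {0, 1, 2} v (corner (e1' + e)) (corner (e2' + e)) \<rho>
    (e1' + e) (e2' + e) (corner e) e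
    (\<lambda>x. (e1' + e) * x * (e1' + e)) (\<lambda>x. (e2' + e) * x * (e2' + e)) (\<lambda>x. e * x * e)"
proof -
  have idem: "e * e = e" "e1' * e1' = e1'" "e2' * e2' = e2'"
    and orth: "e * e1' = 0" "e1' * e = 0" "e * e2' = 0" "e2' * e = 0" "e1' * e2' = 0" "e2' * e1' = 0"
    and unit: "unit = e1' + e + e2'"
    and cross: "\<And>x. e1' * x * e2' = 0" "\<And>x. e2' * x * e1' = 0"
    and cases: "(\<forall>x. e * x * e1' = 0) \<and> (\<forall>x. e * x * e2' = 0) \<or>
      (\<forall>x. e1' * x * e = 0) \<and> (\<forall>x. e2' * x * e = 0) \<or>
      (\<forall>x. e1' * x * e = 0) \<and> (\<forall>x. e * x * e2' = 0)"
    using assms(2) by (auto simp: oriented_def)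
  let ?e1 = "e1' + e" and ?e2 = "e2' + e"
  have idem': "?e1 * ?e1 = ?e1" "?e2 * ?e2 = ?e2"
    by (simp_all add: distrib_left distrib_right idem orth)
  have zero: "x * c = 0" "c * x = 0" if "x \<in> corner w" "w * w = w" "w * c = 0" "c * w = 0" for x c w :: 'r
    using corner_mult[OF that(2,1)] that(3,4) by (metis mult.assoc mult_zero_left mult_zero_right)+
  have zero1: "x * e2' = 0" "e2' * x = 0" if "x \<in> corner ?e1" for x
    using zero[OF that idem'(1), of e2'] by (simp_all add: distrib_left distrib_right orth)
  have zero2: "x * e1' = 0" "e1' * x = 0" if "x \<in> corner ?e2" for x
    using zero[OF that idem'(2), of e1'] by (simp_all add: distrib_left distrib_right orth)
  have in1: "e1' \<in> corner ?e1" "e \<in> corner ?e1" and in2: "e2' \<in> corner ?e2" "e \<in> corner ?e2"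
    by (simp_all add: corner_iff idem' distrib_left distrib_right idem orth)
  \<comment> \<open>Loops at an idempotent below \<open>w\<close> lie in the corner of
    \<open>w\<close>.\<close>
  have loop: "x \<in> corner w" if "i * x * i = x" "w * i = i" "i * w = i" "w * w = w" for i w x :: 'r
    unfolding corner_iff[OF that(4)] using that(1-3) by (metis mult.assoc)
  have sub: "corner e \<subseteq> corner ?e1" "corner e \<subseteq> corner ?e2"
  proof -
    have "corner e \<subseteq> corner w" if "w * e = e" "e * w = e" "w * w = w" for w
      using loop[of e _ w] that corner_iff[OF idem(1)] by auto
    from this[OF _ _ idem'(1)] this[OF _ _ idem'(2)] show "corner e \<subseteq> corner ?e1" "corner e \<subseteq> corner ?e2"
      by (simp_all add: distrib_left distrib_right idem orth)
  qed
  \<comment> \<open>Nonzero steps between different vertices must go upwards: \<open>e\<close> is on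
    top in the first case and at the bottom in the second; in the third the ascending order is
    \<open>e2'\<close>, \<open>e\<close>, \<open>e1'\<close>.\<close>
  obtain \<rho> :: "nat \<Rightarrow> nat" where rank: "\<And>i l x. \<lbrakk>i \<in> {0, 1, 2}; l \<in> {0, 1, 2}; i \<noteq> l; \<rho> l \<le> \<rho> i\<rbrakk> \<Longrightarrow> v i * x * v l = 0"
  proof -
    from cases show ?thesis
    proof (elim disjE)
      assume "(\<forall>x. e * x * e1' = 0) \<and> (\<forall>x. e * x * e2' = 0)"
      then show ?thesis
        by (intro that[of "\<lambda>i. if i = 1 then 1 else 0"]) (auto simp: v_def cross split: if_splits)
    next
      assume "(\<forall>x. e1' * x * e = 0) \<and> (\<forall>x. e2' * x * e = 0)"
      then show ?thesis
        by (intro that[of "\<lambda>i. if i = 1 then 0 else 1"]) (auto simp: v_def cross split: if_splits)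
    next
      assume "(\<forall>x. e1' * x * e = 0) \<and> (\<forall>x. e * x * e2' = 0)"
      then show ?thesis
        by (intro that[of "\<lambda>i. 2 - i"]) (auto simp: v_def cross split: if_splits)
    qed
  qed
  interpret U: algebra_carrier scale UNIV unit by (rule UNIV_carrier)
  interpret A1: algebra_carrier scale "corner ?e1" ?e1 by (rule corner_carrier[OF idem'(1)])
  interpret A2: algebra_carrier scale "corner ?e2" ?e2 by (rule corner_carrier[OF idem'(2)])
  have "idempotent_cover scale UNIV unit {0, 1, 2} v {corner ?e1, corner ?e2} \<rho>"
  proof unfold_locales
    fix i j :: nat and B and x y
    show "v i * v i = v i" by (simp add: v_def idem)
    show "sum v {0, 1, 2} = unit" by (simp add: v_def unit add.assoc)
    assume B: "B \<in> {corner ?e1, corner ?e2}"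
    then show "0 \<in> B" using A1.zero_in A2.zero_in by auto
    show "x * y \<in> B" if "x \<in> B" "y \<in> B" using B that A1.mult_in A2.mult_in by auto
    show "v i \<in> B \<or> (\<forall>x\<in>B. x * v i = 0)"
      using B in1 in2 zero1 zero2 by (auto simp: v_def)
  next
    fix i :: nat assume i: "i \<in> {0, 1, 2}"
    have "?e1 * e1' = e1'" "e1' * ?e1 = e1'" "?e1 * e = e" "e * ?e1 = e" "?e2 * e2' = e2'" "e2' * ?e2 = e2'"
      by (simp_all add: distrib_left distrib_right idem orth)
    then show "\<exists>B\<in>{corner ?e1, corner ?e2}. \<forall>x\<in>UNIV. v i * x * v i = x \<longrightarrow> x \<in> B"
      using i loop[of e1' _ ?e1] loop[of e _ ?e1] loop[of e2' _ ?e2] idem' by (auto simp: v_def)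
  qed (use rank in auto)
  moreover have "mayer_vietoris_axioms scale UNIV (corner ?e1) (corner ?e2) (corner e)
    (\<lambda>x. ?e1 * x * ?e1) (\<lambda>x. ?e2 * x * ?e2) (\<lambda>x. e * x * e)"
  proof
    \<comment> \<open>\<open>e2'\<close> annihilates this corner from both sides, so only the term
      with \<open>e\<close> on either side survives.\<close>
    show "?e2 * x * ?e2 = e * x * e" if "x \<in> corner ?e1" for x
      using zero1[OF that] by (simp add: distrib_left distrib_right mult.assoc)
    show "?e1 * x * ?e1 = e * x * e" if "x \<in> corner ?e2" for x
      using zero2[OF that] by (simp add: distrib_left distrib_right mult.assoc)
  qed (use sub linear_retraction_corner idem idem' in auto)
  ultimately show ?thesis
    using A1.algebra_carrier_axioms A2.algebra_carrier_axioms corner_carrier[OF idem(1)]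
    by (intro exI[of _ \<rho>] mayer_vietoris.intro)
qed

theorem theorem3p9:
  fixes scale :: "'k::field \<Rightarrow> 'r::ring \<Rightarrow> 'r"
    and unit e e1' e2' :: 'r
    and R A1 A2 C :: "'r set"
  assumes "k_algebra scale unit"
    and "oriented unit e e1' e2'"
    and R: "R = UNIV"
    and A1: "A1 = corner (e1' + e)"
    and A2: "A2 = corner (e2' + e)"
    and C: "C = corner e"
  shows "\<exists>\<delta>H \<delta>C.
    \<comment> \<open>rows: the Connes sequences\<close>
    long_exact (HH scale R) (\<lambda>n. HC scale R (n - 1)) (\<lambda>n. HC scale R (n + 1))
      (connes_B scale R) (connes_S scale R) (connes_I scale R) \<and>
    long_exact (\<lambda>n. HH scale A1 n \<boxplus> HH scale A2 n)
      (\<lambda>n. HC scale A1 (n - 1) \<boxplus> HC scale A2 (n - 1))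
      (\<lambda>n. HC scale A1 (n + 1) \<boxplus> HC scale A2 (n + 1))
      (\<lambda>n. map_prod (connes_B scale A1 n) (connes_B scale A2 n))
      (\<lambda>n. map_prod (connes_S scale A1 n) (connes_S scale A2 n))
      (\<lambda>n. map_prod (connes_I scale A1 n) (connes_I scale A2 n)) \<and>
    long_exact (HH scale C) (\<lambda>n. HC scale C (n - 1)) (\<lambda>n. HC scale C (n + 1))
      (connes_B scale C) (connes_S scale C) (connes_I scale C) \<and>
    \<comment> \<open>columns: the Mayer--Vietoris sequences\<close>
    long_exact (HH scale R) (\<lambda>n. HH scale A1 n \<boxplus> HH scale A2 n) (HH scale C)
      (mv_pair (res_HH scale A1) (res_HH scale A2)) (mv_diff (HH scale C) (res_HH scale C)) \<delta>H \<and>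
    long_exact (HC scale R) (\<lambda>n. HC scale A1 n \<boxplus> HC scale A2 n) (HC scale C)
      (mv_pair (res_HC scale A1) (res_HC scale A2)) (mv_diff (HC scale C) (res_HC scale C)) \<delta>C \<and>
    \<comment> \<open>squares between the rows of \<open>R\<close> and of \<open>A1, A2\<close>\<close>
    commuting_ladder (HH scale R) (\<lambda>n. HC scale R (n - 1)) (\<lambda>n. HC scale R (n + 1))
      (connes_B scale R) (connes_S scale R) (connes_I scale R)
      (\<lambda>n. map_prod (connes_B scale A1 n) (connes_B scale A2 n))
      (\<lambda>n. map_prod (connes_S scale A1 n) (connes_S scale A2 n))
      (\<lambda>n. map_prod (connes_I scale A1 n) (connes_I scale A2 n))
      (mv_pair (res_HH scale A1) (res_HH scale A2))
      (\<lambda>n. mv_pair (res_HC scale A1) (res_HC scale A2) (n - 1))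
      (\<lambda>n. mv_pair (res_HC scale A1) (res_HC scale A2) (n + 1)) \<and>
    \<comment> \<open>squares between the rows of \<open>A1, A2\<close> and of \<open>C\<close>\<close>
    commuting_ladder (\<lambda>n. HH scale A1 n \<boxplus> HH scale A2 n)
      (\<lambda>n. HC scale A1 (n - 1) \<boxplus> HC scale A2 (n - 1))
      (\<lambda>n. HC scale A1 (n + 1) \<boxplus> HC scale A2 (n + 1))
      (\<lambda>n. map_prod (connes_B scale A1 n) (connes_B scale A2 n))
      (\<lambda>n. map_prod (connes_S scale A1 n) (connes_S scale A2 n))
      (\<lambda>n. map_prod (connes_I scale A1 n) (connes_I scale A2 n))
      (connes_B scale C) (connes_S scale C) (connes_I scale C)
      (mv_diff (HH scale C) (res_HH scale C))
      (\<lambda>n. mv_diff (HC scale C) (res_HC scale C) (n - 1))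
      (\<lambda>n. mv_diff (HC scale C) (res_HC scale C) (n + 1)) \<and>
    \<comment> \<open>squares between the row of \<open>C\<close> and the next row of \<open>R\<close>\<close>
    commuting_ladder (HH scale C) (\<lambda>n. HC scale C (n - 1)) (\<lambda>n. HC scale C (n + 1))
      (connes_B scale C) (connes_S scale C) (connes_I scale C)
      (\<lambda>n. connes_B scale R (n + 1)) (\<lambda>n. connes_S scale R (n + 1)) (\<lambda>n. connes_I scale R (n + 1))
      \<delta>H (\<lambda>n. \<delta>C (n - 1)) (\<lambda>n. \<delta>C (n + 1))"
proof -
  interpret k_algebra scale unit by fact
  obtain v :: "nat \<Rightarrow> 'r" and \<rho> where "mayer_vietoris scale R unit {0, 1, 2} v A1 A2 \<rho>
      (e1' + e) (e2' + e) C e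
      (\<lambda>x. (e1' + e) * x * (e1' + e)) (\<lambda>x. (e2' + e) * x * (e2' + e)) (\<lambda>x. e * x * e)"
    using oriented_mayer_vietoris[OF assms(2)] unfolding R A1 A2 C by blast
  then interpret mayer_vietoris scale R unit "{0, 1, 2}" v A1 A2 \<rho> "e1' + e" "e2' + e" C e
    "\<lambda>x. (e1' + e) * x * (e1' + e)" "\<lambda>x. (e2' + e) * x * (e2' + e)" "\<lambda>x. e * x * e" .
  show ?thesis
    by (intro exI[of _ HH.connecting] exI[of _ HC.connecting] conjI
        R.Connes_long_exact long_exact_dsum A1.Connes_long_exact A2.Connes_long_exact
        C.Connes_long_exact Mayer_Vietoris_HH Mayer_Vietoris_HC
        ladder_restriction ladder_difference ladder_connecting)
qed

end
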